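(* Let $n\in\mathbb{N}$ and $r\in(0,+\infty]$. There exists a topological algebra isomorphism $\mathcal{O}_{\mathrm{def}}(\mathbb{D}^n_r)\to D_{n,r}$ uniquely determined by $z\mapsto z$, $x_i\mapsto x_i$ ($i=1,\dots,n$).
   Context: All algebras are complex, associative and unital; a Fréchet algebra is a complete metrizable locally convex algebra. $\mathbb{C}^\times=\mathbb{C}\setminus\{0\}$, $\mathbb{Z}_+=\{0,1,\dots\}$. Definition of $\mathcal{O}_{\mathrm{def}}(\mathbb{D}^n_r)$. $W_{n,d}=\{1,\dots,n\}^d$, $W_n=\bigsqcup_{d\ge0}W_{n,d}$, $|\alpha|=d$ for $\alpha\in W_{n,d}$, $\zeta_\alpha=\zeta_{\alpha_1}\cdots\zeta_{\alpha_d}$. $\mathrm{s}(\alpha)=\mathrm{card}\{i\in\{1,\dots,d-1\}:\alpha_i\ne\alpha_{i+1}\}$ if $d=|\alpha|\ge2$, and $\mathrm{s}(\alpha)=|\alpha|-1$ if $|\alpha|\le1$. $\mathcal{F}(\mathbb{D}^n_r)$ is the Fréchet algebra of all formal series $a=\sum_{\alpha\in W_n}c_\alpha\zeta_\alpha$ in free variables $\zeta_1,\dots,\zeta_n$ with $\|a\|_{\rho,\tau}=\sum_\alpha|c_\alpha|\rho^{|\alpha|}\tau^{\mathrm{s}(\alpha)+1}<\infty$ for all $\rho\in(0,r)$, $\tau\ge1$, with the obvious multiplication and the topology given by these norms (a concrete form of the Arens-Michael free product of $n$ copies of the algebra of holomorphic functions on the disk of radius $r$). $\mathcal{O}(\mathbb{C}^\times,\mathcal{F}(\mathbb{D}^n_r))$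 is the Fréchet algebra of holomorphic $\mathcal{F}(\mathbb{D}^n_r)$-valued functions on $\mathbb{C}^\times$ (compact-open topology); $\mathcal{F}(\mathbb{D}^n_r)$ embeds as constants and $z\in\mathcal{O}(\mathbb{C}^\times)$ is the coordinate. $I_{\mathbb{D}}$ is its closed two-sided ideal generated by $\zeta_i\zeta_j-z\zeta_j\zeta_i$ ($i<j$), and $\mathcal{O}_{\mathrm{def}}(\mathbb{D}^n_r)=\mathcal{O}(\mathbb{C}^\times,\mathcal{F}(\mathbb{D}^n_r))/I_{\mathbb{D}}$. The classes of $\zeta_i$ and $z$ are denoted $x_i$ and $z$. Definition of $D_{n,r}$. Define $\omega\colon\mathbb{Z}_+^n\times\mathbb{Z}\to\mathbb{R}$ by: $\omega(k,p)=p$ if $p\ge0$; $\omega(k,p)=0$ if $p<0$ and $p+\sum_{i<j}k_ik_j\ge0$; $\omega(k,p)=p+\sum_{i<j}k_ik_j$ if $p+\sum_{i<j}k_ik_j<0$. Let $$D_{n,r}=\Bigl\{a=\sum_{k\in\mathbb{Z}_+^n,\,p\in\mathbb{Z}}c_{kp}x^kz^p:\ \|a\|_{\rho,\tau}=\sum_{k,p}|c_{kp}|\rho^{|k|}\tau^{|\omega(k,p)|}<\infty\ \ \forall\rho\in(0,r),\ \forall\tau\ge1\Bigr\}$$ (formal series; $x^k=x_1^{k_1}\cdots x_n^{k_n}$, $|k|=k_1+\dots+k_n$), a Fréchet space for the norms $\|\cdot\|_{\rho,\tau}$, with the unique continuous multiplication extending that of its dense subspace of finite sums, identified with the algebra generated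 by $x_1,\dots,x_n,z,z^{-1}$ with relations $x_ix_j=zx_jx_i$ ($i<j$), $x_iz=zx_i$, $zz^{-1}=z^{-1}z=1$ (of which $\{x^kz^p\}$ is a vector space basis). The norms $\|\cdot\|_{\rho,\tau}$ on $D_{n,r}$ are submultiplicative. *)

theory Defs
  imports
    "HOL-Analysis.Analysis"
    "HOL-Algebra.QuotRing"
    "HOL-Algebra.Module"
    "HOL-Library.Function_Algebras"
begin

section \<open>Topological algebras\<close>

record ('a, 'b) top_algebra = "('a, 'b) module" +
  alg_top :: "'b topology"

text \<open>
  The locally convex topology on a vector space \<open>V\<close> defined by a family \<open>P\<close> of seminorms.
\<close>

definition seminorm_topology :: "'b::minus set \<Rightarrow> ('b \<Rightarrow> real) set \<Rightarrow> 'b topology" where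
  "seminorm_topology V P = topology (\<lambda>U. U \<subseteq> V \<and>
     (\<forall>x\<in>U. \<exists>Q \<epsilon>. finite Q \<and> Q \<subseteq> P \<and> \<epsilon> > 0 \<and> {y \<in> V. \<forall>p\<in>Q. p (y - x) < \<epsilon>} \<subseteq> U))"

lemma istopology_seminorm:
  "istopology (\<lambda>U. U \<subseteq> V \<and>
     (\<forall>x\<in>U. \<exists>Q \<epsilon>. finite Q \<and> Q \<subseteq> P \<and> \<epsilon> > (0::real) \<and> {y \<in> V. \<forall>p\<in>Q. p (y - x) < \<epsilon>} \<subseteq> U))"
  (is "istopology ?L")
proof -
  have "?L (S \<inter> T)" if S: "?L S" and T: "?L T" for S T
  proof (intro conjI ballI)
    show "S \<inter> T \<subseteq> V" using S by blast
    fix x assume x: "x \<in> S \<inter> T"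
    obtain Q1 e1 where 1: "finite Q1" "Q1 \<subseteq> P" "e1 > 0" "{y \<in> V. \<forall>p\<in>Q1. p (y - x) < e1} \<subseteq> S"
      using S x by (meson IntD1)
    obtain Q2 e2 where 2: "finite Q2" "Q2 \<subseteq> P" "e2 > 0" "{y \<in> V. \<forall>p\<in>Q2. p (y - x) < e2} \<subseteq> T"
      using T x by (meson IntD2)
    show "\<exists>Q \<epsilon>. finite Q \<and> Q \<subseteq> P \<and> \<epsilon> > 0 \<and> {y \<in> V. \<forall>p\<in>Q. p (y - x) < \<epsilon>} \<subseteq> S \<inter> T"
      by (rule exI[of _ "Q1 \<union> Q2"], rule exI[of _ "min e1 e2"]) (use 1 2 in auto)
  qed
  moreover have "?L (\<Union>K)" if K: "\<forall>S\<in>K. ?L S" for K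
  proof (intro conjI ballI)
    show "\<Union>K \<subseteq> V" using K by blast
    fix x assume "x \<in> \<Union>K"
    then obtain S where S: "S \<in> K" "x \<in> S" by blast
    then obtain Q \<epsilon> where "finite Q" "Q \<subseteq> P" "\<epsilon> > 0" "{y \<in> V. \<forall>p\<in>Q. p (y - x) < \<epsilon>} \<subseteq> S"
      using K by meson
    then show "\<exists>Q \<epsilon>. finite Q \<and> Q \<subseteq> P \<and> \<epsilon> > 0 \<and> {y \<in> V. \<forall>p\<in>Q. p (y - x) < \<epsilon>} \<subseteq> \<Union>K"
      using S(1) by (intro exI[of _ Q] exI[of _ \<epsilon>]) auto
  qed
  ultimately show ?thesis unfolding istopology_def by presburger
qed

lemma openin_seminorm_topology:
  "openin (seminorm_topology V P) U \<longleftrightarrow> U \<subseteq> V \<and>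
     (\<forall>x\<in>U. \<exists>Q \<epsilon>. finite Q \<and> Q \<subseteq> P \<and> \<epsilon> > 0 \<and> {y \<in> V. \<forall>p\<in>Q. p (y - x) < \<epsilon>} \<subseteq> U)"
  unfolding seminorm_topology_def topology_inverse'[OF istopology_seminorm] ..

lemma topspace_seminorm_topology [simp]: "topspace (seminorm_topology V P) = V"
proof
  show "topspace (seminorm_topology V P) \<subseteq> V"
    by (meson openin_seminorm_topology openin_topspace)
  have "openin (seminorm_topology V P) V"
    unfolding openin_seminorm_topology
  proof (intro conjI ballI subset_refl)
    fix x
    show "\<exists>Q \<epsilon>. finite Q \<and> Q \<subseteq> P \<and> \<epsilon> > 0 \<and> {y \<in> V. \<forall>p\<in>Q. p (y - x) < \<epsilon>} \<subseteq> V"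
      by (rule exI[of _ "{}"], rule exI[of _ "1 :: real"]) simp
  qed
  then show "V \<subseteq> topspace (seminorm_topology V P)" by (rule openin_subset)
qed

text \<open>
  A two-sided ideal of a unital algebra is automatically a linear subspace, so the
  library's ring ideals can be used.
\<close>

definition closed_ideal_gen :: "('a, 'b) top_algebra \<Rightarrow> 'b set \<Rightarrow> 'b set" where
  "closed_ideal_gen A S = \<Inter>{I. ideal I A \<and> closedin (alg_top A) I \<and> S \<subseteq> I}"

definition quot_topology :: "('a, 'b) top_algebra \<Rightarrow> 'b set \<Rightarrow> 'b set topology" where
  "quot_topology A I = topology (\<lambda>U. U \<subseteq> carrier (A Quot I) \<and>
     openin (alg_top A) {a \<in> carrier A. I +>\<^bsub>A\<^esub> a \<in> U})"

lemma openin_quot_topology: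
  "openin (quot_topology A I) U \<longleftrightarrow> U \<subseteq> carrier (A Quot I) \<and>
     openin (alg_top A) {a \<in> carrier A. I +>\<^bsub>A\<^esub> a \<in> U}"
proof -
  have "istopology (\<lambda>U. U \<subseteq> carrier (A Quot I) \<and>
     openin (alg_top A) {a \<in> carrier A. I +>\<^bsub>A\<^esub> a \<in> U})" (is "istopology ?L")
    unfolding istopology_def
  proof (intro conjI allI impI)
    fix S T assume "?L S" "?L T"
    moreover have "{a \<in> carrier A. I +>\<^bsub>A\<^esub> a \<in> S \<inter> T} =
        {a \<in> carrier A. I +>\<^bsub>A\<^esub> a \<in> S} \<inter> {a \<in> carrier A. I +>\<^bsub>A\<^esub> a \<in> T}" by blast
    ultimately show "S \<inter> T \<subseteq> carrier (A Quot I)"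
      "openin (alg_top A) {a \<in> carrier A. I +>\<^bsub>A\<^esub> a \<in> S \<inter> T}" by auto
  next
    fix K assume "\<forall>S\<in>K. ?L S"
    moreover have "{a \<in> carrier A. I +>\<^bsub>A\<^esub> a \<in> \<Union>K} = (\<Union>S\<in>K. {a \<in> carrier A. I +>\<^bsub>A\<^esub> a \<in> S})"
      by blast
    ultimately show "\<Union>K \<subseteq> carrier (A Quot I)"
      "openin (alg_top A) {a \<in> carrier A. I +>\<^bsub>A\<^esub> a \<in> \<Union>K}" by auto
  qed
  then show ?thesis unfolding quot_topology_def by (simp add: topology_inverse')
qed

definition quot_algebra :: "('a, 'b) top_algebra \<Rightarrow> 'b set \<Rightarrow> ('a, 'b set) top_algebra" where
  "quot_algebra A I = \<lparr>
     carrier = carrier (A Quot I),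
     mult = mult (A Quot I),
     one = one (A Quot I),
     zero = zero (A Quot I),
     add = add (A Quot I),
     smult = (\<lambda>c X. \<Union>x\<in>X. I +>\<^bsub>A\<^esub> (c \<odot>\<^bsub>A\<^esub> x)),
     alg_top = quot_topology A I\<rparr>"

definition top_algebra_iso ::
    "('a, 'b) top_algebra \<Rightarrow> ('a, 'c) top_algebra \<Rightarrow> ('b \<Rightarrow> 'c) \<Rightarrow> bool" where
  "top_algebra_iso A B \<phi> \<longleftrightarrow>
     \<phi> \<in> ring_iso A B \<and>
     (\<forall>c. \<forall>a\<in>carrier A. \<phi> (c \<odot>\<^bsub>A\<^esub> a) = c \<odot>\<^bsub>B\<^esub> \<phi> a) \<and>
     homeomorphic_map (alg_top A) (alg_top B) \<phi>"


section \<open>The algebra of free power series on the polydisk\<close>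

type_synonym free_series = "nat list \<Rightarrow> complex"

definition words :: "nat \<Rightarrow> nat list set" where
  "words n = {\<alpha>. set \<alpha> \<subseteq> {1..n}}"

definition switches :: "nat list \<Rightarrow> int" where
  "switches \<alpha> = (if length \<alpha> \<ge> 2 then int (card {i. Suc i < length \<alpha> \<and> \<alpha> ! i \<noteq> \<alpha> ! Suc i})
                 else int (length \<alpha>) - 1)"

definition free_term :: "real \<Rightarrow> real \<Rightarrow> free_series \<Rightarrow> nat list \<Rightarrow> real" where
  "free_term \<rho> \<tau> a \<alpha> = cmod (a \<alpha>) * \<rho> ^ length \<alpha> * \<tau> ^ nat (switches \<alpha> + 1)"

definition free_norm :: "nat \<Rightarrow> real \<Rightarrow> real \<Rightarrow> free_series \<Rightarrow> real" where
  "free_norm n \<rho> \<tau> a = (\<Sum>\<^sub>\<infinity>\<alpha>\<in>words n. free_term \<rho> \<tau> a \<alpha>)"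

definition params :: "ereal \<Rightarrow> (real \<times> real) set" where
  "params r = {(\<rho>, \<tau>). 0 < \<rho> \<and> ereal \<rho> < r \<and> 1 \<le> \<tau>}"

definition free_carrier :: "nat \<Rightarrow> ereal \<Rightarrow> free_series set" where
  "free_carrier n r = {a. (\<forall>\<alpha>. \<alpha> \<notin> words n \<longrightarrow> a \<alpha> = 0) \<and>
     (\<forall>(\<rho>, \<tau>)\<in>params r. free_term \<rho> \<tau> a summable_on words n)}"

definition free_mult :: "free_series \<Rightarrow> free_series \<Rightarrow> free_series" where
  "free_mult a b = (\<lambda>\<alpha>. \<Sum>i\<le>length \<alpha>. a (take i \<alpha>) * b (drop i \<alpha>))"

definition free_word :: "nat list \<Rightarrow> free_series" where
  "free_word \<alpha> = (\<lambda>\<beta>. if \<beta> = \<alpha> then 1 else 0)"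

definition free_algebra :: "nat \<Rightarrow> ereal \<Rightarrow> (complex, free_series) top_algebra" where
  "free_algebra n r = \<lparr>
     carrier = free_carrier n r,
     mult = free_mult,
     one = free_word [],
     zero = 0,
     add = (+),
     smult = (\<lambda>c a \<alpha>. c * a \<alpha>),
     alg_top = seminorm_topology (free_carrier n r) {free_norm n \<rho> \<tau> | \<rho> \<tau>. (\<rho>, \<tau>) \<in> params r}\<rparr>"


section \<open>Holomorphic functions on the punctured plane\<close>

text \<open>
  Functions on the punctured plane are represented by functions on the whole plane that are
  extended by \<open>0\<close> to the origin, so that equality of representatives is equality of functions.
\<close>

definition hol_carrier :: "nat \<Rightarrow> ereal \<Rightarrow> (complex \<Rightarrow> free_series) set" where
  "hol_carrier n r = {f. f 0 = 0 \<and> (\<forall>w. w \<noteq> 0 \<longrightarrow> f w \<in> free_carrier n r) \<and>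
     (\<forall>w. w \<noteq> 0 \<longrightarrow> (\<exists>L. limitin (alg_top (free_algebra n r))
        (\<lambda>v \<alpha>. (f v \<alpha> - f w \<alpha>) / (v - w)) L (at w)))}"

definition compact_open_topology :: "nat \<Rightarrow> ereal \<Rightarrow> (complex \<Rightarrow> free_series) topology" where
  "compact_open_topology n r = topology_generated_by
     {{f \<in> hol_carrier n r. f ` K \<subseteq> U} | K U.
        compact K \<and> 0 \<notin> K \<and> openin (alg_top (free_algebra n r)) U}"

definition hol_const :: "free_series \<Rightarrow> complex \<Rightarrow> free_series" where
  "hol_const a = (\<lambda>w. if w = 0 then 0 else a)"

definition hol_algebra :: "nat \<Rightarrow> ereal \<Rightarrow> (complex, complex \<Rightarrow> free_series) top_algebra" where
  "hol_algebra n r = \<lparr>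
     carrier = hol_carrier n r,
     mult = (\<lambda>f g w. free_mult (f w) (g w)),
     one = hol_const (free_word []),
     zero = 0,
     add = (+),
     smult = (\<lambda>c f w \<alpha>. c * f w \<alpha>),
     alg_top = compact_open_topology n r\<rparr>"

definition hol_z :: "complex \<Rightarrow> free_series" where
  "hol_z = (\<lambda>w \<alpha>. w * free_word [] \<alpha>)"

definition hol_zeta :: "nat \<Rightarrow> complex \<Rightarrow> free_series" where
  "hol_zeta i = hol_const (free_word [i])"


section \<open>The deformation algebra\<close>

definition def_relations :: "nat \<Rightarrow> ereal \<Rightarrow> (complex \<Rightarrow> free_series) set" where
  "def_relations n r =
     {hol_zeta i \<otimes>\<^bsub>hol_algebra n r\<^esub> hol_zeta j
        - hol_z \<otimes>\<^bsub>hol_algebra n r\<^esub> (hol_zeta j \<otimes>\<^bsub>hol_algebra n r\<^esub> hol_zeta i)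
      | i j. 1 \<le> i \<and> i < j \<and> j \<le> n}"

definition def_ideal :: "nat \<Rightarrow> ereal \<Rightarrow> (complex \<Rightarrow> free_series) set" where
  "def_ideal n r = closed_ideal_gen (hol_algebra n r) (def_relations n r)"

definition O_def_algebra :: "nat \<Rightarrow> ereal \<Rightarrow> (complex, (complex \<Rightarrow> free_series) set) top_algebra"
  where "O_def_algebra n r = quot_algebra (hol_algebra n r) (def_ideal n r)"

definition O_def_class :: "nat \<Rightarrow> ereal \<Rightarrow> (complex \<Rightarrow> free_series) \<Rightarrow> (complex \<Rightarrow> free_series) set"
  where "O_def_class n r f = def_ideal n r +>\<^bsub>hol_algebra n r\<^esub> f"


section \<open>The power series model\<close>

text \<open>
  A series \<open>\<Sum> c\<^sub>k\<^sub>p x\<^sup>k z\<^sup>p\<close> is represented by its coefficient function; a multi-index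
  \<open>k\<close> is a function on \<open>nat\<close> that vanishes off \<open>{1..n}\<close>.
\<close>

type_synonym mono_index = "(nat \<Rightarrow> nat) \<times> int"
type_synonym D_series = "mono_index \<Rightarrow> complex"

definition D_index :: "nat \<Rightarrow> mono_index set" where
  "D_index n = {(k, p). \<forall>i. i \<notin> {1..n} \<longrightarrow> k i = 0}"

definition cross :: "nat \<Rightarrow> (nat \<Rightarrow> nat) \<Rightarrow> int" where
  "cross n k = (\<Sum>j\<in>{1..n}. \<Sum>i\<in>{1..<j}. int (k i * k j))"

definition omega :: "nat \<Rightarrow> (nat \<Rightarrow> nat) \<Rightarrow> int \<Rightarrow> int" where
  "omega n k p = (if p \<ge> 0 then p else if p + cross n k \<ge> 0 then 0 else p + cross n k)"

definition D_weight :: "nat \<Rightarrow> real \<Rightarrow> real \<Rightarrow> mono_index \<Rightarrow> real" where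
  "D_weight n \<rho> \<tau> = (\<lambda>(k, p). \<rho> ^ (\<Sum>i\<in>{1..n}. k i) * \<tau> ^ nat \<bar>omega n k p\<bar>)"

definition D_norm :: "nat \<Rightarrow> real \<Rightarrow> real \<Rightarrow> D_series \<Rightarrow> real" where
  "D_norm n \<rho> \<tau> a = (\<Sum>\<^sub>\<infinity>u\<in>D_index n. cmod (a u) * D_weight n \<rho> \<tau> u)"

definition D_carrier :: "nat \<Rightarrow> ereal \<Rightarrow> D_series set" where
  "D_carrier n r = {a. (\<forall>u. u \<notin> D_index n \<longrightarrow> a u = 0) \<and>
     (\<forall>(\<rho>, \<tau>)\<in>params r. (\<lambda>u. cmod (a u) * D_weight n \<rho> \<tau> u) summable_on D_index n)}"

text \<open>
  Since \<open>x\<^sub>i x\<^sub>j = z\<^sup>-\<^sup>1 x\<^sub>j x\<^sub>i\<close> for \<open>j < i\<close>, moving the letters of \<open>x\<^sup>l\<close> to their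
  places in \<open>x\<^sup>k x\<^sup>l\<close> produces the factor \<open>z\<close> to the power minus the sum of \<open>k\<^sub>i l\<^sub>j\<close> over
  \<open>j < i\<close>. This gives the product \<open>(x\<^sup>k z\<^sup>p) (x\<^sup>l z\<^sup>q)\<close>, a single monomial,
  and \<open>D_mult\<close> is its extension to series. The lemmas below check that \<open>D_mult\<close> is
  bilinear and submultiplicative for the norms \<open>D_norm\<close> (hence continuous), and that
  \<open>x\<^sub>i\<close>, \<open>z\<close>, \<open>z\<^sup>-\<^sup>1\<close> satisfy the defining relations, with the monomials being
  the ordered products of these elements.
\<close>

definition mono_mult :: "nat \<Rightarrow> mono_index \<Rightarrow> mono_index \<Rightarrow> mono_index" where
  "mono_mult n = (\<lambda>(k, p) (l, q).
     (k + l, p + q - (\<Sum>i\<in>{1..n}. \<Sum>j\<in>{1..<i}. int (k i * l j))))"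

definition D_mult :: "nat \<Rightarrow> D_series \<Rightarrow> D_series \<Rightarrow> D_series" where
  "D_mult n a b = (\<lambda>w. \<Sum>\<^sub>\<infinity>(u, v) \<in> {(u, v) \<in> D_index n \<times> D_index n. mono_mult n u v = w}. a u * b v)"

definition D_mono :: "(nat \<Rightarrow> nat) \<Rightarrow> int \<Rightarrow> D_series" where
  "D_mono k p = (\<lambda>u. if u = (k, p) then 1 else 0)"

definition unit_index :: "nat \<Rightarrow> nat \<Rightarrow> nat" where
  "unit_index i = (\<lambda>j. if j = i then 1 else 0)"

definition D_x :: "nat \<Rightarrow> D_series" where
  "D_x i = D_mono (unit_index i) 0"

definition D_z :: D_series where
  "D_z = D_mono 0 1"

lemma mono_mult_in: "u \<in> D_index n \<Longrightarrow> v \<in> D_index n \<Longrightarrow> mono_mult n u v \<in> D_index n"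
  by (auto simp: mono_mult_def D_index_def)

lemma mono_mult_assoc: "mono_mult n (mono_mult n u v) w = mono_mult n u (mono_mult n v w)"
  by (cases u; cases v; cases w)
     (simp add: mono_mult_def add.assoc distrib_left distrib_right sum.distrib)

lemma D_mult_mono:
  assumes "(k, p) \<in> D_index n" "(l, q) \<in> D_index n"
  shows "D_mult n (D_mono k p) (D_mono l q) = case_prod D_mono (mono_mult n (k, p) (l, q))"
proof
  fix w
  let ?m = "mono_mult n (k, p) (l, q)"
  let ?S = "{(u, v) \<in> D_index n \<times> D_index n. mono_mult n u v = w}"
  let ?f = "\<lambda>(u, v). D_mono k p u * D_mono l q v"
  have "D_mult n (D_mono k p) (D_mono l q) w = infsum ?f ?S"
    by (simp add: D_mult_def)
  also have "\<dots> = infsum ?f (if ?m = w then {((k, p), (l, q))} else {})"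
    by (rule infsum_cong_neutral) (use assms in \<open>auto simp: D_mono_def split: if_splits\<close>)
  also have "\<dots> = case_prod D_mono ?m w"
    by (auto simp: D_mono_def case_prod_unfold)
  finally show "D_mult n (D_mono k p) (D_mono l q) w = case_prod D_mono ?m w" .
qed

lemma unit_index_in: "i \<in> {1..n} \<Longrightarrow> (unit_index i, p) \<in> D_index n"
  by (auto simp: D_index_def unit_index_def)

lemma zero_index_in: "(0, p) \<in> D_index n"
  by (auto simp: D_index_def)

lemma twist_unit_right:
  "(\<Sum>i\<in>{1..n}. \<Sum>j\<in>{1..<i}. int (k i * unit_index m j)) =
     (if m \<ge> 1 then \<Sum>i\<in>{m<..n}. int (k i) else 0)"
proof -
  have "(\<Sum>j\<in>{1..<i}. int (k i * unit_index m j)) = (if 1 \<le> m \<and> m < i then int (k i) else 0)" for i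
  proof -
    have "(\<Sum>j\<in>{1..<i}. int (k i * unit_index m j)) = (\<Sum>j\<in>{1..<i}. if j = m then int (k i) else 0)"
      by (rule sum.cong) (auto simp: unit_index_def)
    then show ?thesis by simp
  qed
  then have "(\<Sum>i\<in>{1..n}. \<Sum>j\<in>{1..<i}. int (k i * unit_index m j)) =
      (\<Sum>i\<in>{1..n}. if 1 \<le> m \<and> m < i then int (k i) else 0)" by simp
  also have "\<dots> = (if m \<ge> 1 then \<Sum>i\<in>{m<..n}. int (k i) else 0)"
    by (auto simp: sum.If_cases intro!: sum.cong)
  finally show ?thesis .
qed

lemma D_x_z_commute: "i \<in> {1..n} \<Longrightarrow> D_mult n (D_x i) D_z = D_mult n D_z (D_x i)"
  unfolding D_x_def D_z_def
  by (simp add: D_mult_mono unit_index_in zero_index_in) (simp add: mono_mult_def)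

lemma D_z_inverse:
  "D_mult n D_z (D_mono 0 (-1)) = D_mono 0 0" "D_mult n (D_mono 0 (-1)) D_z = D_mono 0 0"
  unfolding D_z_def by (simp_all add: D_mult_mono zero_index_in) (simp_all add: mono_mult_def)

lemma D_x_relation:
  assumes "i \<in> {1..n}" "j \<in> {1..n}" "i < j"
  shows "D_mult n (D_x i) (D_x j) = D_mult n D_z (D_mult n (D_x j) (D_x i))"
proof -
  have 1: "(\<Sum>m\<in>{j<..n}. int (unit_index i m)) = 0"
    using assms by (intro sum.neutral) (auto simp: unit_index_def)
  have "(\<Sum>m\<in>{i<..n}. int (unit_index j m)) = (\<Sum>m\<in>{i<..n}. if m = j then 1 else 0)"
    by (rule sum.cong) (auto simp: unit_index_def)
  then have 2: "(\<Sum>m\<in>{i<..n}. int (unit_index j m)) = 1" using assms by simp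
  have 3: "D_mult n (D_x i) (D_x j) = D_mono (unit_index i + unit_index j) 0"
    unfolding D_x_def using assms 1
    by (simp add: D_mult_mono unit_index_in mono_mult_def twist_unit_right del: of_nat_mult One_nat_def)
  have 4: "D_mult n (D_x j) (D_x i) = D_mono (unit_index j + unit_index i) (-1)"
    unfolding D_x_def using assms 2
    by (simp add: D_mult_mono unit_index_in mono_mult_def twist_unit_right del: of_nat_mult One_nat_def)
  have 5: "(unit_index j + unit_index i, -1) \<in> D_index n"
    using assms by (auto simp: D_index_def unit_index_def)
  show ?thesis
    unfolding 3 4 unfolding D_z_def
    by (subst D_mult_mono[OF zero_index_in 5]) (simp add: mono_mult_def add.commute)
qed

lemma D_mono_mult_x:
  assumes "(k, p) \<in> D_index n" "i \<in> {1..n}" "\<And>j. j > i \<Longrightarrow> k j = 0"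
  shows "D_mult n (D_mono k p) (D_x i) = D_mono (k + unit_index i) p"
  unfolding D_x_def using assms
  by (simp add: D_mult_mono unit_index_in mono_mult_def twist_unit_right del: of_nat_mult One_nat_def)

lemma D_mono_mult_z:
  assumes "(k, p) \<in> D_index n"
  shows "D_mult n (D_mono k p) (D_mono 0 q) = D_mono k (p + q)"
  using assms by (simp add: D_mult_mono zero_index_in mono_mult_def)

lemma cross_nonneg: "cross n k \<ge> 0"
  by (simp add: cross_def sum_nonneg)

lemma omega_mono_mult:
  assumes "mono_mult n (k, p) (l, q) = (m, s)"
  shows "\<bar>omega n m s\<bar> \<le> \<bar>omega n k p\<bar> + \<bar>omega n l q\<bar>"
proof -
  define t where "t = (\<Sum>i\<in>{1..n}. \<Sum>j\<in>{1..<i}. int (k i * l j))"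
  define t' where "t' = (\<Sum>i\<in>{1..n}. \<Sum>j\<in>{1..<i}. int (k j * l i))"
  have ms: "m = k + l" "s = p + q - t" using assms by (auto simp: mono_mult_def t_def)
  have c: "cross n m = cross n k + cross n l + t + t'"
    by (simp add: ms cross_def t_def t'_def sum.distrib[symmetric] algebra_simps)
  have "t \<ge> 0" "t' \<ge> 0" by (simp_all add: t_def t'_def sum_nonneg)
  then show ?thesis
    using c cross_nonneg[of n k] cross_nonneg[of n l]
    unfolding omega_def ms(2) by (smt (verit))
qed

lemma D_weight_nonneg: "0 \<le> \<rho> \<Longrightarrow> 0 \<le> \<tau> \<Longrightarrow> 0 \<le> D_weight n \<rho> \<tau> u"
  by (auto simp: D_weight_def case_prod_unfold)

lemma D_weight_mono_mult:
  assumes "0 \<le> \<rho>" "1 \<le> \<tau>"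
  shows "D_weight n \<rho> \<tau> (mono_mult n u v) \<le> D_weight n \<rho> \<tau> u * D_weight n \<rho> \<tau> v"
proof -
  obtain k p l q where uv: "u = (k, p)" "v = (l, q)" by fastforce
  obtain m s where ms: "mono_mult n (k, p) (l, q) = (m, s)" by fastforce
  have "nat \<bar>omega n m s\<bar> \<le> nat \<bar>omega n k p\<bar> + nat \<bar>omega n l q\<bar>"
    using omega_mono_mult[OF ms] by linarith
  then have "\<tau> ^ nat \<bar>omega n m s\<bar> \<le> \<tau> ^ (nat \<bar>omega n k p\<bar> + nat \<bar>omega n l q\<bar>)"
    using assms by (intro power_increasing)
  moreover have "\<rho> ^ (\<Sum>i\<in>{1..n}. m i) = \<rho> ^ (\<Sum>i\<in>{1..n}. k i) * \<rho> ^ (\<Sum>i\<in>{1..n}. l i)"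
    using ms by (auto simp: mono_mult_def sum.distrib power_add)
  ultimately show ?thesis
    unfolding uv ms using assms
    by (simp add: D_weight_def power_add mult_left_mono mult_ac)
qed

lemma D_mult_submultiplicative:
  assumes \<rho>: "0 < \<rho>" and \<tau>: "1 \<le> \<tau>"
    and a: "(\<lambda>u. cmod (a u) * D_weight n \<rho> \<tau> u) summable_on D_index n"
    and b: "(\<lambda>u. cmod (b u) * D_weight n \<rho> \<tau> u) summable_on D_index n"
  shows "(\<lambda>u. cmod (D_mult n a b u) * D_weight n \<rho> \<tau> u) summable_on D_index n" (is ?S)
    and "D_norm n \<rho> \<tau> (D_mult n a b) \<le> D_norm n \<rho> \<tau> a * D_norm n \<rho> \<tau> b" (is ?N)
    and "w \<in> D_index n \<Longrightarrow> (\<lambda>(u, v). norm (a u * b v)) summable_on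
           {(u, v) \<in> D_index n \<times> D_index n. mono_mult n u v = w}"
proof -
  let ?I = "D_index n" and ?w = "D_weight n \<rho> \<tau>"
  define F where "F w = {(u, v) \<in> ?I \<times> ?I. mono_mult n u v = w}" for w
  define g where "g = (\<lambda>(u, v). (cmod (a u) * ?w u) * (cmod (b v) * ?w v))"
  have wpos: "?w u > 0" for u using \<rho> \<tau> by (auto simp: D_weight_def case_prod_unfold)
  have g0: "g x \<ge> 0" for x using wpos by (auto simp: g_def case_prod_unfold less_imp_le)
  have gP: "g summable_on ?I \<times> ?I"
  proof -
    have "((\<lambda>v. g (u, v)) has_sum (cmod (a u) * ?w u) * D_norm n \<rho> \<tau> b) ?I" for u
      unfolding g_def D_norm_def case_prod_conv by (intro has_sum_cmult_right has_sum_infsum b)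
    moreover have "(\<lambda>u. (cmod (a u) * ?w u) * D_norm n \<rho> \<tau> b) summable_on ?I"
      by (intro summable_on_cmult_left a)
    ultimately show ?thesis
      by (intro summable_on_SigmaI) (use g0 in auto)
  qed
  have bij: "bij_betw snd (SIGMA w:?I. F w) (?I \<times> ?I)"
    by (rule bij_betwI[where g = "\<lambda>(u, v). (mono_mult n u v, (u, v))"])
       (auto simp: F_def mono_mult_in)
  have gS: "(\<lambda>(w, x). g x) summable_on (SIGMA w:?I. F w)"
    using summable_on_reindex_bij_betw[OF bij, of g] gP by (simp add: case_prod_unfold)
  have gF: "g summable_on F w" for w
    by (rule summable_on_subset_banach[OF gP]) (auto simp: F_def)
  have gI: "(\<lambda>w. infsum g (F w)) summable_on ?I"
    using summable_on_Sigma_banach[OF gS] by simp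
  have tot: "infsum g (?I \<times> ?I) = infsum (\<lambda>w. infsum g (F w)) ?I"
    using infsum_Sigma'_banach[OF gS] infsum_reindex_bij_betw[OF bij, of g]
    by (simp add: case_prod_unfold)
  have le: "cmod (a u * b v) * ?w w \<le> g (u, v)" if "(u, v) \<in> F w" for u v w
  proof -
    have "?w w \<le> ?w u * ?w v"
      using D_weight_mono_mult[of \<rho> \<tau> n u v] \<rho> \<tau> that by (auto simp: F_def)
    then have "(cmod (a u) * cmod (b v)) * ?w w \<le> (cmod (a u) * cmod (b v)) * (?w u * ?w v)"
      by (intro mult_left_mono) auto
    then show ?thesis by (simp add: g_def norm_mult mult_ac)
  qed
  have ab: "(\<lambda>x. norm (case x of (u, v) \<Rightarrow> a u * b v)) summable_on F w" for w
  proof (rule summable_on_comparison_test)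
    show "(\<lambda>x. g x * inverse (?w w)) summable_on F w"
      by (rule summable_on_cmult_left[OF gF])
    fix x assume "x \<in> F w"
    then show "norm (case x of (u, v) \<Rightarrow> a u * b v) \<le> g x * inverse (?w w)"
      using le[of "fst x" "snd x" w] wpos[of w]
      by (simp add: case_prod_unfold divide_inverse[symmetric] pos_le_divide_eq)
  qed auto
  show "w \<in> D_index n \<Longrightarrow> (\<lambda>(u, v). norm (a u * b v)) summable_on
           {(u, v) \<in> D_index n \<times> D_index n. mono_mult n u v = w}"
    using ab[of w] by (simp add: F_def case_prod_unfold)
  have bnd: "cmod (D_mult n a b w) * ?w w \<le> infsum g (F w)" for w
  proof -
    have "cmod (D_mult n a b w) \<le> (\<Sum>\<^sub>\<infinity>x\<in>F w. norm (case x of (u, v) \<Rightarrow> a u * b v))"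
      unfolding D_mult_def F_def[symmetric] by (rule norm_infsum_bound[OF ab])
    then have "cmod (D_mult n a b w) * ?w w
        \<le> (\<Sum>\<^sub>\<infinity>x\<in>F w. norm (case x of (u, v) \<Rightarrow> a u * b v)) * ?w w"
      using wpos[of w] by (intro mult_right_mono) auto
    also have "\<dots> = (\<Sum>\<^sub>\<infinity>x\<in>F w. norm (case x of (u, v) \<Rightarrow> a u * b v) * ?w w)"
      by (rule infsum_cmult_left[symmetric]) (use ab[of w] in simp)
    also have "\<dots> \<le> infsum g (F w)"
    proof (rule infsum_mono)
      show "(\<lambda>x. norm (case x of (u, v) \<Rightarrow> a u * b v) * ?w w) summable_on F w"
        by (rule summable_on_cmult_left[OF ab])
      show "norm (case x of (u, v) \<Rightarrow> a u * b v) * ?w w \<le> g x" if "x \<in> F w" for x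
        using le[of "fst x" "snd x" w] that by (simp add: case_prod_unfold)
    qed (rule gF)
    finally show ?thesis .
  qed
  show S: ?S
    by (rule summable_on_comparison_test[OF gI]) (use bnd wpos in \<open>auto simp: less_imp_le\<close>)
  have "D_norm n \<rho> \<tau> (D_mult n a b) \<le> infsum g (?I \<times> ?I)"
    unfolding D_norm_def tot by (rule infsum_mono[OF S gI bnd])
  also have "\<dots> = D_norm n \<rho> \<tau> a * D_norm n \<rho> \<tau> b"
  proof -
    have "infsum g (?I \<times> ?I) = (\<Sum>\<^sub>\<infinity>u\<in>?I. \<Sum>\<^sub>\<infinity>v\<in>?I. g (u, v))"
      by (rule infsum_Sigma_banach[OF gP, symmetric])
    also have "\<dots> = (\<Sum>\<^sub>\<infinity>u\<in>?I. (cmod (a u) * ?w u) * D_norm n \<rho> \<tau> b)"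
      unfolding g_def D_norm_def case_prod_conv by (intro infsum_cong infsum_cmult_right')
    also have "\<dots> = D_norm n \<rho> \<tau> a * D_norm n \<rho> \<tau> b"
      unfolding D_norm_def[of n \<rho> \<tau> a] by (rule infsum_cmult_left')
    finally show ?thesis .
  qed
  finally show ?N .
qed

lemma D_mult_closed:
  assumes "a \<in> D_carrier n r" "b \<in> D_carrier n r"
  shows "D_mult n a b \<in> D_carrier n r"
proof -
  have "D_mult n a b w = 0" if "w \<notin> D_index n" for w
  proof -
    have e: "{(u, v) \<in> D_index n \<times> D_index n. mono_mult n u v = w} = {}"
      using that mono_mult_in by auto
    show ?thesis unfolding D_mult_def e by (rule infsum_empty)
  qed
  moreover have "(\<lambda>u. cmod (D_mult n a b u) * D_weight n \<rho> \<tau> u) summable_on D_index n"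
    if "(\<rho>, \<tau>) \<in> params r" for \<rho> \<tau>
  proof (rule D_mult_submultiplicative(1))
    show "0 < \<rho>" "1 \<le> \<tau>" using that by (simp_all add: params_def)
    show "(\<lambda>u. cmod (a u) * D_weight n \<rho> \<tau> u) summable_on D_index n"
      "(\<lambda>u. cmod (b u) * D_weight n \<rho> \<tau> u) summable_on D_index n"
      using assms that unfolding D_carrier_def by blast+
  qed
  ultimately show ?thesis unfolding D_carrier_def by blast
qed

lemma D_mult_summable:
  assumes r: "r > 0" and "a \<in> D_carrier n r" "b \<in> D_carrier n r"
  shows "(\<lambda>(u, v). a u * b v) summable_on {(u, v) \<in> D_index n \<times> D_index n. mono_mult n u v = w}"
proof (cases "w \<in> D_index n")
  case True
  obtain \<rho> where \<rho>: "0 < ereal \<rho>" "ereal \<rho> < r"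
    using r ereal_dense2 by blast
  have "(\<lambda>(u, v). norm (a u * b v)) summable_on
      {(u, v) \<in> D_index n \<times> D_index n. mono_mult n u v = w}"
    using assms True \<rho> by (intro D_mult_submultiplicative(3)[of \<rho> 1]) (auto simp: D_carrier_def params_def)
  then show ?thesis
    unfolding case_prod_unfold by (rule abs_summable_summable)
next
  case False
  then have e: "{(u, v) \<in> D_index n \<times> D_index n. mono_mult n u v = w} = {}"
    using mono_mult_in by auto
  show ?thesis unfolding e by (rule summable_on_empty)
qed

lemma D_mult_add:
  assumes "r > 0" "a \<in> D_carrier n r" "a' \<in> D_carrier n r" "b \<in> D_carrier n r"
  shows "D_mult n (a + a') b = D_mult n a b + D_mult n a' b"
    and "D_mult n b (a + a') = D_mult n b a + D_mult n b a'"
proof -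
  show "D_mult n (a + a') b = D_mult n a b + D_mult n a' b"
  proof
    fix w
    show "D_mult n (a + a') b w = (D_mult n a b + D_mult n a' b) w"
      using infsum_add[OF D_mult_summable[OF assms(1,2,4), of w] D_mult_summable[OF assms(1,3,4), of w]]
      by (simp add: D_mult_def case_prod_unfold distrib_right)
  qed
  show "D_mult n b (a + a') = D_mult n b a + D_mult n b a'"
  proof
    fix w
    show "D_mult n b (a + a') w = (D_mult n b a + D_mult n b a') w"
      using infsum_add[OF D_mult_summable[OF assms(1,4,2), of w] D_mult_summable[OF assms(1,4,3), of w]]
      by (simp add: D_mult_def case_prod_unfold distrib_left)
  qed
qed

lemma D_mult_scale:
  "D_mult n (\<lambda>u. c * a u) b = (\<lambda>w. c * D_mult n a b w)"
  "D_mult n a (\<lambda>u. c * b u) = (\<lambda>w. c * D_mult n a b w)"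
  unfolding D_mult_def infsum_cmult_right'[symmetric] case_prod_unfold by (simp_all only: mult_ac)

definition D_algebra :: "nat \<Rightarrow> ereal \<Rightarrow> (complex, D_series) top_algebra" where
  "D_algebra n r = \<lparr>
     carrier = D_carrier n r,
     mult = D_mult n,
     one = D_mono 0 0,
     zero = 0,
     add = (+),
     smult = (\<lambda>c a u. c * a u),
     alg_top = seminorm_topology (D_carrier n r) {D_norm n \<rho> \<tau> | \<rho> \<tau>. (\<rho>, \<tau>) \<in> params r}\<rparr>"

end

theory Submission
  imports Defs "HOL-Complex_Analysis.Complex_Analysis"
begin

text \<open>
  Through Laurent coefficients, the algebra of holomorphic functions on the punctured plane is a
  weighted \<open>l\<^sup>1\<close>-type space with the monomials \<open>\<zeta>\<^sub>\<alpha> z\<^sup>p\<close> as a basis. Sending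
  \<open>\<zeta>\<^sub>\<alpha> z\<^sup>p\<close> to the monomial obtained by sorting \<open>\<alpha>\<close> (each inversion contributes
  \<open>z\<^sup>-\<^sup>1\<close>) defines a continuous homomorphism onto the power series model.
  It has a continuous linear section: \<open>x\<^sup>k z\<^sup>p\<close> is lifted to \<open>\<zeta>\<^sub>\<alpha> z\<^sup>q\<close> with \<open>q = \<omega>(k, p)\<close>
  and a word \<open>\<alpha>\<close> of content \<open>k\<close> that has \<open>q - p\<close> inversions and a number of blocks bounded in terms
  of \<open>n\<close> only. A monomial and the lift of its image are congruent modulo the relations, so
  \<open>f\<close> minus the lift of its image lies in the closed ideal for every \<open>f\<close>, by density.
  Hence the ideal is the kernel, and the section makes the induced bijection a homeomorphism.
\<close>

section \<open>Spaces of weighted absolutely summable families\<close>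

text \<open>The absolute value of \<open>omega n k p\<close> is the distance from \<open>p\<close>
  to the interval from \<open>- cross n k\<close> to 0. A word of content \<open>k\<close> has
  between 0 and \<open>cross n k\<close> inversions, so this is the least absolute value of an
  exponent \<open>q\<close> such that some word times \<open>z\<close> to the power \<open>q\<close>
  is sent to the monomial with index \<open>(k, p)\<close>. Lifting a monomial to the sorted word
  with the exponent \<open>p\<close> unchanged is not continuous in general:
  \<open>cross n k\<close> grows quadratically with \<open>k\<close>, and for negative
  \<open>p\<close> no weight of the power series model pays for \<tau> to the power \<bar>p\<bar>.
  Negative exponents must be stored in inversions as far as possible. The opposite danger is the
  block factor in the norm of free series: a word with many inversions may have many blocks, and
  nothing pays for these either. Hence every admissible number of inversions has to be realised with
  at most \<open>4 * n\<close> blocks, which costs only the constant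
  \<open>\<tau> ^ (4 * n)\<close>. On the analytic side, Laurent norms are compared with suprema
  over the circles of radius \<open>2 * \<tau>\<close> and \<open>1 / (2 * \<tau>)\<close>; the
  factor 2 leaves a summable power of 1/2.\<close>

locale seminorm_family =
  fixes V :: "'b::ab_group_add set" and N :: "real \<Rightarrow> real \<Rightarrow> 'b \<Rightarrow> real" and r :: ereal
  assumes r_pos: "0 < r"
    and zero_mem: "0 \<in> V"
    and add_mem: "x \<in> V \<Longrightarrow> y \<in> V \<Longrightarrow> x + y \<in> V"
    and minus_mem: "x \<in> V \<Longrightarrow> - x \<in> V"
    and N_add: "(\<rho>, \<tau>) \<in> params r \<Longrightarrow> x \<in> V \<Longrightarrow> y \<in> V \<Longrightarrow> N \<rho> \<tau> (x + y) \<le> N \<rho> \<tau> x + N \<rho> \<tau> y"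
    and N_minus: "x \<in> V \<Longrightarrow> N \<rho> \<tau> (- x) = N \<rho> \<tau> x"
    and N_zero: "N \<rho> \<tau> 0 = 0"
    and N_mono: "(\<rho>, \<tau>) \<in> params r \<Longrightarrow> (\<rho>', \<tau>') \<in> params r \<Longrightarrow> \<rho> \<le> \<rho>' \<Longrightarrow> \<tau> \<le> \<tau>' \<Longrightarrow> x \<in> V \<Longrightarrow>
      N \<rho> \<tau> x \<le> N \<rho>' \<tau>' x"
    and separating: "x \<in> V \<Longrightarrow> (\<And>\<rho> \<tau>. (\<rho>, \<tau>) \<in> params r \<Longrightarrow> N \<rho> \<tau> x = 0) \<Longrightarrow> x = 0"
begin

abbreviation top :: "'b topology" where
  "top \<equiv> seminorm_topology V {N \<rho> \<tau> | \<rho> \<tau>. (\<rho>, \<tau>) \<in> params r}"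

lemma diff_mem: "x \<in> V \<Longrightarrow> y \<in> V \<Longrightarrow> x - y \<in> V"
  using add_mem[of x "- y"] minus_mem by simp

lemma sum_mem: "(\<And>i. i \<in> A \<Longrightarrow> f i \<in> V) \<Longrightarrow> sum f A \<in> V"
  by (induction A rule: infinite_finite_induct) (auto simp: zero_mem add_mem)

lemma params_nonempty: "\<exists>\<rho> \<tau>. (\<rho>, \<tau>) \<in> params r"
proof -
  obtain \<rho> where "0 < ereal \<rho>" "ereal \<rho> < r"
    using r_pos ereal_dense2 by blast
  then show ?thesis by (intro exI[of _ \<rho>] exI[of _ 1]) (simp add: params_def)
qed

lemma params_max:
  "(\<rho>, \<tau>) \<in> params r \<Longrightarrow> (\<rho>', \<tau>') \<in> params r \<Longrightarrow> (max \<rho> \<rho>', max \<tau> \<tau>') \<in> params r"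
  by (auto simp: params_def max_def)

lemma N_nonneg: "(\<rho>, \<tau>) \<in> params r \<Longrightarrow> x \<in> V \<Longrightarrow> 0 \<le> N \<rho> \<tau> x"
  using N_add[of \<rho> \<tau> x "- x"] by (simp add: N_minus N_zero minus_mem)

lemma N_commute: "x \<in> V \<Longrightarrow> y \<in> V \<Longrightarrow> N \<rho> \<tau> (x - y) = N \<rho> \<tau> (y - x)"
  using N_minus[OF diff_mem, of y x \<rho> \<tau>] by simp

lemma N_triangle:
  "(\<rho>, \<tau>) \<in> params r \<Longrightarrow> x \<in> V \<Longrightarrow> y \<in> V \<Longrightarrow> z \<in> V \<Longrightarrow>
    N \<rho> \<tau> (x - z) \<le> N \<rho> \<tau> (x - y) + N \<rho> \<tau> (y - z)"
  using N_add[of \<rho> \<tau> "x - y" "y - z"] by (simp add: diff_mem)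

lemma N_le_diff:
  "(\<rho>, \<tau>) \<in> params r \<Longrightarrow> x \<in> V \<Longrightarrow> y \<in> V \<Longrightarrow> N \<rho> \<tau> x \<le> N \<rho> \<tau> (x - y) + N \<rho> \<tau> y"
  using N_add[of \<rho> \<tau> "x - y" y] by (simp add: diff_mem)

text \<open>Monotonicity in both parameters makes the family directed: the seminorm at the
  componentwise maximum dominates finitely many given ones. This is why neighbourhoods may be
  described by a single seminorm instead of a finite set.\<close>

lemma finite_directed:
  assumes "finite Q" "Q \<subseteq> {N \<rho> \<tau> | \<rho> \<tau>. (\<rho>, \<tau>) \<in> params r}"
  shows "\<exists>\<rho> \<tau>. (\<rho>, \<tau>) \<in> params r \<and> (\<forall>p\<in>Q. \<forall>x\<in>V. p x \<le> N \<rho> \<tau> x)"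
  using assms
proof (induction Q)
  case empty
  then show ?case using params_nonempty by auto
next
  case (insert p Q)
  then obtain \<rho> \<tau> where 1: "(\<rho>, \<tau>) \<in> params r" "\<forall>p\<in>Q. \<forall>x\<in>V. p x \<le> N \<rho> \<tau> x" by auto
  obtain \<rho>' \<tau>' where 2: "(\<rho>', \<tau>') \<in> params r" "p = N \<rho>' \<tau>'" using insert.prems by auto
  have 3: "(max \<rho> \<rho>', max \<tau> \<tau>') \<in> params r" by (rule params_max) fact+
  moreover have "p x \<le> N (max \<rho> \<rho>') (max \<tau> \<tau>') x" if "x \<in> V" for x
    unfolding 2(2) by (rule N_mono[OF 2(1) 3 _ _ that]) auto
  moreover have "q x \<le> N (max \<rho> \<rho>') (max \<tau> \<tau>') x" if "x \<in> V" "q \<in> Q" for x q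
  proof -
    have "q x \<le> N \<rho> \<tau> x" using 1(2) that by blast
    also have "\<dots> \<le> N (max \<rho> \<rho>') (max \<tau> \<tau>') x" by (rule N_mono[OF 1(1) 3 _ _ that(1)]) auto
    finally show ?thesis .
  qed
  ultimately show ?case by blast
qed

lemma openin_top_iff:
  "openin top U \<longleftrightarrow> U \<subseteq> V \<and>
    (\<forall>x\<in>U. \<exists>\<rho> \<tau> \<epsilon>. (\<rho>, \<tau>) \<in> params r \<and> \<epsilon> > 0 \<and> {y \<in> V. N \<rho> \<tau> (y - x) < \<epsilon>} \<subseteq> U)"
  (is "_ \<longleftrightarrow> _ \<and> ?R")
proof (intro iffI conjI)
  assume U: "openin top U"
  then show V: "U \<subseteq> V" by (simp add: openin_seminorm_topology)
  show ?R
  proof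
    fix x assume x: "x \<in> U"
    obtain Q \<epsilon> where Q: "finite Q" "Q \<subseteq> {N \<rho> \<tau> | \<rho> \<tau>. (\<rho>, \<tau>) \<in> params r}" "\<epsilon> > 0"
        "{y \<in> V. \<forall>p\<in>Q. p (y - x) < \<epsilon>} \<subseteq> U"
      using U x unfolding openin_seminorm_topology by meson
    obtain \<rho> \<tau> where P: "(\<rho>, \<tau>) \<in> params r" "\<forall>p\<in>Q. \<forall>x\<in>V. p x \<le> N \<rho> \<tau> x"
      using finite_directed[OF Q(1,2)] by blast
    have "{y \<in> V. N \<rho> \<tau> (y - x) < \<epsilon>} \<subseteq> {y \<in> V. \<forall>p\<in>Q. p (y - x) < \<epsilon>}"
      using P(2) V x diff_mem by (blast intro: le_less_trans)
    then show "\<exists>\<rho> \<tau> \<epsilon>. (\<rho>, \<tau>) \<in> params r \<and> \<epsilon> > 0 \<and> {y \<in> V. N \<rho> \<tau> (y - x) < \<epsilon>} \<subseteq> U"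
      using P(1) Q(3,4) by (intro exI[of _ \<rho>] exI[of _ \<tau>] exI[of _ \<epsilon>]) auto
  qed
next
  assume U: "U \<subseteq> V \<and> ?R"
  show "openin top U" unfolding openin_seminorm_topology
  proof (intro conjI ballI)
    show "U \<subseteq> V" using U by blast
    fix x assume "x \<in> U"
    then obtain \<rho> \<tau> \<epsilon> where *: "(\<rho>, \<tau>) \<in> params r" "\<epsilon> > 0" "{y \<in> V. N \<rho> \<tau> (y - x) < \<epsilon>} \<subseteq> U"
      using U by meson
    then show "\<exists>Q \<epsilon>. finite Q \<and> Q \<subseteq> {N \<rho> \<tau> | \<rho> \<tau>. (\<rho>, \<tau>) \<in> params r} \<and> \<epsilon> > 0 \<and>
        {y \<in> V. \<forall>p\<in>Q. p (y - x) < \<epsilon>} \<subseteq> U"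
      by (intro exI[of _ "{N \<rho> \<tau>}"] exI[of _ \<epsilon>]) auto
  qed
qed

lemma openin_ball:
  assumes p: "(\<rho>, \<tau>) \<in> params r" and x: "x \<in> V"
  shows "openin top {y \<in> V. N \<rho> \<tau> (y - x) < \<epsilon>}"
  unfolding openin_top_iff
proof (intro conjI ballI)
  fix y assume y: "y \<in> {y \<in> V. N \<rho> \<tau> (y - x) < \<epsilon>}"
  have "{z \<in> V. N \<rho> \<tau> (z - y) < \<epsilon> - N \<rho> \<tau> (y - x)} \<subseteq> {y \<in> V. N \<rho> \<tau> (y - x) < \<epsilon>}"
  proof
    fix z assume z: "z \<in> {z \<in> V. N \<rho> \<tau> (z - y) < \<epsilon> - N \<rho> \<tau> (y - x)}"
    then show "z \<in> {y \<in> V. N \<rho> \<tau> (y - x) < \<epsilon>}"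
      using N_triangle[OF p, of z y x] x y by auto
  qed
  then show "\<exists>\<rho>' \<tau>' \<epsilon>'. (\<rho>', \<tau>') \<in> params r \<and> \<epsilon>' > 0 \<and>
      {z \<in> V. N \<rho>' \<tau>' (z - y) < \<epsilon>'} \<subseteq> {y \<in> V. N \<rho> \<tau> (y - x) < \<epsilon>}"
    using p y by (intro exI[of _ \<rho>] exI[of _ \<tau>] exI[of _ "\<epsilon> - N \<rho> \<tau> (y - x)"]) auto
qed auto

lemma limitin_top_iff:
  "limitin top f l F \<longleftrightarrow> l \<in> V \<and>
    (\<forall>\<rho> \<tau> \<epsilon>. (\<rho>, \<tau>) \<in> params r \<longrightarrow> \<epsilon> > 0 \<longrightarrow> (\<forall>\<^sub>F x in F. f x \<in> V \<and> N \<rho> \<tau> (f x - l) < \<epsilon>))"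
  (is "_ \<longleftrightarrow> _ \<and> ?R")
proof (intro iffI conjI)
  assume l: "limitin top f l F"
  then show lV: "l \<in> V" by (simp add: limitin_def)
  show ?R
  proof (intro allI impI)
    fix \<rho> \<tau> and \<epsilon> :: real assume "(\<rho>, \<tau>) \<in> params r" "\<epsilon> > 0"
    then show "\<forall>\<^sub>F x in F. f x \<in> V \<and> N \<rho> \<tau> (f x - l) < \<epsilon>"
      using l lV openin_ball[of \<rho> \<tau> l \<epsilon>] by (auto simp: limitin_def N_zero)
  qed
next
  assume R: "l \<in> V \<and> ?R"
  show "limitin top f l F" unfolding limitin_def
  proof (intro conjI allI impI)
    show "l \<in> topspace top" using R by simp
    fix U assume U: "openin top U \<and> l \<in> U"
    then obtain \<rho> \<tau> \<epsilon> where *: "(\<rho>, \<tau>) \<in> params r" "\<epsilon> > 0" "{y \<in> V. N \<rho> \<tau> (y - l) < \<epsilon>} \<subseteq> U"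
      unfolding openin_top_iff by meson
    then have "\<forall>\<^sub>F x in F. f x \<in> V \<and> N \<rho> \<tau> (f x - l) < \<epsilon>" using R by blast
    then show "\<forall>\<^sub>F x in F. f x \<in> U" using * by (auto elim: eventually_mono)
  qed
qed

lemma closedin_limit:
  assumes S: "closedin top S" and x: "x \<in> V"
    and approx: "\<And>\<rho> \<tau> \<epsilon>. (\<rho>, \<tau>) \<in> params r \<Longrightarrow> \<epsilon> > 0 \<Longrightarrow> \<exists>y\<in>S. N \<rho> \<tau> (y - x) < \<epsilon>"
  shows "x \<in> S"
proof (rule ccontr)
  assume "x \<notin> S"
  have "openin top (V - S)" using S by (simp add: closedin_def)
  then obtain \<rho> \<tau> \<epsilon> where *: "(\<rho>, \<tau>) \<in> params r" "\<epsilon> > 0" "{y \<in> V. N \<rho> \<tau> (y - x) < \<epsilon>} \<subseteq> V - S"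
    using \<open>x \<notin> S\<close> x unfolding openin_top_iff by blast
  obtain y where "y \<in> S" "N \<rho> \<tau> (y - x) < \<epsilon>" using approx * by blast
  moreover have "y \<in> V" using S \<open>y \<in> S\<close> closedin_subset by fastforce
  ultimately show False using * by blast
qed

text \<open>Identities between continuous maps are extended from monomials by density, and for this
  the set where two continuous maps agree has to be closed.\<close>

lemma Hausdorff_top: "Hausdorff_space top"
  unfolding Hausdorff_space_def
proof (intro allI impI)
  fix x y assume *: "x \<in> topspace top \<and> y \<in> topspace top \<and> x \<noteq> y"
  then have xy: "x \<in> V" "y \<in> V" "x - y \<noteq> 0" by auto
  then obtain \<rho> \<tau> where p: "(\<rho>, \<tau>) \<in> params r" "N \<rho> \<tau> (x - y) \<noteq> 0"
    using separating diff_mem by blast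
  define \<epsilon> where "\<epsilon> = N \<rho> \<tau> (x - y) / 2"
  have \<epsilon>: "\<epsilon> > 0" using N_nonneg[OF p(1) diff_mem[OF xy(1,2)]] p(2) by (simp add: \<epsilon>_def)
  have "disjnt {z \<in> V. N \<rho> \<tau> (z - x) < \<epsilon>} {z \<in> V. N \<rho> \<tau> (z - y) < \<epsilon>}"
    using N_triangle[OF p(1) xy(1) _ xy(2)] N_commute[OF xy(1)]
    by (fastforce simp: disjnt_iff \<epsilon>_def)
  then show "\<exists>U V. openin top U \<and> openin top V \<and> x \<in> U \<and> y \<in> V \<and> disjnt U V"
    using openin_ball[OF p(1)] xy \<epsilon> N_zero
    by (intro exI[of _ "{z \<in> V. N \<rho> \<tau> (z - x) < \<epsilon>}"] exI[of _ "{z \<in> V. N \<rho> \<tau> (z - y) < \<epsilon>}"]) auto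
qed

end

text \<open>For an additive map continuity at 0 is enough, so each target seminorm only has to be
  bounded by a multiple of some source seminorm. The parameters may change on the way:
  multiplication of holomorphic functions pays with a larger \<tau>.\<close>

lemma continuous_map_seminorm_bounded:
  assumes A: "seminorm_family V1 N1 r" and B: "seminorm_family V2 N2 r"
    and mem: "\<And>x. x \<in> V1 \<Longrightarrow> h x \<in> V2"
    and diff: "\<And>x y. x \<in> V1 \<Longrightarrow> y \<in> V1 \<Longrightarrow> h (x - y) = h x - h y"
    and bound: "\<And>\<rho> \<tau>. (\<rho>, \<tau>) \<in> params r \<Longrightarrow>
      \<exists>\<rho>' \<tau>' C. (\<rho>', \<tau>') \<in> params r \<and> (\<forall>x\<in>V1. N2 \<rho> \<tau> (h x) \<le> C * N1 \<rho>' \<tau>' x)"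
  shows "continuous_map (seminorm_topology V1 {N1 \<rho> \<tau> | \<rho> \<tau>. (\<rho>, \<tau>) \<in> params r})
    (seminorm_topology V2 {N2 \<rho> \<tau> | \<rho> \<tau>. (\<rho>, \<tau>) \<in> params r}) h"
proof -
  interpret A: seminorm_family V1 N1 r by fact
  interpret B: seminorm_family V2 N2 r by fact
  show ?thesis
    unfolding continuous_map_def
  proof (intro conjI allI impI)
    show "h \<in> topspace A.top \<rightarrow> topspace B.top" using mem by simp
    fix U assume U: "openin B.top U"
    show "openin A.top {x \<in> topspace A.top. h x \<in> U}"
      unfolding A.openin_top_iff
    proof (intro conjI ballI)
      fix x assume "x \<in> {x \<in> topspace A.top. h x \<in> U}"
      then have x: "x \<in> V1" "h x \<in> U" by auto
      obtain \<rho> \<tau> \<epsilon> where 1: "(\<rho>, \<tau>) \<in> params r" "\<epsilon> > 0" "{y \<in> V2. N2 \<rho> \<tau> (y - h x) < \<epsilon>} \<subseteq> U"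
        using U x unfolding B.openin_top_iff by meson
      obtain \<rho>' \<tau>' C where 2: "(\<rho>', \<tau>') \<in> params r" "\<forall>x\<in>V1. N2 \<rho> \<tau> (h x) \<le> C * N1 \<rho>' \<tau>' x"
        using bound[OF 1(1)] by blast
      \<comment> \<open>The constant \<open>C\<close> may be zero or negative, so the radius is
        divided by \<open>\<bar>C\<bar> + 1\<close>.\<close>
      have "h y \<in> U" if y: "y \<in> V1" "N1 \<rho>' \<tau>' (y - x) < \<epsilon> / (\<bar>C\<bar> + 1)" for y
      proof -
        have "N2 \<rho> \<tau> (h y - h x) \<le> C * N1 \<rho>' \<tau>' (y - x)"
          using 2(2) A.diff_mem[OF y(1) x(1)] diff[OF y(1) x(1)] by metis
        also have "\<dots> \<le> (\<bar>C\<bar> + 1) * N1 \<rho>' \<tau>' (y - x)"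
          using A.N_nonneg[OF 2(1) A.diff_mem[OF y(1) x(1)]] by (intro mult_right_mono) auto
        also have "\<dots> < \<epsilon>" using y(2) by (simp add: pos_less_divide_eq mult.commute)
        finally show ?thesis using 1(3) mem[OF y(1)] by blast
      qed
      then show "\<exists>\<rho> \<tau> \<epsilon>. (\<rho>, \<tau>) \<in> params r \<and> \<epsilon> > 0 \<and>
          {y \<in> V1. N1 \<rho> \<tau> (y - x) < \<epsilon>} \<subseteq> {x \<in> topspace A.top. h x \<in> U}"
        using 2(1) 1(2)
        by (intro exI[of _ \<rho>'] exI[of _ \<tau>'] exI[of _ "\<epsilon> / (\<bar>C\<bar> + 1)"]) auto
    qed auto
  qed
qed

section \<open>Weighted l^1 spaces given by coordinates\<close>

lemma sum_fun_apply: "(\<Sum>i\<in>A. f i) x = (\<Sum>i\<in>A. f i x :: 'c::comm_monoid_add)"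
  by (induction A rule: infinite_finite_induct) simp_all

text \<open>The coordinates are a map \<kappa> because elements need not be families themselves:
  free series and elements of the power series model are their own coordinates, while a holomorphic
  function is seen through its Laurent coefficients. All three algebras are Koethe echelon spaces of
  order one in this way.\<close>

locale koethe_space =
  fixes V :: "'b::ab_group_add set" and \<kappa> :: "'b \<Rightarrow> 'i \<Rightarrow> complex" and J :: "'i set"
    and W :: "real \<Rightarrow> real \<Rightarrow> 'i \<Rightarrow> real" and r :: ereal
  assumes r_pos': "0 < r"
    and W_pos: "(\<rho>, \<tau>) \<in> params r \<Longrightarrow> i \<in> J \<Longrightarrow> 0 < W \<rho> \<tau> i"
    and W_mono: "(\<rho>, \<tau>) \<in> params r \<Longrightarrow> (\<rho>', \<tau>') \<in> params r \<Longrightarrow> \<rho> \<le> \<rho>' \<Longrightarrow> \<tau> \<le> \<tau>' \<Longrightarrow> i \<in> J \<Longrightarrow>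
      W \<rho> \<tau> i \<le> W \<rho>' \<tau>' i"
    and zero_mem': "0 \<in> V"
    and add_mem': "x \<in> V \<Longrightarrow> y \<in> V \<Longrightarrow> x + y \<in> V"
    and minus_mem': "x \<in> V \<Longrightarrow> - x \<in> V"
    and coord_add: "x \<in> V \<Longrightarrow> y \<in> V \<Longrightarrow> \<kappa> (x + y) = \<kappa> x + \<kappa> y"
    and coord_inj: "x \<in> V \<Longrightarrow> \<forall>i\<in>J. \<kappa> x i = 0 \<Longrightarrow> x = 0"
    and coord_summable:
      "x \<in> V \<Longrightarrow> (\<rho>, \<tau>) \<in> params r \<Longrightarrow> (\<lambda>i. cmod (\<kappa> x i) * W \<rho> \<tau> i) summable_on J"
begin

definition nrm :: "real \<Rightarrow> real \<Rightarrow> 'b \<Rightarrow> real" where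
  "nrm \<rho> \<tau> x = (\<Sum>\<^sub>\<infinity>i\<in>J. cmod (\<kappa> x i) * W \<rho> \<tau> i)"

lemma coord_zero: "\<kappa> 0 = 0"
  using coord_add[of 0 0] zero_mem' by simp

lemma coord_minus: "x \<in> V \<Longrightarrow> \<kappa> (- x) = - \<kappa> x"
  using coord_add[of x "- x"] minus_mem' coord_zero by (simp add: eq_neg_iff_add_eq_0 add.commute)

lemma coord_le_nrm:
  assumes "x \<in> V" "(\<rho>, \<tau>) \<in> params r" "i \<in> J"
  shows "cmod (\<kappa> x i) * W \<rho> \<tau> i \<le> nrm \<rho> \<tau> x"
  using finite_sum_le_infsum[OF coord_summable[OF assms(1,2)], of "{i}"] assms W_pos
  by (auto simp: nrm_def less_imp_le)

sublocale seminorm_family V nrm r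
proof
  fix x y \<rho> \<tau> assume *: "(\<rho>, \<tau>) \<in> params r" "x \<in> V" "y \<in> V"
  have s: "(\<lambda>i. cmod (\<kappa> x i) * W \<rho> \<tau> i + cmod (\<kappa> y i) * W \<rho> \<tau> i) summable_on J"
    by (intro summable_on_add coord_summable *)
  have "nrm \<rho> \<tau> (x + y) \<le> (\<Sum>\<^sub>\<infinity>i\<in>J. cmod (\<kappa> x i) * W \<rho> \<tau> i + cmod (\<kappa> y i) * W \<rho> \<tau> i)"
    unfolding nrm_def
  proof (rule infsum_mono[OF _ s])
    show "(\<lambda>i. cmod (\<kappa> (x + y) i) * W \<rho> \<tau> i) summable_on J"
      by (intro coord_summable add_mem' *)
    show "cmod (\<kappa> (x + y) i) * W \<rho> \<tau> i \<le> cmod (\<kappa> x i) * W \<rho> \<tau> i + cmod (\<kappa> y i) * W \<rho> \<tau> i"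
      if "i \<in> J" for i
      using W_pos[OF *(1) that] *
      by (simp add: coord_add distrib_right[symmetric] mult_right_mono norm_triangle_ineq)
  qed
  also have "\<dots> = nrm \<rho> \<tau> x + nrm \<rho> \<tau> y"
    unfolding nrm_def by (intro infsum_add coord_summable *)
  finally show "nrm \<rho> \<tau> (x + y) \<le> nrm \<rho> \<tau> x + nrm \<rho> \<tau> y" .
next
  fix x \<rho> \<tau> assume "x \<in> V"
  then show "nrm \<rho> \<tau> (- x) = nrm \<rho> \<tau> x" by (simp add: nrm_def coord_minus)
next
  fix x \<rho> \<tau> \<rho>' \<tau>' assume *: "(\<rho>, \<tau>) \<in> params r" "(\<rho>', \<tau>') \<in> params r" "\<rho> \<le> \<rho>'" "\<tau> \<le> \<tau>'" "x \<in> V"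
  show "nrm \<rho> \<tau> x \<le> nrm \<rho>' \<tau>' x"
    unfolding nrm_def using * by (intro infsum_mono coord_summable mult_left_mono W_mono) auto
next
  fix x assume x: "x \<in> V" and 0: "\<And>\<rho> \<tau>. (\<rho>, \<tau>) \<in> params r \<Longrightarrow> nrm \<rho> \<tau> x = 0"
  obtain \<rho> where "0 < ereal \<rho>" "ereal \<rho> < r" using r_pos' ereal_dense2 by blast
  then have p: "(\<rho>, 1) \<in> params r" by (simp add: params_def)
  have "\<kappa> x i = 0" if "i \<in> J" for i
  proof -
    have "cmod (\<kappa> x i) * W \<rho> 1 i \<le> 0" using coord_le_nrm[OF x p that] 0[OF p] by simp
    then show ?thesis using W_pos[OF p that] by (simp add: mult_le_0_iff)
  qed
  then show "x = 0" using coord_inj x by blast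
qed (auto simp: nrm_def coord_zero r_pos' zero_mem' add_mem' minus_mem')

lemma coord_diff: "x \<in> V \<Longrightarrow> y \<in> V \<Longrightarrow> \<kappa> (x - y) = \<kappa> x - \<kappa> y"
  using coord_add[of x "- y"] by (simp add: coord_minus minus_mem)

lemma coord_sum: "(\<And>i. i \<in> A \<Longrightarrow> f i \<in> V) \<Longrightarrow> \<kappa> (sum f A) = (\<Sum>i\<in>A. \<kappa> (f i))"
  by (induction A rule: infinite_finite_induct) (auto simp: coord_zero coord_add sum_mem)

text \<open>The partial sums of the coordinate expansion converge to \<open>x\<close> in each
  seminorm, because the norm of the remainder is the tail of a convergent series. The scalar is
  carried by \<open>e i c\<close>, so closure of \<open>P\<close> under sums suffices.\<close>

lemma closed_span_induct [consumes 2, case_names closed zero add mono]: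
  assumes x: "x \<in> V" and e: "\<And>i c. i \<in> J \<Longrightarrow> e i c \<in> V \<and> (\<forall>j. \<kappa> (e i c) j = (if j = i then c else 0))"
    and closed: "closedin top {x \<in> V. P x}"
    and zero: "P 0" and add: "\<And>x y. x \<in> V \<Longrightarrow> y \<in> V \<Longrightarrow> P x \<Longrightarrow> P y \<Longrightarrow> P (x + y)"
    and mono: "\<And>i c. i \<in> J \<Longrightarrow> P (e i c)"
  shows "P x"
proof -
  have "x \<in> {x \<in> V. P x}"
  proof (rule closedin_limit[OF closed x])
    fix \<rho> \<tau> and \<epsilon> :: real assume p: "(\<rho>, \<tau>) \<in> params r" and \<epsilon>: "\<epsilon> > 0"
    let ?f = "\<lambda>i. cmod (\<kappa> x i) * W \<rho> \<tau> i"
    have s: "?f summable_on J" by (rule coord_summable[OF x p])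
    obtain A where A: "finite A" "A \<subseteq> J" "dist (sum ?f A) (infsum ?f J) \<le> \<epsilon> / 2"
      using infsum_finite_approximation[OF s, of "\<epsilon> / 2"] \<epsilon> by auto
    define y where "y = (\<Sum>i\<in>A. e i (\<kappa> x i))"
    have eV: "e i (\<kappa> x i) \<in> V" if "i \<in> A" for i using e that A by blast
    have yV: "y \<in> V" unfolding y_def by (intro sum_mem eV)
    have "P (\<Sum>i\<in>B. e i (\<kappa> x i))" if "finite B" "B \<subseteq> A" for B
      using that
    proof (induction B)
      case (insert i B)
      have "(\<Sum>i\<in>B. e i (\<kappa> x i)) \<in> V" using insert eV by (intro sum_mem) auto
      then show ?case using insert A eV by (auto intro!: add mono)
    qed (auto simp: zero)
    then have Py: "P y" using A by (simp add: y_def)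
    have ky: "\<kappa> y j = (if j \<in> A then \<kappa> x j else 0)" for j
    proof -
      have "\<kappa> y j = (\<Sum>i\<in>A. \<kappa> (e i (\<kappa> x i)) j)"
        unfolding y_def by (simp add: coord_sum[OF eV] sum_fun_apply)
      also have "\<dots> = (\<Sum>i\<in>A. if j = i then \<kappa> x i else 0)" using e A by (intro sum.cong) auto
      also have "\<dots> = (if j \<in> A then \<kappa> x j else 0)" using A by simp
      finally show ?thesis .
    qed
    \<comment> \<open>\<open>y\<close> agrees with \<open>x\<close> in the coordinates in
      \<open>A\<close> and vanishes in the others, so only the tail survives in the
      difference.\<close>
    have "nrm \<rho> \<tau> (y - x) = infsum ?f (J - A)"
      unfolding nrm_def coord_diff[OF yV x]
      by (rule infsum_cong_neutral) (auto simp: ky)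
    also have "\<dots> = infsum ?f J - sum ?f A"
      using A by (subst infsum_Diff[OF s]) (auto intro: summable_on_finite)
    also have "\<dots> \<le> \<epsilon> / 2" using A(3) unfolding dist_real_def by linarith
    finally show "\<exists>y\<in>{x \<in> V. P x}. nrm \<rho> \<tau> (y - x) < \<epsilon>" using yV Py \<epsilon> by (intro bexI[of _ y]) auto
  qed
  then show ?thesis by simp
qed

end

lemma koethe_space_id:
  assumes r: "0 < r"
    and V: "V = {a. (\<forall>i. i \<notin> J \<longrightarrow> a i = 0) \<and>
      (\<forall>(\<rho>, \<tau>)\<in>params r. (\<lambda>i. cmod (a i) * W \<rho> \<tau> i) summable_on J)}"
    and pos: "\<And>\<rho> \<tau> i. (\<rho>, \<tau>) \<in> params r \<Longrightarrow> i \<in> J \<Longrightarrow> 0 < W \<rho> \<tau> i"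
    and mono: "\<And>\<rho> \<tau> \<rho>' \<tau>' i. (\<rho>, \<tau>) \<in> params r \<Longrightarrow> (\<rho>', \<tau>') \<in> params r \<Longrightarrow> \<rho> \<le> \<rho>' \<Longrightarrow> \<tau> \<le> \<tau>' \<Longrightarrow>
      i \<in> J \<Longrightarrow> W \<rho> \<tau> i \<le> W \<rho>' \<tau>' i"
  shows "koethe_space V (\<lambda>a. a) J W r"
proof
  fix a b assume ab: "a \<in> V" "b \<in> V"
  have "(\<lambda>i. cmod ((a + b) i) * W \<rho> \<tau> i) summable_on J" if p: "(\<rho>, \<tau>) \<in> params r" for \<rho> \<tau>
  proof (rule summable_on_comparison_test)
    show "(\<lambda>i. cmod (a i) * W \<rho> \<tau> i + cmod (b i) * W \<rho> \<tau> i) summable_on J"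
      using ab p by (intro summable_on_add) (auto simp: V)
    fix i assume "i \<in> J"
    then show "cmod ((a + b) i) * W \<rho> \<tau> i \<le> cmod (a i) * W \<rho> \<tau> i + cmod (b i) * W \<rho> \<tau> i"
      "0 \<le> cmod ((a + b) i) * W \<rho> \<tau> i"
      using pos[OF p] by (simp_all add: distrib_right[symmetric] mult_right_mono norm_triangle_ineq less_imp_le)
  qed
  then show "a + b \<in> V" using ab by (auto simp: V)
next
  fix a assume "a \<in> V" "\<forall>i\<in>J. a i = 0"
  then have "a i = 0" for i by (cases "i \<in> J") (auto simp: V)
  then show "a = 0" by (simp add: fun_eq_iff)
qed (auto simp: r V pos mono)

section \<open>Push-forward of coefficient families along a map of index sets\<close>

definition wpush :: "'i set \<Rightarrow> ('i \<Rightarrow> 'j) \<Rightarrow> ('i \<Rightarrow> complex) \<Rightarrow> ('i \<Rightarrow> complex) \<Rightarrow> 'j \<Rightarrow> complex" where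
  "wpush J m e a = (\<lambda>j. \<Sum>\<^sub>\<infinity>i\<in>{i \<in> J. m i = j}. a i * e i)"

text \<open>\<open>wpush\<close> is the linear extension of the rule that sends the basis vector at
  \<open>i\<close> to \<open>e i\<close> times the basis vector at \<open>m i\<close>. In l^1 norms
  a bound on basis vectors passes to all families, after the sum over \<open>J\<close> is regrouped
  by the fibres of \<open>m\<close>. Multiplication of free series, evaluation of Laurent series,
  the projection and its section are all instances. The last claim guarantees that the infinite sums
  in \<open>wpush\<close> are genuine sums and not the default value 0.\<close>

lemma wpush_bound:
  fixes W :: "'i \<Rightarrow> real" and W' :: "'j \<Rightarrow> real"
  assumes a: "(\<lambda>i. cmod (a i) * W i) summable_on J"
    and m: "\<And>i. i \<in> J \<Longrightarrow> m i \<in> J'"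
    and e: "\<And>i. i \<in> J \<Longrightarrow> cmod (e i) * W' (m i) \<le> C * W i"
    and W': "\<And>j. j \<in> J' \<Longrightarrow> 0 < W' j"
  shows "(\<lambda>j. cmod (wpush J m e a j) * W' j) summable_on J'" (is ?A)
    and "(\<Sum>\<^sub>\<infinity>j\<in>J'. cmod (wpush J m e a j) * W' j) \<le> C * (\<Sum>\<^sub>\<infinity>i\<in>J. cmod (a i) * W i)" (is ?B)
    and "(\<lambda>i. norm (a i * e i)) summable_on {i \<in> J. m i = j}"
proof -
  define F where "F j = {i \<in> J. m i = j}" for j
  define g where "g i = C * (cmod (a i) * W i)" for i
  have gJ: "g summable_on J" unfolding g_def by (intro summable_on_cmult_right a)
  have le: "cmod (a i * e i) * W' (m i) \<le> g i" if "i \<in> J" for i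
    using mult_left_mono[OF e[OF that], of "cmod (a i)"] by (simp add: g_def norm_mult mult_ac)
  have bij: "bij_betw snd (SIGMA j:J'. F j) J"
    by (rule bij_betwI[where g = "\<lambda>i. (m i, i)"]) (auto simp: F_def m)
  have gS: "(\<lambda>(j, i). g i) summable_on (SIGMA j:J'. F j)"
    using summable_on_reindex_bij_betw[OF bij, of g] gJ by (simp add: case_prod_unfold)
  have gF: "g summable_on F j" for j
    by (rule summable_on_subset_banach[OF gJ]) (auto simp: F_def)
  have gI: "(\<lambda>j. infsum g (F j)) summable_on J'"
    using summable_on_Sigma_banach[OF gS] by simp
  have tot: "infsum g J = infsum (\<lambda>j. infsum g (F j)) J'"
    using infsum_Sigma'_banach[OF gS] infsum_reindex_bij_betw[OF bij, of g]
    by (simp add: case_prod_unfold)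
  have abs: "(\<lambda>i. norm (a i * e i)) summable_on F j" for j
  proof (cases "j \<in> J'")
    case True
    show ?thesis
    proof (rule summable_on_comparison_test)
      show "(\<lambda>i. g i * inverse (W' j)) summable_on F j" by (rule summable_on_cmult_left[OF gF])
      show "norm (a i * e i) \<le> g i * inverse (W' j)" if "i \<in> F j" for i
        using le[of i] W'[OF True] that
        by (simp add: F_def divide_inverse[symmetric] pos_le_divide_eq)
    qed auto
  next
    case False
    then have "F j = {}" using m by (auto simp: F_def)
    then show ?thesis by simp
  qed
  then show "(\<lambda>i. norm (a i * e i)) summable_on {i \<in> J. m i = j}" by (simp add: F_def)
  have bnd: "cmod (wpush J m e a j) * W' j \<le> infsum g (F j)" if j: "j \<in> J'" for j
  proof -
    have "cmod (wpush J m e a j) * W' j \<le> (\<Sum>\<^sub>\<infinity>i\<in>F j. norm (a i * e i)) * W' j"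
      unfolding wpush_def F_def[symmetric] using W'[OF j]
      by (intro mult_right_mono norm_infsum_bound abs) auto
    also have "\<dots> = (\<Sum>\<^sub>\<infinity>i\<in>F j. norm (a i * e i) * W' j)"
      by (rule infsum_cmult_left'[symmetric])
    also have "\<dots> \<le> infsum g (F j)"
      using le by (intro infsum_mono summable_on_cmult_left abs gF) (auto simp: F_def)
    finally show ?thesis .
  qed
  show A: ?A
    by (rule summable_on_comparison_test[OF gI bnd]) (use W' in \<open>auto simp: less_imp_le\<close>)
  have "(\<Sum>\<^sub>\<infinity>j\<in>J'. cmod (wpush J m e a j) * W' j) \<le> infsum g J"
    unfolding tot by (rule infsum_mono[OF A gI bnd])
  also have "\<dots> = C * (\<Sum>\<^sub>\<infinity>i\<in>J. cmod (a i) * W i)" unfolding g_def by (rule infsum_cmult_right')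
  finally show ?B .
qed

lemma wpush_single:
  assumes "i \<in> J"
  shows "wpush J m e (\<lambda>l. if l = i then c else 0) = (\<lambda>j. if j = m i then c * e i else 0)"
proof
  fix j
  have "wpush J m e (\<lambda>l. if l = i then c else 0) j =
      infsum (\<lambda>l. (if l = i then c else 0) * e l) (if m i = j then {i} else {})"
    unfolding wpush_def by (rule infsum_cong_neutral) (use assms in \<open>auto split: if_splits\<close>)
  then show "wpush J m e (\<lambda>l. if l = i then c else 0) j = (if j = m i then c * e i else 0)" by auto
qed

lemma has_sum_subtract:
  fixes f g :: "'a \<Rightarrow> complex"
  assumes "(f has_sum a) A" "(g has_sum b) A"
  shows "((\<lambda>x. f x - g x) has_sum (a - b)) A"
  using has_sum_add[OF assms(1) has_sum_cmult_right[OF assms(2), of "- 1"]] by simp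

lemma wpush_diff:
  assumes "\<And>j. (\<lambda>i. a i * e i) summable_on {i \<in> J. m i = j}" "\<And>j. (\<lambda>i. a i * e' i) summable_on {i \<in> J. m i = j}"
  shows "wpush J m e a - wpush J m e' a = wpush J m (\<lambda>i. e i - e' i) a"
proof
  fix j
  show "(wpush J m e a - wpush J m e' a) j = wpush J m (\<lambda>i. e i - e' i) a j"
    using infsumI[OF has_sum_subtract[OF has_sum_infsum[OF assms(1)[of j]] has_sum_infsum[OF assms(2)[of j]]]]
    by (simp add: wpush_def right_diff_distrib)
qed

lemma wpush_scale: "wpush J m (\<lambda>i. c * e i) a j = c * wpush J m e a j"
  unfolding wpush_def infsum_cmult_right'[symmetric] by (simp only: mult_ac)

lemma wpush_add:
  assumes "\<And>j. (\<lambda>i. a i * e i) summable_on {i \<in> J. m i = j}" "\<And>j. (\<lambda>i. b i * e i) summable_on {i \<in> J. m i = j}"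
  shows "wpush J m e (a + b) = wpush J m e a + wpush J m e b"
proof
  fix j
  show "wpush J m e (a + b) j = (wpush J m e a + wpush J m e b) j"
    using infsum_add[OF assms(1)[of j] assms(2)[of j]] by (simp add: wpush_def distrib_right)
qed

lemma wpush_cmult: "wpush J m e (\<lambda>i. c * a i) j = c * wpush J m e a j"
  unfolding wpush_def infsum_cmult_right'[symmetric] by (simp only: mult.assoc)

section \<open>Laurent series on the punctured plane\<close>

definition laurent_coeff :: "(complex \<Rightarrow> complex) \<Rightarrow> int \<Rightarrow> complex" where
  "laurent_coeff g p = residue (\<lambda>w. g w * w powi (- p - 1)) 0"

lemma laurent_coeff_holomorphic:
  assumes "g holomorphic_on - {0}"
  shows "(\<lambda>w. g w * w powi q) holomorphic_on UNIV - {0}"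
  using assms by (auto intro!: holomorphic_intros simp: Compl_eq_Diff_UNIV)

lemma laurent_coeff_integral:
  assumes "g holomorphic_on - {0}" "0 < s"
  shows "((\<lambda>w. g w * w powi (- p - 1)) has_contour_integral 2 * pi * \<i> * laurent_coeff g p) (circlepath 0 s)"
  unfolding laurent_coeff_def
  by (rule base_residue[of UNIV]) (use assms laurent_coeff_holomorphic in auto)

text \<open>Cauchy's estimate. The radius \<open>s\<close> is free since the residue is given by the
  integral over every circle about the origin; large radii will serve for nonnegative
  \<open>p\<close> and small radii for negative \<open>p\<close>.\<close>

lemma laurent_coeff_bound:
  assumes g: "g holomorphic_on - {0}" and s: "0 < s" and M: "\<And>w. cmod w = s \<Longrightarrow> cmod (g w) \<le> M"
  shows "cmod (laurent_coeff g p) * s powi p \<le> M"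
proof -
  have "0 \<le> M" using M[of "of_real s"] s norm_ge_zero[of "g (of_real s)"] by (simp del: norm_ge_zero)
  have "norm (2 * pi * \<i> * laurent_coeff g p) \<le> (M * s powi (- p - 1)) * (2 * pi * s)"
  proof (rule has_contour_integral_bound_circlepath[OF laurent_coeff_integral[OF g s]])
    show "norm (g x * x powi (- p - 1)) \<le> M * s powi (- p - 1)" if "norm (x - 0) = s" for x
      using M[of x] s that by (simp add: norm_mult norm_power_int mult_right_mono)
  qed (use s \<open>0 \<le> M\<close> in auto)
  also have "\<dots> = 2 * pi * (M * s powi (- p))"
    using s by (simp add: power_int_diff)
  finally have "cmod (laurent_coeff g p) \<le> M * s powi (- p)" by (simp add: norm_mult)
  then show ?thesis using s by (simp add: power_int_minus field_simps)
qed

lemma laurent_coeff_add: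
  assumes "f holomorphic_on - {0}" "g holomorphic_on - {0}"
  shows "laurent_coeff (\<lambda>w. f w + g w) p = laurent_coeff f p + laurent_coeff g p"
  unfolding laurent_coeff_def distrib_right
  by (rule residue_add[of UNIV]) (use assms laurent_coeff_holomorphic in auto)

lemma laurent_coeff_cmult:
  assumes "g holomorphic_on - {0}"
  shows "laurent_coeff (\<lambda>w. c * g w) p = c * laurent_coeff g p"
  unfolding laurent_coeff_def mult.assoc
  by (rule residue_lmul[of UNIV]) (use assms laurent_coeff_holomorphic in auto)

lemma laurent_coeff_zero [simp]: "laurent_coeff (\<lambda>w. 0) p = 0"
  using residue_const[of 0 0] by (simp add: laurent_coeff_def)

lemma laurent_coeff_sum:
  assumes "\<And>i. i \<in> A \<Longrightarrow> f i holomorphic_on - {0}"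
  shows "laurent_coeff (\<lambda>w. \<Sum>i\<in>A. f i w) p = (\<Sum>i\<in>A. laurent_coeff (f i) p)"
  using assms
proof (induction A rule: infinite_finite_induct)
  case (insert i A)
  then show ?case by (auto simp: laurent_coeff_add holomorphic_on_sum)
qed auto

lemma laurent_coeff_monomial: "laurent_coeff (\<lambda>w. c * w powi q) p = (if p = q then c else 0)"
proof -
  have hol: "(\<lambda>w. w powi q) holomorphic_on - {0}" by (auto intro!: holomorphic_intros)
  have int: "((\<lambda>w. w powi q * w powi (- p - 1)) has_contour_integral
      2 * pi * \<i> * laurent_coeff (\<lambda>w. w powi q) p) (circlepath 0 1)"
    by (rule laurent_coeff_integral[OF hol]) simp
  have "2 * pi * \<i> * laurent_coeff (\<lambda>w. w powi q) p = (if p = q then 2 * pi * \<i> else 0)"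
  proof (rule has_contour_integral_unique[OF int], cases "p = q")
    case True
    have "((\<lambda>w. 1 / (w - 0)) has_contour_integral 2 * pi * \<i>) (circlepath (0::complex) 1)"
      using Cauchy_integral_circlepath_simple[of "\<lambda>_. 1" 0 1 0] by simp
    then show "((\<lambda>w. w powi q * w powi (- p - 1)) has_contour_integral (if p = q then 2 * pi * \<i> else 0))
        (circlepath 0 1)"
      unfolding if_P[OF True]
    proof (rule has_contour_integral_eq)
      fix w :: complex assume "w \<in> path_image (circlepath 0 1)"
      then have "w \<noteq> 0" by auto
      then show "1 / (w - 0) = w powi q * w powi (- p - 1)"
        using True by (simp add: power_int_add[symmetric] power_int_minus inverse_eq_divide)
    qed
  next
    case False
    \<comment> \<open>For distinct exponents the integrand has the single-valued primitive
      \<open>w powi (q - p) / of_int (q - p)\<close>, so its integral over the closed circle is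
      0.\<close>
    have prim: "((\<lambda>w. w powi (q - p - 1)) has_contour_integral
        (pathfinish (circlepath 0 1) powi (q - p) / of_int (q - p)
         - pathstart (circlepath 0 1) powi (q - p) / of_int (q - p))) (circlepath (0::complex) 1)"
    proof (rule contour_integral_primitive[where S = "- {0}"])
      fix w :: complex assume "w \<in> - {0}"
      then show "((\<lambda>w. w powi (q - p) / of_int (q - p)) has_field_derivative w powi (q - p - 1)) (at w within - {0})"
        using False by (auto intro!: derivative_eq_intros)
    qed auto
    have "((\<lambda>w. w powi q * w powi (- p - 1)) has_contour_integral 0) (circlepath 0 1)"
    proof (rule has_contour_integral_eq)
      show "((\<lambda>w. w powi (q - p - 1)) has_contour_integral 0) (circlepath (0::complex) 1)"
        using prim by simp
      fix w :: complex assume "w \<in> path_image (circlepath 0 1)"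
      then have "w \<noteq> 0" by auto
      then show "w powi (q - p - 1) = w powi q * w powi (- p - 1)"
        by (simp add: power_int_add[symmetric] algebra_simps)
    qed
    then show "((\<lambda>w. w powi q * w powi (- p - 1)) has_contour_integral (if p = q then 2 * pi * \<i> else 0))
        (circlepath 0 1)" using False by simp
  qed
  then show ?thesis using laurent_coeff_cmult[OF hol, of c p] by (auto split: if_splits)
qed

section \<open>Convergence and uniqueness of the Laurent expansion\<close>

lemma has_sum_int:
  fixes f :: "int \<Rightarrow> 'a::{topological_comm_monoid_add, t2_space}"
  assumes "((\<lambda>n. f (int n)) has_sum a) UNIV" "((\<lambda>n. f (- int n - 1)) has_sum b) UNIV"
  shows "(f has_sum (a + b)) UNIV"
proof -
  have 1: "(f has_sum a) (range int)"
    using assms(1) by (subst has_sum_reindex) (auto simp: o_def)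
  have 2: "(f has_sum b) (range (\<lambda>n. - int n - 1))"
    using assms(2) by (subst has_sum_reindex) (auto simp: o_def inj_def)
  have "x \<in> range int \<union> range (\<lambda>n. - int n - 1)" for x :: int
  proof (cases "x \<ge> 0")
    case True
    then have "x = int (nat x)" by simp
    then show ?thesis by blast
  next
    case False
    then have "x = - int (nat (- x - 1)) - 1" by simp
    then show ?thesis by blast
  qed
  then have "range int \<union> range (\<lambda>n. - int n - 1) = UNIV" by blast
  moreover have "range int \<inter> range (\<lambda>n. - int n - 1) = {}" by auto
  ultimately show ?thesis using has_sum_Un_disjoint[OF 1 2] by simp
qed

lemma summable_half_power_int: "(\<lambda>p::int. (1/2::real) ^ nat \<bar>p\<bar>) summable_on UNIV"
proof -
  have "summable (\<lambda>n. norm ((1/2::real) ^ n))" by (simp add: summable_geometric)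
  then have 1: "(\<lambda>n. (1/2::real) ^ n) summable_on UNIV"
    using norm_summable_imp_summable_on by blast
  then have "(\<lambda>n. (1/2::real) ^ n * (1/2)) summable_on UNIV" by (rule summable_on_cmult_left)
  moreover have "(\<lambda>n. (1/2::real) ^ n * (1/2)) = (\<lambda>n. (1/2) ^ nat \<bar>- int n - 1\<bar>)"
  proof
    fix n
    have "nat \<bar>- int n - 1\<bar> = Suc n" by linarith
    then show "(1/2::real) ^ n * (1/2) = (1/2) ^ nat \<bar>- int n - 1\<bar>" by simp
  qed
  ultimately have 2: "(\<lambda>n. (1/2::real) ^ nat \<bar>- int n - 1\<bar>) summable_on UNIV" by (simp only:)
  show ?thesis
    by (rule has_sum_imp_summable, rule has_sum_int[OF has_sum_infsum has_sum_infsum])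
       (use 1 2 in simp_all)
qed

text \<open>Integration term by term: the remainder is at most \<open>B * (1/2) ^ N\<close>
  uniformly on the circle, so its integral is at most that times the length of the circle and tends
  to 0.\<close>

lemma circle_integral_sums:
  fixes t B :: real
  assumes t: "0 < t" and u: "\<And>n. (u n has_contour_integral U n) (circlepath 0 t)"
    and G: "(G has_contour_integral I) (circlepath 0 t)"
    and B: "\<And>N \<zeta>. cmod \<zeta> = t \<Longrightarrow> norm (G \<zeta> - (\<Sum>n<N. u n \<zeta>)) \<le> B * (1/2) ^ N"
  shows "U sums I"
proof -
  have "0 \<le> B" using B[of "of_real t" 0] t norm_ge_zero[of "G (of_real t)"] by (simp del: norm_ge_zero)
  have bound: "norm (I - (\<Sum>n<N. U n)) \<le> B * (1/2) ^ N * (2 * pi * t)" for N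
  proof (rule has_contour_integral_bound_circlepath)
    show "((\<lambda>\<zeta>. G \<zeta> - (\<Sum>n<N. u n \<zeta>)) has_contour_integral I - (\<Sum>n<N. U n)) (circlepath 0 t)"
      by (intro has_contour_integral_diff has_contour_integral_sum G u) auto
  qed (use t B \<open>0 \<le> B\<close> in auto)
  have "(\<lambda>N. (1/2::real) ^ N) \<longlonglongrightarrow> 0" by (rule LIMSEQ_realpow_zero) auto
  then have "(\<lambda>N. B * (1/2) ^ N * (2 * pi * t)) \<longlonglongrightarrow> B * 0 * (2 * pi * t)"
    by (intro tendsto_mult tendsto_const)
  then have lim: "(\<lambda>N. B * (1/2) ^ N * (2 * pi * t)) \<longlonglongrightarrow> 0" by (simp only: mult_zero_left mult_zero_right)
  have "\<forall>\<^sub>F N in sequentially. norm (I - (\<Sum>n<N. U n)) \<le> B * (1/2) ^ N * (2 * pi * t)"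
    using bound by (intro always_eventually allI)
  then have "(\<lambda>N. I - (\<Sum>n<N. U n)) \<longlonglongrightarrow> 0" by (rule Lim_null_comparison[OF _ lim])
  then have "(\<lambda>N. I - (I - (\<Sum>n<N. U n))) \<longlonglongrightarrow> I - 0" by (intro tendsto_diff tendsto_const)
  then show ?thesis by (simp add: sums_def)
qed

text \<open>On the outer circle \<open>a\<close> will be the variable point and \<open>b\<close> the
  fixed one; on the inner circle the roles are exchanged. The ratio \<open>b / a\<close> has modulus
  1/2 in both cases.\<close>

lemma geometric_remainder:
  fixes a b :: complex
  assumes "a \<noteq> 0" "a \<noteq> b"
  shows "1 / (a - b) - (\<Sum>n<N. b ^ n / a ^ Suc n) = (b / a) ^ N / (a - b)"
proof (induction N)
  case (Suc N)
  have "1 / (a - b) - (\<Sum>n<Suc N. b ^ n / a ^ Suc n) = (b / a) ^ N / (a - b) - b ^ N / a ^ Suc N"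
    using Suc by simp
  also have "\<dots> = (b / a) ^ Suc N / (a - b)"
    using assms by (simp add: power_divide divide_simps) (simp add: algebra_simps)
  finally show ?case .
qed simp

lemma bounded_on_circle:
  fixes g :: "complex \<Rightarrow> complex"
  assumes "g holomorphic_on - {0}" "0 < s"
  obtains M where "0 \<le> M" "\<And>w. cmod w = s \<Longrightarrow> cmod (g w) \<le> M"
proof -
  have "continuous_on (sphere 0 s) g"
    by (rule holomorphic_on_imp_continuous_on[OF holomorphic_on_subset[OF assms(1)]]) (use assms in auto)
  then have "bounded (g ` sphere 0 s)" by (intro compact_imp_bounded compact_continuous_image) auto
  then obtain M where M: "0 < M" "\<forall>y\<in>g ` sphere 0 s. cmod y \<le> M" by (auto simp: bounded_pos)
  show ?thesis by (rule that[of M]) (use M in auto)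
qed

text \<open>
  The difference quotient of \<open>g\<close> at \<open>z\<close> is holomorphic off the origin, hence has the same
  integral over the circles of radius \<open>\<bar>z\<bar> / 2\<close> and \<open>2\<bar>z\<bar>\<close>. The Cauchy kernel
  is then expanded in a geometric series on each of them.
\<close>

theorem laurent_expansion_punctured_plane:
  assumes g: "g holomorphic_on - {0}" and z: "z \<noteq> 0"
  shows "((\<lambda>p. laurent_coeff g p * z powi p) has_sum g z) UNIV"
proof -
  define q where "q = (\<lambda>\<zeta>. if \<zeta> = z then deriv g z else (g \<zeta> - g z) / (\<zeta> - z))"
  have q: "q holomorphic_on - {0}"
    unfolding q_def by (rule pole_lemma_open[OF g]) auto
  \<comment> \<open>The residue \<open>K\<close> of the difference quotient stays unknown: it enters
    the sum over nonnegative exponents with a plus sign and the sum over negative exponents with a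
    minus sign, and cancels at the end.\<close>
  define K where "K = residue q 0"
  have K: "(q has_contour_integral 2 * pi * \<i> * K) (circlepath 0 t)" if "0 < t" for t
    unfolding K_def by (rule base_residue[of UNIV]) (use that q in \<open>auto simp: Compl_eq_Diff_UNIV\<close>)
  define R s where "R = 2 * cmod z" and "s = cmod z / 2"
  have R: "0 < R" "0 < s" using z by (auto simp: R_def s_def)
  obtain M where M: "0 \<le> M" "\<And>w. cmod w = R \<Longrightarrow> cmod (g w) \<le> M" using bounded_on_circle[OF g R(1)] by blast
  obtain M' where M': "0 \<le> M'" "\<And>w. cmod w = s \<Longrightarrow> cmod (g w) \<le> M'" using bounded_on_circle[OF g R(2)] by blast
  have kernel: "((\<lambda>\<zeta>. g \<zeta> / (\<zeta> - z)) has_contour_integral 2 * pi * \<i> * K + g z * c) (circlepath 0 t)"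
    if t: "0 < t" "t \<noteq> cmod z" and c: "((\<lambda>\<zeta>. 1 / (\<zeta> - z)) has_contour_integral c) (circlepath 0 t)" for t c
  proof (rule has_contour_integral_eq)
    show "((\<lambda>\<zeta>. q \<zeta> + g z * (1 / (\<zeta> - z))) has_contour_integral 2 * pi * \<i> * K + g z * c) (circlepath 0 t)"
      by (intro has_contour_integral_add has_contour_integral_lmul K t c)
    fix \<zeta> assume "\<zeta> \<in> path_image (circlepath 0 t)"
    then have "\<zeta> \<noteq> z" using t by auto
    then show "q \<zeta> + g z * (1 / (\<zeta> - z)) = g \<zeta> / (\<zeta> - z)" by (simp add: q_def diff_divide_distrib)
  qed
  \<comment> \<open>The outer circle winds once around \<open>z\<close> while the inner circle does
    not enclose it. This is the only source of the term \<open>g z\<close>.\<close>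
  have out: "((\<lambda>\<zeta>. 1 / (\<zeta> - z)) has_contour_integral 2 * pi * \<i> * 1) (circlepath 0 R)"
    using Cauchy_integral_circlepath_simple[of "\<lambda>_. 1" 0 R z] z by (simp add: R_def)
  have sz: "s < cmod z" using z by (simp add: s_def)
  have inn: "((\<lambda>\<zeta>. 1 / (\<zeta> - z)) has_contour_integral 0) (circlepath 0 s)"
  proof (rule Cauchy_theorem_disc_simple[of _ 0 "cmod z"])
    show "(\<lambda>\<zeta>. 1 / (\<zeta> - z)) holomorphic_on ball 0 (cmod z)" by (auto intro!: holomorphic_intros)
  qed (use sz R in auto)
  have S1: "(\<lambda>n. z ^ n * (2 * pi * \<i> * laurent_coeff g (int n))) sums (2 * pi * \<i> * K + g z * (2 * pi * \<i> * 1))"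
  proof (rule circle_integral_sums[OF R(1)])
    show "((\<lambda>w. z ^ n * (g w * w powi (- int n - 1))) has_contour_integral
        z ^ n * (2 * pi * \<i> * laurent_coeff g (int n))) (circlepath 0 R)" for n
      by (intro has_contour_integral_lmul laurent_coeff_integral g R)
    show "((\<lambda>\<zeta>. g \<zeta> / (\<zeta> - z)) has_contour_integral 2 * pi * \<i> * K + g z * (2 * pi * \<i> * 1)) (circlepath 0 R)"
      by (rule kernel[OF R(1) _ out]) (use z in \<open>auto simp: R_def\<close>)
    fix N \<zeta> assume \<zeta>: "cmod \<zeta> = R"
    then have ne: "\<zeta> \<noteq> 0" "\<zeta> \<noteq> z" using R z by (auto simp: R_def)
    have pw: "w powi (- int n - 1) = 1 / w ^ Suc n" if "w \<noteq> 0" for w :: complex and n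
      using that by (simp add: power_int_diff power_int_minus field_simps)
    have "g \<zeta> / (\<zeta> - z) - (\<Sum>n<N. z ^ n * (g \<zeta> * \<zeta> powi (- int n - 1))) =
        g \<zeta> * (1 / (\<zeta> - z) - (\<Sum>n<N. z ^ n / \<zeta> ^ Suc n))"
      using ne by (simp add: pw right_diff_distrib sum_distrib_left mult_ac)
    also have "\<dots> = g \<zeta> * ((z / \<zeta>) ^ N / (\<zeta> - z))" by (simp only: geometric_remainder[OF ne])
    finally have "norm (g \<zeta> / (\<zeta> - z) - (\<Sum>n<N. z ^ n * (g \<zeta> * \<zeta> powi (- int n - 1)))) =
        cmod (g \<zeta>) * ((cmod z / cmod \<zeta>) ^ N / cmod (\<zeta> - z))"
      by (simp add: norm_mult norm_divide norm_power)
    also have "\<dots> \<le> M * ((1/2) ^ N / cmod z)"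
    proof (intro mult_mono frac_le)
      show "cmod z \<le> cmod (\<zeta> - z)" using norm_triangle_ineq2[of \<zeta> z] \<zeta> by (simp add: R_def)
      show "(cmod z / cmod \<zeta>) ^ N \<le> (1/2) ^ N" using z by (simp add: \<zeta> R_def)
    qed (use M \<zeta> z in auto)
    finally show "norm (g \<zeta> / (\<zeta> - z) - (\<Sum>n<N. z ^ n * (g \<zeta> * \<zeta> powi (- int n - 1)))) \<le>
        M / cmod z * (1/2) ^ N" by simp
  qed
  \<comment> \<open>On the inner circle \<open>1 / (\<zeta> - z)\<close> is minus the sum of the
    terms \<open>\<zeta> ^ n / z ^ Suc n\<close>; the power \<open>\<zeta> ^ n\<close> belongs to
    the coefficient of index \<open>- int n - 1\<close>.\<close>
  have S2: "(\<lambda>n. - 1 / z ^ Suc n * (2 * pi * \<i> * laurent_coeff g (- int n - 1))) sums (2 * pi * \<i> * K + g z * 0)"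
  proof (rule circle_integral_sums[OF R(2)])
    show "((\<lambda>w. - 1 / z ^ Suc n * (g w * w powi (- (- int n - 1) - 1))) has_contour_integral
        - 1 / z ^ Suc n * (2 * pi * \<i> * laurent_coeff g (- int n - 1))) (circlepath 0 s)" for n
      by (intro has_contour_integral_lmul laurent_coeff_integral g R)
    show "((\<lambda>\<zeta>. g \<zeta> / (\<zeta> - z)) has_contour_integral 2 * pi * \<i> * K + g z * 0) (circlepath 0 s)"
      by (rule kernel[OF R(2) _ inn]) (use z in \<open>auto simp: s_def\<close>)
    fix N \<zeta> assume \<zeta>: "cmod \<zeta> = s"
    then have ne: "z \<noteq> 0" "z \<noteq> \<zeta>" using R z by (auto simp: s_def)
    have kern: "g \<zeta> / (\<zeta> - z) = - (g \<zeta> * (1 / (z - \<zeta>)))"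
      using minus_divide_right[of "g \<zeta>" "z - \<zeta>"] by simp
    have "g \<zeta> / (\<zeta> - z) - (\<Sum>n<N. - 1 / z ^ Suc n * (g \<zeta> * \<zeta> powi (- (- int n - 1) - 1))) =
        - (g \<zeta> * (1 / (z - \<zeta>) - (\<Sum>n<N. \<zeta> ^ n / z ^ Suc n)))"
      unfolding kern by (simp add: right_diff_distrib sum_distrib_left sum_negf mult_ac)
    also have "\<dots> = - (g \<zeta> * ((\<zeta> / z) ^ N / (z - \<zeta>)))" by (simp only: geometric_remainder[OF ne])
    finally have "norm (g \<zeta> / (\<zeta> - z) - (\<Sum>n<N. - 1 / z ^ Suc n * (g \<zeta> * \<zeta> powi (- (- int n - 1) - 1)))) =
        cmod (g \<zeta>) * ((cmod \<zeta> / cmod z) ^ N / cmod (z - \<zeta>))"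
      by (simp only: norm_mult norm_divide norm_power norm_minus_cancel)
    also have "\<dots> \<le> M' * ((1/2) ^ N / (cmod z / 2))"
    proof (intro mult_mono frac_le)
      show "cmod z / 2 \<le> cmod (z - \<zeta>)" using norm_triangle_ineq2[of z \<zeta>] \<zeta> by (simp add: s_def)
      show "(cmod \<zeta> / cmod z) ^ N \<le> (1/2) ^ N" using z by (simp add: \<zeta> s_def)
    qed (use M' \<zeta> z in auto)
    finally show "norm (g \<zeta> / (\<zeta> - z) - (\<Sum>n<N. - 1 / z ^ Suc n * (g \<zeta> * \<zeta> powi (- (- int n - 1) - 1)))) \<le>
        M' / (cmod z / 2) * (1/2) ^ N" by (simp add: mult_ac)
  qed
  define f where "f p = laurent_coeff g p * z powi p" for p
  have cancel: "(a * (2 * pi * \<i> * l)) / (2 * pi * \<i>) = l * a" for a l :: complex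
  proof -
    have *: "(a * (c * l)) / c = l * a" if "c \<noteq> 0" for c using that by simp
    show ?thesis by (rule *) simp
  qed
  have "(\<lambda>n. (z ^ n * (2 * pi * \<i> * laurent_coeff g (int n))) / (2 * pi * \<i>)) sums
      ((2 * pi * \<i> * K + g z * (2 * pi * \<i> * 1)) / (2 * pi * \<i>))" by (rule sums_divide[OF S1])
  moreover have "(z ^ n * (2 * pi * \<i> * laurent_coeff g (int n))) / (2 * pi * \<i>) = f (int n)" for n
    unfolding cancel by (simp add: f_def)
  moreover have "(2 * pi * \<i> * K + g z * (2 * pi * \<i> * 1)) / (2 * pi * \<i>) = K + g z"
    by (simp add: field_simps)
  ultimately have F1: "(\<lambda>n. f (int n)) sums (K + g z)" by simp
  have "(\<lambda>n. (- 1 / z ^ Suc n * (2 * pi * \<i> * laurent_coeff g (- int n - 1))) / (- (2 * pi * \<i>))) sums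
      ((2 * pi * \<i> * K + g z * 0) / (- (2 * pi * \<i>)))" by (rule sums_divide[OF S2])
  moreover have "(- 1 / z ^ Suc n * (2 * pi * \<i> * laurent_coeff g (- int n - 1))) / (- (2 * pi * \<i>)) =
      f (- int n - 1)" for n
  proof -
    have "z powi (- int n - 1) = 1 / z ^ Suc n"
      using z by (simp add: power_int_diff power_int_minus field_simps)
    then show ?thesis
      unfolding minus_divide_left[symmetric] mult_minus_left minus_divide_divide cancel by (simp add: f_def)
  qed
  moreover have "(2 * pi * \<i> * K + g z * 0) / (- (2 * pi * \<i>)) = - K" by (simp add: field_simps)
  ultimately have F2: "(\<lambda>n. f (- int n - 1)) sums (- K)" by simp
  have geo: "summable (\<lambda>n. C * (1/2::real) ^ n)" for C by (intro summable_mult summable_geometric) auto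
  \<comment> \<open>\<open>has_sum\<close> is unconditional, so convergence must be upgraded to
    absolute convergence. The Cauchy estimate at twice the modulus of \<open>z\<close> gives the
    decay \<open>(1/2) ^ n\<close>, and the one at half the modulus does the same for negative
    exponents.\<close>
  have "norm (f (int n)) \<le> M * (1/2) ^ n" for n
  proof -
    have "cmod (laurent_coeff g (int n)) * R ^ n \<le> M"
      using laurent_coeff_bound[OF g R(1) M(2), of "int n"] by simp
    then have "cmod (laurent_coeff g (int n)) * R ^ n * (1/2) ^ n \<le> M * (1/2) ^ n"
      by (intro mult_right_mono) auto
    moreover have "R ^ n * (1/2) ^ n = cmod z ^ n"
      unfolding power_mult_distrib[symmetric] by (simp add: R_def)
    ultimately show ?thesis
      unfolding f_def norm_mult norm_power power_int_of_nat mult.assoc by simp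
  qed
  then have N1: "summable (\<lambda>n. norm (f (int n)))"
    by (intro summable_comparison_test'[OF geo[of M]]) auto
  have "norm (f (- int n - 1)) \<le> M' * (1/2) ^ n" for n
  proof -
    have "cmod (laurent_coeff g (- int n - 1)) * s powi (- int n - 1) \<le> M'"
      by (rule laurent_coeff_bound[OF g R(2) M'(2)])
    moreover have "s powi (- int n - 1) = (2 * 2 ^ n) * cmod z powi (- int n - 1)"
      using z by (simp add: s_def power_int_diff power_int_minus field_simps)
    ultimately have "norm (f (- int n - 1)) * (2 * 2 ^ n) \<le> M'"
      by (simp add: f_def norm_mult norm_power_int mult_ac)
    moreover have "norm (f (- int n - 1)) * 2 ^ n \<le> norm (f (- int n - 1)) * (2 * 2 ^ n)"
      by (intro mult_left_mono) auto
    ultimately have "norm (f (- int n - 1)) * 2 ^ n \<le> M'" by linarith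
    then show ?thesis by (simp add: field_simps)
  qed
  then have N2: "summable (\<lambda>n. norm (f (- int n - 1)))"
    by (intro summable_comparison_test'[OF geo[of M']]) auto
  have "(f has_sum (K + g z + - K)) UNIV"
    by (intro has_sum_int norm_summable_imp_has_sum N1 N2 F1 F2)
  then show ?thesis by (simp add: f_def[abs_def])
qed

text \<open>Remove a finite partial sum that contains the index \<open>p\<close> and leaves a tail
  of at most \<epsilon>. What remains, \<open>h\<close>, is bounded by \<epsilon> on the unit
  circle, and so is its coefficient \<open>laurent_coeff g p - c p\<close> by the Cauchy estimate at
  radius 1.\<close>

lemma laurent_coeff_unique:
  assumes g: "g holomorphic_on - {0}" and c: "(\<lambda>p. norm (c p)) summable_on UNIV"
    and sum: "\<And>w. cmod w = 1 \<Longrightarrow> ((\<lambda>p. c p * w powi p) has_sum g w) UNIV"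
  shows "laurent_coeff g p = c p"
proof -
  have "cmod (laurent_coeff g p - c p) \<le> \<epsilon>" if \<epsilon>: "\<epsilon> > 0" for \<epsilon>
  proof -
    obtain B0 where B0: "finite B0" "dist (\<Sum>p\<in>B0. norm (c p)) (\<Sum>\<^sub>\<infinity>p. norm (c p)) \<le> \<epsilon>"
      using infsum_finite_approximation[OF c \<epsilon>] by blast
    define B where "B = insert p B0"
    have B: "finite B" "p \<in> B" using B0 by (auto simp: B_def)
    have "(\<Sum>p\<in>B0. norm (c p)) \<le> (\<Sum>p\<in>B. norm (c p))"
      using B0 by (intro sum_mono2) (auto simp: B_def)
    then have tail: "(\<Sum>\<^sub>\<infinity>p\<in>UNIV - B. norm (c p)) \<le> \<epsilon>"
      using B0(2) B by (subst infsum_Diff[OF c]) (auto simp: dist_real_def)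
    define h where "h w = g w + (\<Sum>q\<in>B. (- c q) * w powi q)" for w
    have mono: "(\<lambda>w. a * w powi q) holomorphic_on - {0}" for a q by (auto intro!: holomorphic_intros)
    have sum_hol: "(\<lambda>w. \<Sum>q\<in>B. (- c q) * w powi q) holomorphic_on - {0}"
      by (intro holomorphic_on_sum mono)
    have h: "h holomorphic_on - {0}" unfolding h_def by (intro holomorphic_on_add g sum_hol)
    have "laurent_coeff h p = laurent_coeff g p + (\<Sum>q\<in>B. laurent_coeff (\<lambda>w. (- c q) * w powi q) p)"
      unfolding h_def laurent_coeff_add[OF g sum_hol] by (subst laurent_coeff_sum[OF mono]) simp
    also have "(\<Sum>q\<in>B. laurent_coeff (\<lambda>w. (- c q) * w powi q) p) = - c p"
      using B by (subst laurent_coeff_monomial) simp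
    finally have lh: "laurent_coeff h p = laurent_coeff g p - c p" by simp
    have "cmod (h w) \<le> \<epsilon>" if w: "cmod w = 1" for w
    proof -
      have n1: "norm (c p * w powi p) = norm (c p)" for p using w by (simp add: norm_mult norm_power_int)
      have s: "(\<lambda>p. c p * w powi p) summable_on UNIV" "infsum (\<lambda>p. c p * w powi p) UNIV = g w"
        using sum[OF w] by (auto simp: summable_on_def infsumI)
      have "h w = infsum (\<lambda>p. c p * w powi p) (UNIV - B)"
        using B s by (subst infsum_Diff[OF s(1)]) (auto simp: h_def sum_negf)
      also have "norm \<dots> \<le> (\<Sum>\<^sub>\<infinity>p\<in>UNIV - B. norm (c p * w powi p))"
        by (rule norm_infsum_bound) (unfold n1, rule summable_on_subset_banach[OF c], simp)
      finally show ?thesis using tail by (simp add: n1)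
    qed
    then show ?thesis using laurent_coeff_bound[OF h, of 1 \<epsilon> p] lh by simp
  qed
  then have "cmod (laurent_coeff g p - c p) \<le> 0" by (rule field_le_epsilon[where y = 0, simplified])
  then show ?thesis by simp
qed

section \<open>The algebra of free power series\<close>

text \<open>The exponent of \<tau> in the norm of a free series is the number of maximal runs of
  equal letters. The value -1 of \<open>switches\<close> at the empty word makes it 0 there.\<close>

definition blocks :: "nat list \<Rightarrow> nat" where
  "blocks \<alpha> = nat (switches \<alpha> + 1)"

lemma blocks_Nil [simp]: "blocks [] = 0"
  and blocks_single [simp]: "blocks [x] = 1"
  by (simp_all add: blocks_def switches_def)

lemma blocks_Cons_Cons [simp]: "blocks (x # y # xs) = blocks (y # xs) + (if x = y then 0 else 1)"
proof -
  define D where "D xs = {i. Suc i < length xs \<and> xs ! i \<noteq> xs ! Suc i}" for xs :: "nat list"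
  have fin: "finite (D xs)" for xs
    by (rule finite_subset[of _ "{..<length xs}"]) (auto simp: D_def)
  have D1: "D [x] = {}" for x by (auto simp: D_def)
  have blocks: "blocks (x # xs) = Suc (card (D (x # xs)))" for x xs
    by (cases xs) (auto simp: blocks_def switches_def D1[unfolded D_def] D_def)
  have "D (x # y # xs) = (if x = y then {} else {0}) \<union> Suc ` D (y # xs)"
  proof (rule Set.set_eqI)
    fix i show "i \<in> D (x # y # xs) \<longleftrightarrow> i \<in> (if x = y then {} else {0}) \<union> Suc ` D (y # xs)"
      by (cases i) (auto simp: D_def)
  qed
  then have "card (D (x # y # xs)) = (if x = y then 0 else 1) + card (D (y # xs))"
    using fin[of "y # xs"] by (cases "x = y") (simp_all add: card_image)
  then show ?thesis by (simp add: blocks)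
qed

text \<open>At the seam two runs may merge, but no new run arises. This makes the weights of words
  submultiplicative.\<close>

lemma blocks_append: "blocks (\<alpha> @ \<beta>) \<le> blocks \<alpha> + blocks \<beta>"
proof (induction \<alpha>)
  case (Cons x \<alpha>)
  show ?case
  proof (cases \<alpha>)
    case Nil
    then show ?thesis by (cases \<beta>) auto
  next
    case (Cons y ys)
    then show ?thesis using Cons.IH by auto
  qed
qed simp

lemma blocks_Cons_le: "blocks xs \<le> blocks (x # xs)"
  by (cases xs) auto

text \<open>Conversely, cutting a word in two breaks at most one run.\<close>

lemma blocks_split: "blocks \<alpha> + blocks (x # \<beta>) \<le> blocks (\<alpha> @ x # \<beta>) + 1"
proof (induction \<alpha>)
  case (Cons y \<alpha>)
  then show ?case by (cases \<alpha>) auto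
qed simp

lemma blocks_replicate: "blocks (replicate m x) \<le> 1"
proof (induction m)
  case (Suc m)
  then show ?case by (cases m) auto
qed simp

lemma words_append: "\<alpha> @ \<beta> \<in> words n \<longleftrightarrow> \<alpha> \<in> words n \<and> \<beta> \<in> words n"
  by (auto simp: words_def)

lemma words_Nil [simp]: "[] \<in> words n"
  by (simp add: words_def)

lemma words_Cons [simp]: "i # \<alpha> \<in> words n \<longleftrightarrow> i \<in> {1..n} \<and> \<alpha> \<in> words n"
  by (auto simp: words_def)

section \<open>The product of free series\<close>

lemma has_sum_product_nonneg:
  fixes f :: "'a \<Rightarrow> real" and g :: "'b \<Rightarrow> real"
  assumes "f summable_on A" "g summable_on B" "\<And>x. x \<in> A \<Longrightarrow> 0 \<le> f x" "\<And>y. y \<in> B \<Longrightarrow> 0 \<le> g y"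
  shows "((\<lambda>(x, y). f x * g y) has_sum infsum f A * infsum g B) (A \<times> B)"
proof -
  have P: "(\<lambda>(x, y). f x * g y) summable_on A \<times> B"
  proof (rule summable_on_SigmaI)
    show "((\<lambda>y. case (x, y) of (x, y) \<Rightarrow> f x * g y) has_sum f x * infsum g B) B" for x
      by (simp add: has_sum_cmult_right has_sum_infsum assms)
    show "(\<lambda>x. f x * infsum g B) summable_on A" by (intro summable_on_cmult_left assms)
  qed (use assms in auto)
  have "infsum (\<lambda>(x, y). f x * g y) (A \<times> B) = (\<Sum>\<^sub>\<infinity>x\<in>A. \<Sum>\<^sub>\<infinity>y\<in>B. f x * g y)"
    using infsum_Sigma_banach[OF P] by simp
  also have "\<dots> = infsum f A * infsum g B"
    by (simp add: infsum_cmult_right' infsum_cmult_left')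
  finally show ?thesis using P has_sum_infsum by metis
qed

text \<open>Both sides sum over the ways to cut a word at two places. The left side names the later
  cut first, which explains the substitution of \<open>(i, j)\<close> by
  \<open>(j, i - j)\<close>.\<close>

lemma free_mult_assoc: "free_mult (free_mult a b) c = free_mult a (free_mult b c)"
proof
  fix \<alpha>
  have "free_mult (free_mult a b) c \<alpha> =
      (\<Sum>(i, j)\<in>(SIGMA i:{..length \<alpha>}. {..i}). a (take j \<alpha>) * b (drop j (take i \<alpha>)) * c (drop i \<alpha>))"
  proof -
    have "free_mult (free_mult a b) c \<alpha> =
        (\<Sum>i\<le>length \<alpha>. \<Sum>j\<le>i. a (take j \<alpha>) * b (drop j (take i \<alpha>)) * c (drop i \<alpha>))"
      unfolding free_mult_def by (rule sum.cong) (auto simp: sum_distrib_right min_def intro!: sum.cong)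
    then show ?thesis by (simp add: sum.Sigma)
  qed
  also have "\<dots> = (\<Sum>(j, k)\<in>(SIGMA j:{..length \<alpha>}. {..length \<alpha> - j}).
      a (take j \<alpha>) * (b (take k (drop j \<alpha>)) * c (drop k (drop j \<alpha>))))"
    by (rule sum.reindex_bij_witness[where i = "\<lambda>(j, k). (j + k, j)" and j = "\<lambda>(i, j). (j, i - j)"])
       (auto simp: drop_take mult.assoc)
  also have "\<dots> = free_mult a (free_mult b c) \<alpha>"
    by (simp add: free_mult_def sum_distrib_left sum.Sigma)
  finally show "free_mult (free_mult a b) c \<alpha> = free_mult a (free_mult b c) \<alpha>" .
qed

lemma free_mult_add:
  "free_mult (a + b) c = free_mult a c + free_mult b c"
  "free_mult a (b + c) = free_mult a b + free_mult a c"
  by (auto simp: free_mult_def fun_eq_iff distrib_right distrib_left sum.distrib)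

lemma free_mult_diff:
  "free_mult (a - b) c = free_mult a c - free_mult b c"
  "free_mult a (b - c) = free_mult a b - free_mult a c"
  by (auto simp: free_mult_def fun_eq_iff left_diff_distrib right_diff_distrib sum_subtractf)

lemma free_mult_scale:
  "free_mult (\<lambda>\<alpha>. c * a \<alpha>) b = (\<lambda>\<alpha>. c * free_mult a b \<alpha>)"
  "free_mult a (\<lambda>\<alpha>. c * b \<alpha>) = (\<lambda>\<alpha>. c * free_mult a b \<alpha>)"
  by (auto simp: free_mult_def fun_eq_iff sum_distrib_left mult_ac)

lemma free_mult_one:
  "free_mult (free_word []) a = a" "free_mult a (free_word []) = a"
proof -
  show "free_mult (free_word []) a = a"
  proof
    fix \<alpha>
    have "free_mult (free_word []) a \<alpha> = (\<Sum>i\<le>length \<alpha>. if i = 0 then a \<alpha> else 0)"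
      unfolding free_mult_def by (rule sum.cong) (auto simp: free_word_def)
    then show "free_mult (free_word []) a \<alpha> = a \<alpha>" by simp
  qed
  show "free_mult a (free_word []) = a"
  proof
    fix \<alpha>
    have "free_mult a (free_word []) \<alpha> = (\<Sum>i\<le>length \<alpha>. if i = length \<alpha> then a \<alpha> else 0)"
      unfolding free_mult_def by (rule sum.cong) (auto simp: free_word_def)
    then show "free_mult a (free_word []) \<alpha> = a \<alpha>" by simp
  qed
qed

lemma free_mult_word: "free_mult (free_word \<alpha>) (free_word \<beta>) = free_word (\<alpha> @ \<beta>)"
proof
  fix \<gamma>
  have "free_mult (free_word \<alpha>) (free_word \<beta>) \<gamma> =
      (\<Sum>i\<le>length \<gamma>. if i = length \<alpha> then (if \<gamma> = \<alpha> @ \<beta> then 1 else 0) else 0)"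
    unfolding free_mult_def
  proof (rule sum.cong)
    fix i assume "i \<in> {..length \<gamma>}"
    then have eq: "take i \<gamma> = \<alpha> \<and> drop i \<gamma> = \<beta> \<longleftrightarrow> i = length \<alpha> \<and> \<gamma> = \<alpha> @ \<beta>"
      by (metis append_eq_conv_conj append_take_drop_id atMost_iff length_take min.absorb2)
    have "free_word \<alpha> (take i \<gamma>) * free_word \<beta> (drop i \<gamma>) =
        (if take i \<gamma> = \<alpha> \<and> drop i \<gamma> = \<beta> then 1 else 0)"
      by (simp add: free_word_def)
    then show "free_word \<alpha> (take i \<gamma>) * free_word \<beta> (drop i \<gamma>) =
        (if i = length \<alpha> then (if \<gamma> = \<alpha> @ \<beta> then 1 else 0) else 0)"
      unfolding eq by simp
  qed simp
  also have "\<dots> = free_word (\<alpha> @ \<beta>) \<gamma>" by (auto simp: free_word_def)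
  finally show "free_mult (free_word \<alpha>) (free_word \<beta>) \<gamma> = free_word (\<alpha> @ \<beta>) \<gamma>" .
qed

definition word_weight :: "real \<Rightarrow> real \<Rightarrow> nat list \<Rightarrow> real" where
  "word_weight \<rho> \<tau> \<alpha> = \<rho> ^ length \<alpha> * \<tau> ^ blocks \<alpha>"

lemma free_term_weight: "free_term \<rho> \<tau> a \<alpha> = cmod (a \<alpha>) * word_weight \<rho> \<tau> \<alpha>"
  by (simp add: free_term_def word_weight_def blocks_def)

lemma word_weight_append:
  assumes "0 < \<rho>" "1 \<le> \<tau>"
  shows "word_weight \<rho> \<tau> (\<alpha> @ \<beta>) \<le> word_weight \<rho> \<tau> \<alpha> * word_weight \<rho> \<tau> \<beta>"
proof -
  have "\<tau> ^ blocks (\<alpha> @ \<beta>) \<le> \<tau> ^ (blocks \<alpha> + blocks \<beta>)"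
    using assms blocks_append by (intro power_increasing) auto
  then have "\<rho> ^ (length \<alpha> + length \<beta>) * \<tau> ^ blocks (\<alpha> @ \<beta>) \<le> \<rho> ^ (length \<alpha> + length \<beta>) * \<tau> ^ (blocks \<alpha> + blocks \<beta>)"
    using assms by (intro mult_left_mono) auto
  then show ?thesis by (simp add: word_weight_def power_add mult_ac)
qed

locale deformation =
  fixes n :: nat and r :: ereal
  assumes radius_pos: "0 < r"
begin

lemma paramsD: "(\<rho>, \<tau>) \<in> params r \<Longrightarrow> 0 < \<rho> \<and> 1 \<le> \<tau>"
  by (simp add: params_def)

lemma params_scale: "(\<rho>, \<tau>) \<in> params r \<Longrightarrow> \<tau> \<le> \<tau>' \<Longrightarrow> (\<rho>, \<tau>') \<in> params r"
  by (simp add: params_def)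

lemma word_weight_pos: "(\<rho>, \<tau>) \<in> params r \<Longrightarrow> 0 < word_weight \<rho> \<tau> \<alpha>"
  using paramsD by (fastforce simp: word_weight_def)

sublocale F: koethe_space "free_carrier n r" "\<lambda>a. a" "words n" word_weight r
proof (rule koethe_space_id)
  fix \<rho> \<tau> \<rho>' \<tau>' \<alpha> assume *: "(\<rho>, \<tau>) \<in> params r" "(\<rho>', \<tau>') \<in> params r" "\<rho> \<le> \<rho>'" "\<tau> \<le> \<tau>'"
  then show "word_weight \<rho> \<tau> \<alpha> \<le> word_weight \<rho>' \<tau>' \<alpha>"
    using paramsD[of \<rho> \<tau>] unfolding word_weight_def by (intro mult_mono power_mono) auto
qed (auto simp: radius_pos word_weight_pos free_carrier_def free_term_weight[abs_def])

lemma free_norm_eq: "free_norm n = F.nrm"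
  by (simp add: fun_eq_iff free_norm_def F.nrm_def free_term_weight)

lemma top_free_algebra: "alg_top (free_algebra n r) = F.top"
  by (simp add: free_algebra_def free_norm_eq)

lemma free_carrierI:
  assumes "\<And>\<alpha>. \<alpha> \<notin> words n \<Longrightarrow> a \<alpha> = 0"
    and "\<And>\<rho> \<tau>. (\<rho>, \<tau>) \<in> params r \<Longrightarrow> (\<lambda>\<alpha>. cmod (a \<alpha>) * word_weight \<rho> \<tau> \<alpha>) summable_on words n"
  shows "a \<in> free_carrier n r"
  using assms by (auto simp: free_carrier_def free_term_weight[abs_def])

lemma free_carrier_off: "a \<in> free_carrier n r \<Longrightarrow> \<alpha> \<notin> words n \<Longrightarrow> a \<alpha> = 0"
  by (simp add: free_carrier_def)

lemma free_scale:
  assumes "a \<in> free_carrier n r"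
  shows "(\<lambda>\<alpha>. c * a \<alpha>) \<in> free_carrier n r" "F.nrm \<rho> \<tau> (\<lambda>\<alpha>. c * a \<alpha>) = cmod c * F.nrm \<rho> \<tau> a"
proof -
  show "(\<lambda>\<alpha>. c * a \<alpha>) \<in> free_carrier n r"
  proof (rule free_carrierI)
    show "(\<lambda>\<alpha>. cmod (c * a \<alpha>) * word_weight \<rho> \<tau> \<alpha>) summable_on words n"
      if "(\<rho>, \<tau>) \<in> params r" for \<rho> \<tau>
      using summable_on_cmult_right[OF F.coord_summable[OF assms that], of "cmod c"]
      by (simp add: norm_mult mult.assoc)
  qed (use assms free_carrier_off in auto)
  show "F.nrm \<rho> \<tau> (\<lambda>\<alpha>. c * a \<alpha>) = cmod c * F.nrm \<rho> \<tau> a"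
    unfolding F.nrm_def by (simp add: norm_mult mult.assoc infsum_cmult_right')
qed

text \<open>The product is the push-forward of the family \<open>a \<alpha> * b \<beta>\<close>
  along concatenation, and the fibre over a word consists of its cuts. So \<open>wpush_bound\<close>
  with constant 1 gives membership and submultiplicativity at once.\<close>

lemma free_mult_mem:
  assumes a: "a \<in> free_carrier n r" and b: "b \<in> free_carrier n r"
  shows "free_mult a b \<in> free_carrier n r"
    and "(\<rho>, \<tau>) \<in> params r \<Longrightarrow> F.nrm \<rho> \<tau> (free_mult a b) \<le> F.nrm \<rho> \<tau> a * F.nrm \<rho> \<tau> b"
proof -
  let ?J = "words n \<times> words n"
  let ?m = "\<lambda>(\<alpha>, \<beta>). \<alpha> @ \<beta> :: nat list"
  let ?c = "\<lambda>(\<alpha>, \<beta>). a \<alpha> * b \<beta>"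
  have off: "free_mult a b \<gamma> = 0" if "\<gamma> \<notin> words n" for \<gamma>
    unfolding free_mult_def
  proof (rule sum.neutral, rule ballI)
    fix i
    have "take i \<gamma> \<notin> words n \<or> drop i \<gamma> \<notin> words n"
      using words_append[of "take i \<gamma>" "drop i \<gamma>" n] that by simp
    then show "a (take i \<gamma>) * b (drop i \<gamma>) = 0" using free_carrier_off a b by auto
  qed
  have eq: "free_mult a b \<gamma> = wpush ?J ?m (\<lambda>_. 1) ?c \<gamma>" if "\<gamma> \<in> words n" for \<gamma>
  proof -
    have bij: "bij_betw (\<lambda>i. (take i \<gamma>, drop i \<gamma>)) {..length \<gamma>} {u \<in> ?J. ?m u = \<gamma>}"
      by (rule bij_betwI[where g = "\<lambda>(\<alpha>, \<beta>). length \<alpha>"])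
         (use that words_append[of "take i \<gamma>" "drop i \<gamma>" n for i] in auto)
    have "wpush ?J ?m (\<lambda>_. 1) ?c \<gamma> = infsum (\<lambda>i. a (take i \<gamma>) * b (drop i \<gamma>)) {..length \<gamma>}"
      unfolding wpush_def using infsum_reindex_bij_betw[OF bij, of "\<lambda>u. ?c u * 1"] by simp
    then show ?thesis by (simp add: free_mult_def)
  qed
  have S: "(\<lambda>\<gamma>. cmod (free_mult a b \<gamma>) * word_weight \<rho> \<tau> \<gamma>) summable_on words n \<and>
      F.nrm \<rho> \<tau> (free_mult a b) \<le> F.nrm \<rho> \<tau> a * F.nrm \<rho> \<tau> b" if p: "(\<rho>, \<tau>) \<in> params r" for \<rho> \<tau>
  proof -
    let ?W = "\<lambda>(\<alpha>, \<beta>). word_weight \<rho> \<tau> \<alpha> * word_weight \<rho> \<tau> \<beta>"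
    have "((\<lambda>(\<alpha>, \<beta>). (cmod (a \<alpha>) * word_weight \<rho> \<tau> \<alpha>) * (cmod (b \<beta>) * word_weight \<rho> \<tau> \<beta>))
        has_sum F.nrm \<rho> \<tau> a * F.nrm \<rho> \<tau> b) ?J"
      unfolding F.nrm_def
      using word_weight_pos[OF p] by (intro has_sum_product_nonneg F.coord_summable a b p) (auto simp: less_imp_le)
    also have "(\<lambda>(\<alpha>, \<beta>). (cmod (a \<alpha>) * word_weight \<rho> \<tau> \<alpha>) * (cmod (b \<beta>) * word_weight \<rho> \<tau> \<beta>)) =
        (\<lambda>u. cmod (?c u) * ?W u)"
      by (auto simp: fun_eq_iff norm_mult)
    finally have hs: "((\<lambda>u. cmod (?c u) * ?W u) has_sum F.nrm \<rho> \<tau> a * F.nrm \<rho> \<tau> b) ?J" .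
    have W: "cmod 1 * word_weight \<rho> \<tau> (?m u) \<le> 1 * ?W u" if "u \<in> ?J" for u
      using word_weight_append[of \<rho> \<tau>] paramsD[OF p] by (auto simp: case_prod_unfold)
    note B = wpush_bound[where J = ?J and m = ?m and J' = "words n" and W = ?W and W' = "word_weight \<rho> \<tau>"
        and e = "\<lambda>_. 1" and C = 1, OF has_sum_imp_summable[OF hs] _ W word_weight_pos[OF p]]
    have "(\<lambda>\<gamma>. cmod (free_mult a b \<gamma>) * word_weight \<rho> \<tau> \<gamma>) summable_on words n"
      using B(1) by (auto simp: words_append eq cong: summable_on_cong)
    moreover have "F.nrm \<rho> \<tau> (free_mult a b) \<le> F.nrm \<rho> \<tau> a * F.nrm \<rho> \<tau> b"
    proof -
      have "F.nrm \<rho> \<tau> (free_mult a b) =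
          (\<Sum>\<^sub>\<infinity>\<gamma>\<in>words n. cmod (wpush ?J ?m (\<lambda>_. 1) ?c \<gamma>) * word_weight \<rho> \<tau> \<gamma>)"
        unfolding F.nrm_def by (intro infsum_cong) (simp add: eq)
      also have "\<dots> \<le> 1 * (\<Sum>\<^sub>\<infinity>u\<in>?J. cmod (?c u) * ?W u)"
        by (rule B(2)) (auto simp: words_append)
      finally show ?thesis using infsumI[OF hs] by simp
    qed
    ultimately show ?thesis ..
  qed
  show "free_mult a b \<in> free_carrier n r" using off S by (intro free_carrierI) auto
  show "(\<rho>, \<tau>) \<in> params r \<Longrightarrow> F.nrm \<rho> \<tau> (free_mult a b) \<le> F.nrm \<rho> \<tau> a * F.nrm \<rho> \<tau> b"
    using S by blast
qed

end

section \<open>Vector-valued holomorphic functions and their Laurent coefficients\<close>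

lemma norm_powi_le:
  assumes "1 \<le> T" "inverse T \<le> cmod z" "cmod z \<le> T"
  shows "cmod (z powi q) \<le> T ^ nat \<bar>q\<bar>"
proof (cases "q \<ge> 0")
  case True
  then show ?thesis using assms by (simp add: power_int_def norm_power power_mono)
next
  case False
  have "0 < cmod z" using assms by (meson inverse_positive_iff_positive less_le_trans zero_less_one)
  then have "inverse (cmod z) \<le> T" using assms by (simp add: field_simps)
  then have "inverse (cmod z) ^ nat (- q) \<le> T ^ nat (- q)" by (intro power_mono) auto
  then show ?thesis using False by (simp add: power_int_def norm_power norm_inverse power_inverse)
qed

text \<open>The second derivative of \<open>z powi p\<close> brings the factor
  \<open>p * (p - 1)\<close>. Bounding it by an exponential in \<bar>p\<bar> lets it be absorbed
  into the weights by enlarging \<tau>.\<close>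

lemma abs_mult_pred_le: "\<bar>real_of_int p * (real_of_int p - 1)\<bar> \<le> 4 ^ nat \<bar>p\<bar>"
proof -
  define k where "k = nat \<bar>p\<bar>"
  have k: "real k < 2 ^ k" using less_exp[of k] by (metis of_nat_less_iff of_nat_numeral of_nat_power)
  have "real k + 1 \<le> 2 ^ k"
    using less_exp[of k] by (metis Suc_leI of_nat_Suc of_nat_le_iff of_nat_numeral of_nat_power add.commute)
  moreover have "\<bar>real_of_int p\<bar> = real k" by (simp add: k_def)
  ultimately have "\<bar>real_of_int p\<bar> * \<bar>real_of_int p - 1\<bar> \<le> 2 ^ k * 2 ^ k"
    using k by (intro mult_mono) auto
  also have "\<dots> = 4 ^ k" by (simp add: power_mult_distrib[symmetric])
  finally show ?thesis by (simp add: abs_mult k_def)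
qed

text \<open>Taylor's formula on the disc of radius \<open>cmod w / 2\<close> about \<open>w\<close>,
  which the assumptions on \<open>T\<close> put inside the annulus between \<open>inverse T\<close>
  and \<open>T\<close>. The error is quadratic in \<open>v - w\<close> and exponential in
  \<bar>p\<bar>, which is what termwise differentiation of a Laurent series requires.\<close>

lemma powi_second_order:
  assumes w: "w \<noteq> 0" and v: "v \<in> ball w (cmod w / 2)" and T: "1 \<le> T" "2 * cmod w \<le> T" "2 \<le> T * cmod w"
  shows "cmod (v powi p - w powi p - of_int p * w powi (p - 1) * (v - w)) \<le>
    T\<^sup>2 * (4 * T) ^ nat \<bar>p\<bar> * (cmod (v - w))\<^sup>2"
proof -
  define S where "S = ball w (cmod w / 2)"
  \<comment> \<open>The power with its first and second derivatives, in the form that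
    \<open>complex_Taylor\<close> expects.\<close>
  define f where "f i z = (if i = 0 then z powi p else if i = 1 then of_int p * z powi (p - 1)
    else of_int p * (of_int (p - 1) * z powi (p - 2)))" for i :: nat and z :: complex
  have z: "inverse T \<le> cmod z \<and> cmod z \<le> T \<and> z \<noteq> 0" if "z \<in> S" for z
  proof -
    have d: "cmod (w - z) < cmod w / 2" using that by (simp add: S_def dist_norm)
    have 1: "cmod w / 2 \<le> cmod z" using norm_triangle_ineq2[of w z] d by linarith
    have 2: "cmod z \<le> T" using norm_triangle_ineq3[of w z] d T by linarith
    have "inverse T \<le> cmod w / 2" using T by (simp add: field_simps)
    then show ?thesis using order_trans[OF _ 1] 1 2 w by auto
  qed
  have "cmod (f 0 v - (\<Sum>i\<le>1. f i w * (v - w) ^ i / fact i)) \<le>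
      T\<^sup>2 * (4 * T) ^ nat \<bar>p\<bar> * cmod (v - w) ^ Suc 1 / fact 1"
  proof (rule complex_Taylor[where S = S])
    show "convex S" "v \<in> S" "w \<in> S" using v w by (auto simp: S_def)
    fix i :: nat and x assume "x \<in> S" "i \<le> 1"
    then have i: "i = 0 \<or> i = 1" and x: "x \<noteq> 0" using z by auto
    have "((\<lambda>z. z powi p) has_field_derivative of_int p * x powi (p - 1)) (at x within S)"
      using x by (auto intro!: derivative_eq_intros)
    moreover have "((\<lambda>z. z powi (p - 1)) has_field_derivative of_int (p - 1) * x powi (p - 1 - 1)) (at x within S)"
      using x by (auto intro!: derivative_eq_intros)
    then have "((\<lambda>z. of_int p * z powi (p - 1)) has_field_derivative
        of_int p * (of_int (p - 1) * x powi (p - 1 - 1))) (at x within S)"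
      by (rule DERIV_cmult)
    then have "((\<lambda>z. of_int p * z powi (p - 1)) has_field_derivative
        of_int p * (of_int (p - 1) * x powi (p - 2))) (at x within S)"
      by (simp only: diff_diff_eq one_add_one)
    ultimately show "(f i has_field_derivative f (Suc i) x) (at x within S)"
      using i unfolding f_def by auto
  next
    fix x assume x: "x \<in> S"
    have "cmod (f (Suc 1) x) = \<bar>real_of_int p * (real_of_int p - 1)\<bar> * cmod (x powi (p - 2))"
    proof -
      have "f (Suc 1) x = of_real (real_of_int p * (real_of_int p - 1)) * x powi (p - 2)"
        by (simp add: f_def)
      then show ?thesis by (simp only: norm_mult norm_of_real)
    qed
    also have "\<dots> \<le> 4 ^ nat \<bar>p\<bar> * T ^ (nat \<bar>p\<bar> + 2)"
    proof (rule mult_mono[OF abs_mult_pred_le])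
      have "cmod (x powi (p - 2)) \<le> T ^ nat \<bar>p - 2\<bar>" using z[OF x] T by (intro norm_powi_le) auto
      also have "\<dots> \<le> T ^ (nat \<bar>p\<bar> + 2)" using T by (intro power_increasing) auto
      finally show "cmod (x powi (p - 2)) \<le> T ^ (nat \<bar>p\<bar> + 2)" .
    qed auto
    also have "\<dots> = T\<^sup>2 * (4 * T) ^ nat \<bar>p\<bar>" by (simp add: power_add power_mult_distrib power2_eq_square)
    finally show "cmod (f (Suc 1) x) \<le> T\<^sup>2 * (4 * T) ^ nat \<bar>p\<bar>" .
  qed
  moreover have "f 0 v - (\<Sum>i\<le>1. f i w * (v - w) ^ i / fact i) =
      v powi p - w powi p - of_int p * w powi (p - 1) * (v - w)"
    by (simp add: f_def)
  ultimately show ?thesis by (simp add: power2_eq_square)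
qed

definition diff_quot :: "(complex \<Rightarrow> free_series) \<Rightarrow> complex \<Rightarrow> complex \<Rightarrow> free_series" where
  "diff_quot f w v = (\<lambda>\<alpha>. (f v \<alpha> - f w \<alpha>) / (v - w))"

context deformation
begin

section \<open>Holomorphic functions with values in the free algebra\<close>

lemma eventually_at_nonzero: "w \<noteq> 0 \<Longrightarrow> \<forall>\<^sub>F v in at w. v \<noteq> (0::complex)"
  by (rule eventually_neq_at_within)

lemma diff_quot_mem:
  assumes "f v \<in> free_carrier n r" "f w \<in> free_carrier n r"
  shows "diff_quot f w v \<in> free_carrier n r"
  using free_scale(1)[OF F.diff_mem[OF assms], of "inverse (v - w)"]
  by (simp add: diff_quot_def divide_inverse mult.commute)

text \<open>Convergence of the difference quotient in the topology is convergence in each seminorm,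
  but to one and the same limit; hence \<open>L\<close> is chosen before the parameters.\<close>

lemma hol_carrier_iff:
  "f \<in> hol_carrier n r \<longleftrightarrow> f 0 = 0 \<and> (\<forall>w. w \<noteq> 0 \<longrightarrow> f w \<in> free_carrier n r) \<and>
    (\<forall>w. w \<noteq> 0 \<longrightarrow> (\<exists>L\<in>free_carrier n r. \<forall>\<rho> \<tau>. (\<rho>, \<tau>) \<in> params r \<longrightarrow>
      ((\<lambda>v. F.nrm \<rho> \<tau> (diff_quot f w v - L)) \<longlongrightarrow> 0) (at w)))"
proof -
  have "limitin F.top (diff_quot f w) L (at w) \<longleftrightarrow> L \<in> free_carrier n r \<and>
      (\<forall>\<rho> \<tau>. (\<rho>, \<tau>) \<in> params r \<longrightarrow> ((\<lambda>v. F.nrm \<rho> \<tau> (diff_quot f w v - L)) \<longlongrightarrow> 0) (at w))"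
    if f: "\<And>w. w \<noteq> 0 \<Longrightarrow> f w \<in> free_carrier n r" and w: "w \<noteq> 0" for w L
  proof -
    have mem: "\<forall>\<^sub>F v in at w. diff_quot f w v \<in> free_carrier n r"
      using eventually_at_nonzero[OF w] by eventually_elim (intro diff_quot_mem f w)
    have "(\<forall>\<^sub>F v in at w. diff_quot f w v \<in> free_carrier n r \<and> F.nrm \<rho> \<tau> (diff_quot f w v - L) < \<epsilon>) \<longleftrightarrow>
        (\<forall>\<^sub>F v in at w. dist (F.nrm \<rho> \<tau> (diff_quot f w v - L)) 0 < \<epsilon>)"
      if p: "(\<rho>, \<tau>) \<in> params r" and L: "L \<in> free_carrier n r" for \<rho> \<tau> \<epsilon>
    proof (rule eventually_cong[OF mem])
      fix v assume "diff_quot f w v \<in> free_carrier n r"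
      then show "(diff_quot f w v \<in> free_carrier n r \<and> F.nrm \<rho> \<tau> (diff_quot f w v - L) < \<epsilon>) \<longleftrightarrow>
          dist (F.nrm \<rho> \<tau> (diff_quot f w v - L)) 0 < \<epsilon>"
        using F.N_nonneg[OF p F.diff_mem[OF _ L]] by auto
    qed
    then show ?thesis unfolding F.limitin_top_iff tendsto_iff by blast
  qed
  then have "(\<exists>L. limitin F.top (diff_quot f w) L (at w)) \<longleftrightarrow> (\<exists>L\<in>free_carrier n r. \<forall>\<rho> \<tau>. (\<rho>, \<tau>) \<in> params r \<longrightarrow>
      ((\<lambda>v. F.nrm \<rho> \<tau> (diff_quot f w v - L)) \<longlongrightarrow> 0) (at w))"
    if "\<forall>w. w \<noteq> 0 \<longrightarrow> f w \<in> free_carrier n r" "w \<noteq> 0" for w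
    using that by (simp add: Bex_def)
  moreover have "f \<in> hol_carrier n r \<longleftrightarrow> f 0 = 0 \<and> (\<forall>w. w \<noteq> 0 \<longrightarrow> f w \<in> free_carrier n r) \<and>
      (\<forall>w. w \<noteq> 0 \<longrightarrow> (\<exists>L. limitin F.top (diff_quot f w) L (at w)))"
    by (simp add: hol_carrier_def top_free_algebra diff_quot_def[abs_def])
  ultimately show ?thesis by meson
qed

lemma hol_zero: "f \<in> hol_carrier n r \<Longrightarrow> f 0 = 0"
  by (simp add: hol_carrier_iff)

lemma hol_value: "f \<in> hol_carrier n r \<Longrightarrow> w \<noteq> 0 \<Longrightarrow> f w \<in> free_carrier n r"
  by (simp add: hol_carrier_iff)

lemma hol_derivative:
  assumes "f \<in> hol_carrier n r" "w \<noteq> 0"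
  obtains L where "L \<in> free_carrier n r"
    "\<And>\<rho> \<tau>. (\<rho>, \<tau>) \<in> params r \<Longrightarrow> ((\<lambda>v. F.nrm \<rho> \<tau> (diff_quot f w v - L)) \<longlongrightarrow> 0) (at w)"
  using assms unfolding hol_carrier_iff by blast

lemma hol_continuous:
  assumes f: "f \<in> hol_carrier n r" and w: "w \<noteq> 0" and p: "(\<rho>, \<tau>) \<in> params r"
  shows "((\<lambda>v. F.nrm \<rho> \<tau> (f v - f w)) \<longlongrightarrow> 0) (at w)"
proof -
  obtain L where L: "L \<in> free_carrier n r" "((\<lambda>v. F.nrm \<rho> \<tau> (diff_quot f w v - L)) \<longlongrightarrow> 0) (at w)"
    using hol_derivative[OF f w] p by metis
  have "((\<lambda>v. cmod (v - w) * (F.nrm \<rho> \<tau> (diff_quot f w v - L) + F.nrm \<rho> \<tau> L)) \<longlongrightarrow>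
      cmod (w - w) * (0 + F.nrm \<rho> \<tau> L)) (at w)"
    by (intro tendsto_intros L)
  then have lim: "((\<lambda>v. cmod (v - w) * (F.nrm \<rho> \<tau> (diff_quot f w v - L) + F.nrm \<rho> \<tau> L)) \<longlongrightarrow> 0) (at w)"
    by simp
  have "\<forall>\<^sub>F v in at w. norm (F.nrm \<rho> \<tau> (f v - f w)) \<le>
      cmod (v - w) * (F.nrm \<rho> \<tau> (diff_quot f w v - L) + F.nrm \<rho> \<tau> L)"
    using eventually_at_nonzero[OF w] eventually_neq_at_within[of w w UNIV]
  proof eventually_elim
    case (elim v)
    have m: "diff_quot f w v \<in> free_carrier n r" "f v - f w \<in> free_carrier n r"
      using elim w by (intro diff_quot_mem F.diff_mem hol_value f; simp)+
    have "f v - f w = (\<lambda>\<alpha>. (v - w) * diff_quot f w v \<alpha>)"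
      using elim by (simp add: diff_quot_def fun_eq_iff)
    then have "F.nrm \<rho> \<tau> (f v - f w) = cmod (v - w) * F.nrm \<rho> \<tau> (diff_quot f w v)"
      using free_scale(2)[OF m(1)] by simp
    also have "\<dots> \<le> cmod (v - w) * (F.nrm \<rho> \<tau> (diff_quot f w v - L) + F.nrm \<rho> \<tau> L)"
      by (intro mult_left_mono F.N_le_diff p m L) auto
    finally show ?case using F.N_nonneg[OF p m(2)] by simp
  qed
  then show ?thesis by (rule Lim_null_comparison[OF _ lim])
qed

lemma hol_norm_continuous:
  assumes f: "f \<in> hol_carrier n r" and p: "(\<rho>, \<tau>) \<in> params r"
  shows "continuous_on (- {0}) (\<lambda>w. F.nrm \<rho> \<tau> (f w))"
  unfolding continuous_on_def
proof
  fix w :: complex assume "w \<in> - {0}"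
  then have w: "w \<noteq> 0" by simp
  have "((\<lambda>v. F.nrm \<rho> \<tau> (f v) - F.nrm \<rho> \<tau> (f w)) \<longlongrightarrow> 0) (at w)"
  proof (rule Lim_null_comparison[OF _ hol_continuous[OF f w p]])
    show "\<forall>\<^sub>F v in at w. norm (F.nrm \<rho> \<tau> (f v) - F.nrm \<rho> \<tau> (f w)) \<le> F.nrm \<rho> \<tau> (f v - f w)"
      using eventually_at_nonzero[OF w]
    proof eventually_elim
      case (elim v)
      then show ?case
        using F.N_le_diff[OF p hol_value[OF f elim] hol_value[OF f w]]
          F.N_le_diff[OF p hol_value[OF f w] hol_value[OF f elim]]
          F.N_commute[OF hol_value[OF f w] hol_value[OF f elim]] by auto
    qed
  qed
  then have "((\<lambda>v. F.nrm \<rho> \<tau> (f v)) \<longlongrightarrow> F.nrm \<rho> \<tau> (f w)) (at w)" by (simp add: LIM_zero_iff)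
  then show "((\<lambda>v. F.nrm \<rho> \<tau> (f v)) \<longlongrightarrow> F.nrm \<rho> \<tau> (f w)) (at w within - {0})"
    by (rule tendsto_within_subset) auto
qed

text \<open>Each coefficient is, up to its weight, dominated by a seminorm, so differentiability
  passes to it. This reduces vector-valued functions to scalar complex analysis.\<close>

lemma hol_coordinate:
  assumes f: "f \<in> hol_carrier n r"
  shows "(\<lambda>w. f w \<alpha>) holomorphic_on - {0}"
proof (cases "\<alpha> \<in> words n")
  case True
  have "(\<lambda>w. f w \<alpha>) field_differentiable at w" if w: "w \<noteq> 0" for w
  proof -
    obtain L where L: "L \<in> free_carrier n r"
      "\<And>\<rho> \<tau>. (\<rho>, \<tau>) \<in> params r \<Longrightarrow> ((\<lambda>v. F.nrm \<rho> \<tau> (diff_quot f w v - L)) \<longlongrightarrow> 0) (at w)"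
      using hol_derivative[OF f w] by metis
    obtain \<rho> \<tau> where p: "(\<rho>, \<tau>) \<in> params r" using F.params_nonempty by blast
    have W: "0 < word_weight \<rho> \<tau> \<alpha>" by (rule word_weight_pos[OF p])
    have lim: "((\<lambda>v. F.nrm \<rho> \<tau> (diff_quot f w v - L) / word_weight \<rho> \<tau> \<alpha>) \<longlongrightarrow> 0) (at w)"
      using tendsto_divide_zero[OF L(2)[OF p]] by blast
    have "\<forall>\<^sub>F v in at w. norm ((f v \<alpha> - f w \<alpha>) / (v - w) - L \<alpha>) \<le>
        F.nrm \<rho> \<tau> (diff_quot f w v - L) / word_weight \<rho> \<tau> \<alpha>"
      using eventually_at_nonzero[OF w]
    proof eventually_elim
      case (elim v)
      have "diff_quot f w v - L \<in> free_carrier n r"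
        by (intro F.diff_mem diff_quot_mem hol_value f elim w L)
      from F.coord_le_nrm[OF this p True] show ?case
        using W by (simp add: diff_quot_def pos_le_divide_eq)
    qed
    then have "((\<lambda>v. (f v \<alpha> - f w \<alpha>) / (v - w) - L \<alpha>) \<longlongrightarrow> 0) (at w)"
      by (rule Lim_null_comparison[OF _ lim])
    then have "((\<lambda>w. f w \<alpha>) has_field_derivative L \<alpha>) (at w)"
      by (simp add: has_field_derivative_iff LIM_zero_iff)
    then show ?thesis by (auto simp: field_differentiable_def)
  qed
  then show ?thesis
    by (auto simp: holomorphic_on_def intro: field_differentiable_at_within)
next
  case False
  have "f w \<alpha> = 0" for w
    using hol_zero[OF f] free_carrier_off[OF hol_value[OF f] False] by (cases "w = 0") auto
  then show ?thesis by simp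
qed

lemma hol_add:
  assumes f: "f \<in> hol_carrier n r" and g: "g \<in> hol_carrier n r"
  shows "f + g \<in> hol_carrier n r"
  unfolding hol_carrier_iff
proof (intro conjI allI impI)
  show "(f + g) 0 = 0" using hol_zero[OF f] hol_zero[OF g] by (simp add: fun_eq_iff)
  show "(f + g) w \<in> free_carrier n r" if "w \<noteq> 0" for w
    using F.add_mem[OF hol_value[OF f that] hol_value[OF g that]] by simp
  fix w :: complex assume w: "w \<noteq> 0"
  obtain L where L: "L \<in> free_carrier n r"
    "\<And>\<rho> \<tau>. (\<rho>, \<tau>) \<in> params r \<Longrightarrow> ((\<lambda>v. F.nrm \<rho> \<tau> (diff_quot f w v - L)) \<longlongrightarrow> 0) (at w)"
    using hol_derivative[OF f w] by metis
  obtain M where M: "M \<in> free_carrier n r"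
    "\<And>\<rho> \<tau>. (\<rho>, \<tau>) \<in> params r \<Longrightarrow> ((\<lambda>v. F.nrm \<rho> \<tau> (diff_quot g w v - M)) \<longlongrightarrow> 0) (at w)"
    using hol_derivative[OF g w] by metis
  have "((\<lambda>v. F.nrm \<rho> \<tau> (diff_quot (f + g) w v - (L + M))) \<longlongrightarrow> 0) (at w)" if p: "(\<rho>, \<tau>) \<in> params r" for \<rho> \<tau>
  proof (rule Lim_null_comparison)
    show "((\<lambda>v. F.nrm \<rho> \<tau> (diff_quot f w v - L) + F.nrm \<rho> \<tau> (diff_quot g w v - M)) \<longlongrightarrow> 0) (at w)"
      using tendsto_add[OF L(2)[OF p] M(2)[OF p]] by simp
    show "\<forall>\<^sub>F v in at w. norm (F.nrm \<rho> \<tau> (diff_quot (f + g) w v - (L + M))) \<le>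
        F.nrm \<rho> \<tau> (diff_quot f w v - L) + F.nrm \<rho> \<tau> (diff_quot g w v - M)"
      using eventually_at_nonzero[OF w]
    proof eventually_elim
      case (elim v)
      have m: "diff_quot f w v - L \<in> free_carrier n r" "diff_quot g w v - M \<in> free_carrier n r"
        by (intro F.diff_mem diff_quot_mem hol_value f g elim w L M)+
      have eq: "diff_quot (f + g) w v - (L + M) = (diff_quot f w v - L) + (diff_quot g w v - M)"
        by (simp add: diff_quot_def fun_eq_iff add_divide_distrib diff_divide_distrib)
      show ?case unfolding eq using F.N_add[OF p m] F.N_nonneg[OF p F.add_mem[OF m]] by simp
    qed
  qed
  then show "\<exists>L\<in>free_carrier n r. \<forall>\<rho> \<tau>. (\<rho>, \<tau>) \<in> params r \<longrightarrow>
      ((\<lambda>v. F.nrm \<rho> \<tau> (diff_quot (f + g) w v - L)) \<longlongrightarrow> 0) (at w)"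
    using F.add_mem[OF L(1) M(1)] by blast
qed

lemma hol_mult:
  assumes f: "f \<in> hol_carrier n r" and g: "g \<in> hol_carrier n r"
  shows "(\<lambda>w. free_mult (f w) (g w)) \<in> hol_carrier n r"
  unfolding hol_carrier_iff
proof (intro conjI allI impI)
  show "free_mult (f 0) (g 0) = 0" by (simp add: hol_zero f free_mult_def fun_eq_iff)
  show "free_mult (f w) (g w) \<in> free_carrier n r" if "w \<noteq> 0" for w
    by (intro free_mult_mem hol_value f g that)
  fix w :: complex assume w: "w \<noteq> 0"
  let ?h = "\<lambda>w. free_mult (f w) (g w)"
  obtain L where L: "L \<in> free_carrier n r"
    "\<And>\<rho> \<tau>. (\<rho>, \<tau>) \<in> params r \<Longrightarrow> ((\<lambda>v. F.nrm \<rho> \<tau> (diff_quot f w v - L)) \<longlongrightarrow> 0) (at w)"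
    using hol_derivative[OF f w] by metis
  obtain M where M: "M \<in> free_carrier n r"
    "\<And>\<rho> \<tau>. (\<rho>, \<tau>) \<in> params r \<Longrightarrow> ((\<lambda>v. F.nrm \<rho> \<tau> (diff_quot g w v - M)) \<longlongrightarrow> 0) (at w)"
    using hol_derivative[OF g w] by metis
  define K where "K = free_mult L (g w) + free_mult (f w) M"
  have K: "K \<in> free_carrier n r"
    unfolding K_def by (intro F.add_mem free_mult_mem hol_value f g w L M)
  have "((\<lambda>v. F.nrm \<rho> \<tau> (diff_quot ?h w v - K)) \<longlongrightarrow> 0) (at w)" if p: "(\<rho>, \<tau>) \<in> params r" for \<rho> \<tau>
  proof -
    let ?N = "F.nrm \<rho> \<tau>"
    let ?B = "\<lambda>v. ?N (diff_quot f w v - L) * (?N (g v - g w) + ?N (g w)) + ?N L * ?N (g v - g w) +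
      ?N (f w) * ?N (diff_quot g w v - M)"
    have "(?B \<longlongrightarrow> 0 * (0 + ?N (g w)) + ?N L * 0 + ?N (f w) * 0) (at w)"
      by (intro tendsto_intros L M hol_continuous g w p)
    then have lim: "(?B \<longlongrightarrow> 0) (at w)" by simp
    have "\<forall>\<^sub>F v in at w. norm (?N (diff_quot ?h w v - K)) \<le> ?B v"
      using eventually_at_nonzero[OF w]
    proof eventually_elim
      case (elim v)
      have fm: "diff_quot f w v - L \<in> free_carrier n r" "diff_quot g w v - M \<in> free_carrier n r"
        "g v - g w \<in> free_carrier n r" "g v \<in> free_carrier n r" "g w \<in> free_carrier n r" "f w \<in> free_carrier n r"
        by (intro F.diff_mem diff_quot_mem hol_value f g elim w L M)+
      let ?P = "free_mult (diff_quot f w v - L) (g v)" and ?Q = "free_mult L (g v - g w)"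
        and ?R = "free_mult (f w) (diff_quot g w v - M)"
      have scale: "diff_quot k w v = (\<lambda>\<alpha>. inverse (v - w) * (k v - k w) \<alpha>)" for k
        by (simp add: diff_quot_def divide_inverse mult.commute)
      \<comment> \<open>The discrete Leibniz rule. It contains \<open>g v\<close>, whereas the
        candidate derivative \<open>K\<close> contains \<open>g w\<close>; the term
        \<open>?Q\<close> corrects this.\<close>
      have "diff_quot ?h w v = free_mult (diff_quot f w v) (g v) + free_mult (f w) (diff_quot g w v)"
        unfolding scale free_mult_scale free_mult_diff by (simp add: fun_eq_iff algebra_simps)
      then have eq: "diff_quot ?h w v - K = ?P + ?Q + ?R"
        by (simp add: K_def free_mult_diff)
      have PQR: "?P \<in> free_carrier n r" "?Q \<in> free_carrier n r" "?R \<in> free_carrier n r"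
        by (intro free_mult_mem fm L)+
      have "?N (diff_quot ?h w v - K) \<le> ?N ?P + ?N ?Q + ?N ?R"
        unfolding eq using F.N_add[OF p PQR(1,2)] F.N_add[OF p F.add_mem[OF PQR(1,2)] PQR(3)] by linarith
      moreover have "?N ?P \<le> ?N (diff_quot f w v - L) * ?N (g v)" by (intro free_mult_mem fm p)
      moreover have "?N (diff_quot f w v - L) * ?N (g v) \<le>
          ?N (diff_quot f w v - L) * (?N (g v - g w) + ?N (g w))"
        by (intro mult_left_mono F.N_le_diff F.N_nonneg p fm)
      moreover have "?N ?Q \<le> ?N L * ?N (g v - g w)" by (intro free_mult_mem fm p L)
      moreover have "?N ?R \<le> ?N (f w) * ?N (diff_quot g w v - M)" by (intro free_mult_mem fm p)
      ultimately have "?N (diff_quot ?h w v - K) \<le> ?B v" by linarith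
      moreover have "0 \<le> ?N (diff_quot ?h w v - K)"
        unfolding eq by (intro F.N_nonneg p F.add_mem PQR)
      ultimately show ?case by simp
    qed
    then show ?thesis by (rule Lim_null_comparison[OF _ lim])
  qed
  then show "\<exists>L\<in>free_carrier n r. \<forall>\<rho> \<tau>. (\<rho>, \<tau>) \<in> params r \<longrightarrow>
      ((\<lambda>v. F.nrm \<rho> \<tau> (diff_quot ?h w v - L)) \<longlongrightarrow> 0) (at w)"
    using K by blast
qed

end

text \<open>One parameter \<tau> governs both the blocks and the exponent of \<open>z\<close>. Since
  \<tau> may be arbitrarily large, two independent parameters would define the same
  topology.\<close>

definition hol_weight :: "real \<Rightarrow> real \<Rightarrow> nat list \<times> int \<Rightarrow> real" where
  "hol_weight \<rho> \<tau> = (\<lambda>(\<alpha>, p). word_weight \<rho> \<tau> \<alpha> * \<tau> ^ nat \<bar>p\<bar>)"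

definition coef :: "(complex \<Rightarrow> free_series) \<Rightarrow> nat list \<times> int \<Rightarrow> complex" where
  "coef f = (\<lambda>(\<alpha>, p). laurent_coeff (\<lambda>w. f w \<alpha>) p)"

context deformation
begin

section \<open>Summation of Laurent arrays\<close>

abbreviation (input) "IJ \<equiv> words n \<times> (UNIV :: int set)"

definition laurent_arrays :: "(nat list \<times> int \<Rightarrow> complex) set" where
  "laurent_arrays = {c. (\<forall>u. u \<notin> words n \<times> UNIV \<longrightarrow> c u = 0) \<and>
     (\<forall>\<rho> \<tau>. (\<rho>, \<tau>) \<in> params r \<longrightarrow> (\<lambda>u. cmod (c u) * hol_weight \<rho> \<tau> u) summable_on IJ)}"

text \<open>An arbitrary sequence \<open>e\<close> stands in place of the powers of a point, so that
  the value, the termwise derivative and the error of the difference quotient are evaluations of the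
  same array.\<close>

definition laurent_eval :: "(int \<Rightarrow> complex) \<Rightarrow> (nat list \<times> int \<Rightarrow> complex) \<Rightarrow> free_series" where
  "laurent_eval e c = wpush IJ fst (\<lambda>u. e (snd u)) c"

definition laurent_sum :: "(nat list \<times> int \<Rightarrow> complex) \<Rightarrow> complex \<Rightarrow> free_series" where
  "laurent_sum c = (\<lambda>w. if w = 0 then 0 else laurent_eval (\<lambda>p. w powi p) c)"

lemma hol_weight_pos: "(\<rho>, \<tau>) \<in> params r \<Longrightarrow> 0 < hol_weight \<rho> \<tau> u"
  using word_weight_pos paramsD by (fastforce simp: hol_weight_def case_prod_unfold)

lemma hol_weight_mono:
  "(\<rho>, \<tau>) \<in> params r \<Longrightarrow> (\<rho>', \<tau>') \<in> params r \<Longrightarrow> \<rho> \<le> \<rho>' \<Longrightarrow> \<tau> \<le> \<tau>' \<Longrightarrow> fst u \<in> words n \<Longrightarrow>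
    hol_weight \<rho> \<tau> u \<le> hol_weight \<rho>' \<tau>' u"
  using F.W_mono[of \<rho> \<tau> \<rho>' \<tau>' "fst u"] paramsD[of \<rho> \<tau>] word_weight_pos[of \<rho>' \<tau>' "fst u"]
  by (auto simp: hol_weight_def case_prod_unfold intro!: mult_mono power_mono)

lemma laurent_eval_eq: "\<alpha> \<in> words n \<Longrightarrow> laurent_eval e c \<alpha> = (\<Sum>\<^sub>\<infinity>p. c (\<alpha>, p) * e p)"
proof -
  assume "\<alpha> \<in> words n"
  then have bij: "bij_betw (\<lambda>p. (\<alpha>, p)) UNIV {u \<in> IJ. fst u = \<alpha>}"
    by (intro bij_betwI[where g = snd]) auto
  show ?thesis unfolding laurent_eval_def wpush_def by (subst infsum_reindex_bij_betw[OF bij, symmetric]) simp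
qed

lemma laurent_eval_weight:
  assumes e: "\<And>p. cmod (e p) \<le> C * T ^ nat \<bar>p\<bar>" and p: "(\<rho>, \<tau>) \<in> params r" and T: "0 \<le> T" "T \<le> \<tau>'" "\<tau> \<le> \<tau>'"
    and C: "0 \<le> C" and u: "u \<in> IJ"
  shows "cmod (e (snd u)) * word_weight \<rho> \<tau> (fst u) \<le> C * hol_weight \<rho> \<tau>' u"
proof -
  have p': "(\<rho>, \<tau>') \<in> params r" using params_scale[OF p T(3)] .
  have "cmod (e (snd u)) \<le> C * \<tau>' ^ nat \<bar>snd u\<bar>"
    using e[of "snd u"] T C by (meson mult_left_mono order_trans power_mono)
  moreover have "word_weight \<rho> \<tau> (fst u) \<le> word_weight \<rho> \<tau>' (fst u)"
    using T u by (intro F.W_mono p p') auto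
  ultimately have "cmod (e (snd u)) * word_weight \<rho> \<tau> (fst u) \<le>
      (C * \<tau>' ^ nat \<bar>snd u\<bar>) * word_weight \<rho> \<tau>' (fst u)"
    using word_weight_pos[OF p] T C by (intro mult_mono) (auto simp: less_imp_le)
  then show ?thesis by (simp add: hol_weight_def case_prod_unfold mult_ac)
qed

text \<open>Any growth rate \<open>T ^ nat \<bar>p\<bar>\<close> is tolerated: the weight absorbs it
  once \<tau>' is at least \<open>T\<close>. The factor \<open>C\<close> is kept apart since it will
  tend to 0 in the proof of differentiability.\<close>

lemma laurent_eval_bound:
  assumes c: "c \<in> laurent_arrays" and e: "\<And>p. cmod (e p) \<le> C * T ^ nat \<bar>p\<bar>" and T: "0 \<le> T" and C: "0 \<le> C"
  shows "laurent_eval e c \<in> free_carrier n r"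
    and "(\<rho>, \<tau>) \<in> params r \<Longrightarrow> T \<le> \<tau>' \<Longrightarrow> \<tau> \<le> \<tau>' \<Longrightarrow>
      F.nrm \<rho> \<tau> (laurent_eval e c) \<le> C * (\<Sum>\<^sub>\<infinity>u\<in>IJ. cmod (c u) * hol_weight \<rho> \<tau>' u)"
    and "(\<lambda>u. norm (c u * e (snd u))) summable_on {u \<in> IJ. fst u = \<alpha>}"
proof -
  have S: "(\<lambda>u. cmod (c u) * hol_weight \<rho> \<tau> u) summable_on IJ" if "(\<rho>, \<tau>) \<in> params r" for \<rho> \<tau>
    using c that by (simp add: laurent_arrays_def)
  note B = wpush_bound[where J = IJ and m = fst and J' = "words n" and e = "\<lambda>u. e (snd u)" and a = c and C = C]
  show bd: "F.nrm \<rho> \<tau> (laurent_eval e c) \<le> C * (\<Sum>\<^sub>\<infinity>u\<in>IJ. cmod (c u) * hol_weight \<rho> \<tau>' u)"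
    if p: "(\<rho>, \<tau>) \<in> params r" and t: "T \<le> \<tau>'" "\<tau> \<le> \<tau>'" for \<rho> \<tau> \<tau>'
    unfolding F.nrm_def laurent_eval_def
    by (rule B(2)[OF S[OF params_scale[OF p t(2)]] _ laurent_eval_weight[OF e p T t C]])
       (auto simp: word_weight_pos[OF p])
  show "laurent_eval e c \<in> free_carrier n r"
  proof (rule free_carrierI)
    fix \<alpha> assume "\<alpha> \<notin> words n"
    then have "{u \<in> IJ. fst u = \<alpha>} = {}" by auto
    then show "laurent_eval e c \<alpha> = 0" unfolding laurent_eval_def wpush_def by (simp only: infsum_empty)
  next
    fix \<rho> \<tau> assume p: "(\<rho>, \<tau>) \<in> params r"
    have t: "\<tau> \<le> max \<tau> T" "T \<le> max \<tau> T" by auto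
    show "(\<lambda>\<alpha>. cmod (laurent_eval e c \<alpha>) * word_weight \<rho> \<tau> \<alpha>) summable_on words n"
      unfolding laurent_eval_def
      by (rule B(1)[OF S[OF params_scale[OF p t(1)]] _ laurent_eval_weight[OF e p T t(2,1) C]])
         (auto simp: word_weight_pos[OF p])
  qed
  obtain \<rho> \<tau> where p: "(\<rho>, \<tau>) \<in> params r" using F.params_nonempty by blast
  have t: "\<tau> \<le> max \<tau> T" "T \<le> max \<tau> T" by auto
  show "(\<lambda>u. norm (c u * e (snd u))) summable_on {u \<in> IJ. fst u = \<alpha>}"
    by (rule B(3)[OF S[OF params_scale[OF p t(1)]] _ laurent_eval_weight[OF e p T t(2,1) C]])
       (auto simp: word_weight_pos[OF p])
qed

lemma powi_bound:
  assumes "w \<noteq> 0"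
  obtains T where "1 \<le> T" "inverse T \<le> cmod w" "cmod w \<le> T"
proof (rule that[of "max 1 (max (cmod w) (inverse (cmod w)))"])
  show "inverse (max 1 (max (cmod w) (inverse (cmod w)))) \<le> cmod w"
  proof -
    have "inverse (max 1 (max (cmod w) (inverse (cmod w)))) \<le> inverse (inverse (cmod w))"
      using assms by (intro le_imp_inverse_le) auto
    then show ?thesis by simp
  qed
qed auto

lemma laurent_sum_bound:
  assumes c: "c \<in> laurent_arrays" and w: "w \<noteq> 0" "inverse \<tau>' \<le> cmod w" "cmod w \<le> \<tau>'"
    and p: "(\<rho>, \<tau>) \<in> params r" "\<tau> \<le> \<tau>'"
  shows "F.nrm \<rho> \<tau> (laurent_sum c w) \<le> (\<Sum>\<^sub>\<infinity>u\<in>IJ. cmod (c u) * hol_weight \<rho> \<tau>' u)"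
proof -
  have t: "1 \<le> \<tau>'" using paramsD[OF p(1)] p(2) by auto
  have "F.nrm \<rho> \<tau> (laurent_eval (\<lambda>p. w powi p) c) \<le> 1 * (\<Sum>\<^sub>\<infinity>u\<in>IJ. cmod (c u) * hol_weight \<rho> \<tau>' u)"
    by (rule laurent_eval_bound(2)[OF c _ _ _ p(1), where T = \<tau>']) (use t p norm_powi_le[OF t w(2,3)] in auto)
  then show ?thesis using w by (simp add: laurent_sum_def)
qed

lemma laurent_sum_value_mem:
  assumes c: "c \<in> laurent_arrays" and w: "w \<noteq> 0"
  shows "laurent_sum c w \<in> free_carrier n r"
proof -
  obtain T where T: "1 \<le> T" "inverse T \<le> cmod w" "cmod w \<le> T" using powi_bound[OF w] .
  have "laurent_eval (\<lambda>p. w powi p) c \<in> free_carrier n r"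
    by (rule laurent_eval_bound(1)[OF c, where T = T and C = 1]) (use T norm_powi_le[OF T] in auto)
  then show ?thesis using w by (simp add: laurent_sum_def)
qed

lemma powi_deriv_bound:
  assumes "1 \<le> T" "inverse T \<le> cmod w" "cmod w \<le> T"
  shows "cmod (of_int p * w powi (p - 1)) \<le> T * (2 * T) ^ nat \<bar>p\<bar>"
proof -
  define k where "k = nat \<bar>p\<bar>"
  have "real k \<le> 2 ^ k" using less_exp[of k] by (metis less_imp_le of_nat_le_iff of_nat_numeral of_nat_power)
  moreover have "cmod (w powi (p - 1)) \<le> T ^ Suc k"
  proof -
    have "cmod (w powi (p - 1)) \<le> T ^ nat \<bar>p - 1\<bar>" by (rule norm_powi_le[OF assms])
    also have "\<dots> \<le> T ^ Suc k" using assms by (intro power_increasing) (auto simp: k_def)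
    finally show ?thesis .
  qed
  moreover have "cmod (of_int p) = real k" by (simp add: k_def)
  ultimately have "cmod (of_int p) * cmod (w powi (p - 1)) \<le> 2 ^ k * T ^ Suc k"
    by (intro mult_mono) auto
  then show ?thesis by (simp add: norm_mult k_def power_mult_distrib mult_ac)
qed

text \<open>The derivative is the termwise one. The difference quotient minus this candidate is the
  evaluation of \<open>c\<close> at the second-order errors of the powers, so each seminorm of it is
  at most a constant times \<open>cmod (v - w)\<close>.\<close>

lemma laurent_sum_mem:
  assumes c: "c \<in> laurent_arrays"
  shows "laurent_sum c \<in> hol_carrier n r"
  unfolding hol_carrier_iff
proof (intro conjI allI impI)
  show "laurent_sum c 0 = 0" by (simp add: laurent_sum_def)
  show "laurent_sum c w \<in> free_carrier n r" if "w \<noteq> 0" for w by (rule laurent_sum_value_mem[OF c that])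
  fix w :: complex assume w: "w \<noteq> 0"
  define L where "L = laurent_eval (\<lambda>p. of_int p * w powi (p - 1)) c"
  obtain T where T0: "1 \<le> T" "inverse T \<le> cmod w" "cmod w \<le> T" using powi_bound[OF w] .
  have dT: "cmod (of_int p * w powi (p - 1)) \<le> T * (2 * T) ^ nat \<bar>p\<bar>" for p by (rule powi_deriv_bound[OF T0])
  have L: "L \<in> free_carrier n r"
    unfolding L_def by (rule laurent_eval_bound(1)[OF c dT]) (use T0 in auto)
  have Ls: "(\<lambda>u. norm (c u * (of_int (snd u) * w powi (snd u - 1)))) summable_on {u \<in> IJ. fst u = \<alpha>}" for \<alpha>
    using laurent_eval_bound(3)[OF c dT] T0 by auto
  have ps: "(\<lambda>u. norm (c u * v powi (snd u))) summable_on {u \<in> IJ. fst u = \<alpha>}" if v: "v \<noteq> 0" for v \<alpha>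
  proof -
    obtain T where T: "1 \<le> T" "inverse T \<le> cmod v" "cmod v \<le> T" using powi_bound[OF v] .
    show ?thesis
      by (rule laurent_eval_bound(3)[OF c, where T = T and C = 1 and e = "\<lambda>p. v powi p"]) (use T norm_powi_le[OF T] in auto)
  qed
  \<comment> \<open>Chosen to satisfy the three conditions that \<open>powi_second_order\<close>
    puts on its \<open>T\<close>.\<close>
  define S where "S = max 1 (max (2 * cmod w) (2 / cmod w))"
  have S: "1 \<le> S" "2 * cmod w \<le> S" "2 \<le> S * cmod w"
  proof -
    show "1 \<le> S" "2 * cmod w \<le> S" by (auto simp: S_def)
    have "2 / cmod w \<le> S" by (auto simp: S_def)
    then show "2 \<le> S * cmod w" using w by (simp add: pos_divide_le_eq)
  qed
  have eq: "diff_quot (laurent_sum c) w v - L =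
      laurent_eval (\<lambda>p. inverse (v - w) * (v powi p - w powi p) - of_int p * w powi (p - 1)) c" if v: "v \<noteq> 0" for v
  proof -
    have 1: "laurent_sum c v - laurent_sum c w = wpush IJ fst (\<lambda>u. v powi snd u - w powi snd u) c"
      using v w unfolding laurent_sum_def laurent_eval_def
      by (simp add: wpush_diff abs_summable_summable[OF ps])
    have 2: "diff_quot (laurent_sum c) w v = wpush IJ fst (\<lambda>u. inverse (v - w) * (v powi snd u - w powi snd u)) c"
      using fun_cong[OF 1] by (auto simp: diff_quot_def wpush_scale divide_inverse mult.commute)
    have 3: "(\<lambda>u. c u * (inverse (v - w) * (v powi snd u - w powi snd u))) summable_on {u \<in> IJ. fst u = \<alpha>}" for \<alpha>
    proof -
      have "(\<lambda>u. inverse (v - w) * (c u * v powi snd u - c u * w powi snd u)) summable_on {u \<in> IJ. fst u = \<alpha>}"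
        by (intro summable_on_cmult_right has_sum_imp_summable[OF has_sum_subtract[OF
            has_sum_infsum[OF abs_summable_summable[OF ps[OF v]]] has_sum_infsum[OF abs_summable_summable[OF ps[OF w]]]]])
      then show ?thesis by (simp add: algebra_simps)
    qed
    show ?thesis
      unfolding 2 L_def laurent_eval_def by (rule wpush_diff[OF 3 abs_summable_summable[OF Ls]])
  qed
  have "((\<lambda>v. F.nrm \<rho> \<tau> (diff_quot (laurent_sum c) w v - L)) \<longlongrightarrow> 0) (at w)" if p: "(\<rho>, \<tau>) \<in> params r" for \<rho> \<tau>
  proof -
    define K where "K = (\<Sum>\<^sub>\<infinity>u\<in>IJ. cmod (c u) * hol_weight \<rho> (max \<tau> (4 * S)) u)"
    have "((\<lambda>v. (S\<^sup>2 * cmod (v - w)) * K) \<longlongrightarrow> (S\<^sup>2 * cmod (w - w)) * K) (at w)" by (intro tendsto_intros)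
    then have lim: "((\<lambda>v. (S\<^sup>2 * cmod (v - w)) * K) \<longlongrightarrow> 0) (at w)" by simp
    have ball: "\<forall>\<^sub>F v in at w. v \<in> ball w (cmod w / 2)"
      using w by (intro eventually_at_in_open') auto
    have "\<forall>\<^sub>F v in at w. norm (F.nrm \<rho> \<tau> (diff_quot (laurent_sum c) w v - L)) \<le> (S\<^sup>2 * cmod (v - w)) * K"
      using eventually_at_nonzero[OF w] eventually_neq_at_within[of w w UNIV] ball
    proof eventually_elim
      case (elim v)
      let ?e = "\<lambda>p. inverse (v - w) * (v powi p - w powi p) - of_int p * w powi (p - 1)"
      have e: "cmod (?e p) \<le> (S\<^sup>2 * cmod (v - w)) * (4 * S) ^ nat \<bar>p\<bar>" for p
      proof -
        have "?e p = (v powi p - w powi p - of_int p * w powi (p - 1) * (v - w)) / (v - w)"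
          using elim by (simp add: field_simps)
        then have "cmod (?e p) = cmod (v powi p - w powi p - of_int p * w powi (p - 1) * (v - w)) / cmod (v - w)"
          by (simp only: norm_divide)
        also have "\<dots> \<le> (S\<^sup>2 * (4 * S) ^ nat \<bar>p\<bar> * (cmod (v - w))\<^sup>2) / cmod (v - w)"
          by (intro divide_right_mono powi_second_order w S elim) auto
        also have "\<dots> = (S\<^sup>2 * cmod (v - w)) * (4 * S) ^ nat \<bar>p\<bar>"
          using elim by (simp add: power2_eq_square)
        finally show ?thesis .
      qed
      have "F.nrm \<rho> \<tau> (diff_quot (laurent_sum c) w v - L) \<le> (S\<^sup>2 * cmod (v - w)) * K"
        unfolding eq[OF elim(1)] K_def by (rule laurent_eval_bound(2)[OF c e _ _ p]) (use S in auto)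
      moreover have "0 \<le> F.nrm \<rho> \<tau> (diff_quot (laurent_sum c) w v - L)"
        by (intro F.N_nonneg p F.diff_mem L diff_quot_mem laurent_sum_value_mem c w elim)
      ultimately show ?case by simp
    qed
    then show ?thesis by (rule Lim_null_comparison[OF _ lim])
  qed
  then show "\<exists>L\<in>free_carrier n r. \<forall>\<rho> \<tau>. (\<rho>, \<tau>) \<in> params r \<longrightarrow>
      ((\<lambda>v. F.nrm \<rho> \<tau> (diff_quot (laurent_sum c) w v - L)) \<longlongrightarrow> 0) (at w)"
    using L by blast
qed

section \<open>Laurent norms and suprema over circles\<close>

lemma hol_off: "f \<in> hol_carrier n r \<Longrightarrow> \<alpha> \<notin> words n \<Longrightarrow> f w \<alpha> = 0"
  using hol_zero[of f] free_carrier_off[OF hol_value] by (cases "w = 0") auto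

lemma coef_off: "f \<in> hol_carrier n r \<Longrightarrow> fst u \<notin> words n \<Longrightarrow> coef f u = 0"
  by (simp add: coef_def case_prod_unfold hol_off)

definition geom_const :: real where
  "geom_const = (\<Sum>\<^sub>\<infinity>p::int. (1/2) ^ nat \<bar>p\<bar>)"

text \<open>Estimating the coefficients one by one would lose the sum over words. Instead the Cauchy
  estimate is applied to a single scalar function, the composition of \<open>f\<close> with a
  functional of norm at most 1 that norms a finite part of the column of coefficients.\<close>

lemma coef_column_bound:
  assumes f: "f \<in> hol_carrier n r" and p: "(\<rho>, \<tau>) \<in> params r" and A: "finite A" "A \<subseteq> words n"
    and s: "0 < s" and M: "\<And>w. cmod w = s \<Longrightarrow> F.nrm \<rho> \<tau> (f w) \<le> M"
  shows "(\<Sum>\<alpha>\<in>A. cmod (coef f (\<alpha>, q)) * word_weight \<rho> \<tau> \<alpha>) * s powi q \<le> M"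
proof -
  \<comment> \<open>The conjugate phase of each coefficient times its weight: paired with the
    coefficients, these numbers add up the weighted moduli.\<close>
  define u where "u \<alpha> = cnj (sgn (coef f (\<alpha>, q))) * word_weight \<rho> \<tau> \<alpha>" for \<alpha>
  define g where "g w = (\<Sum>\<alpha>\<in>A. u \<alpha> * f w \<alpha>)" for w
  have hol: "(\<lambda>w. u \<alpha> * f w \<alpha>) holomorphic_on - {0}" for \<alpha> by (intro holomorphic_intros hol_coordinate f)
  have g: "g holomorphic_on - {0}" unfolding g_def by (intro holomorphic_on_sum hol)
  have sg: "cnj (sgn c) * c = of_real (cmod c)" for c :: complex
  proof (cases "c = 0")
    case False
    have "cnj c * c = of_real (cmod c) * of_real (cmod c)"
      using complex_norm_square[of c] by (simp add: power2_eq_square mult.commute)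
    then have "cnj c * c / of_real (cmod c) = of_real (cmod c)" using False by simp
    then show ?thesis by (simp add: sgn_eq)
  qed simp
  have "laurent_coeff g q = (\<Sum>\<alpha>\<in>A. u \<alpha> * coef f (\<alpha>, q))"
    unfolding g_def by (subst laurent_coeff_sum[OF hol]) (simp add: laurent_coeff_cmult hol_coordinate f coef_def)
  also have "\<dots> = of_real (\<Sum>\<alpha>\<in>A. cmod (coef f (\<alpha>, q)) * word_weight \<rho> \<tau> \<alpha>)"
    unfolding of_real_sum of_real_mult sg[symmetric] by (simp add: u_def mult_ac)
  finally have l: "cmod (laurent_coeff g q) = (\<Sum>\<alpha>\<in>A. cmod (coef f (\<alpha>, q)) * word_weight \<rho> \<tau> \<alpha>)"
    using word_weight_pos[OF p] by (simp add: sum_nonneg less_imp_le del: of_real_sum)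
  have "cmod (g w) \<le> M" if w: "cmod w = s" for w
  proof -
    have fw: "f w \<in> free_carrier n r" using w s by (intro hol_value f) auto
    have "cmod (g w) \<le> (\<Sum>\<alpha>\<in>A. cmod (u \<alpha> * f w \<alpha>))" unfolding g_def by (rule norm_sum)
    also have "\<dots> \<le> (\<Sum>\<alpha>\<in>A. cmod (f w \<alpha>) * word_weight \<rho> \<tau> \<alpha>)"
    proof (rule sum_mono)
      fix \<alpha>
      have "cmod (u \<alpha>) \<le> word_weight \<rho> \<tau> \<alpha>"
        using word_weight_pos[OF p, of \<alpha>] by (simp add: u_def norm_mult norm_sgn)
      then show "cmod (u \<alpha> * f w \<alpha>) \<le> cmod (f w \<alpha>) * word_weight \<rho> \<tau> \<alpha>"
        by (simp add: norm_mult mult.commute[of _ "word_weight \<rho> \<tau> \<alpha>"] mult_right_mono)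
    qed
    also have "\<dots> \<le> F.nrm \<rho> \<tau> (f w)"
      unfolding F.nrm_def using word_weight_pos[OF p]
      by (intro finite_sum_le_infsum F.coord_summable fw p A) (auto simp: less_imp_le)
    finally show ?thesis using M[OF w] by simp
  qed
  from laurent_coeff_bound[OF g s this, of q] show ?thesis by (simp add: l)
qed

text \<open>Column \<open>q\<close> is estimated on the circle of radius \<open>2 * \<tau>\<close>
  or of the inverse radius, according to the sign of \<open>q\<close>. The surplus factor 2 leaves
  \<open>(1/2) ^ nat \<bar>q\<bar>\<close>, whose sum over all \<open>q\<close> is
  \<open>geom_const\<close>.\<close>

lemma coef_bound:
  assumes f: "f \<in> hol_carrier n r" and p: "(\<rho>, \<tau>) \<in> params r"
    and M: "\<And>w. cmod w = 2 * \<tau> \<or> cmod w = 1 / (2 * \<tau>) \<Longrightarrow> F.nrm \<rho> \<tau> (f w) \<le> M"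
  shows "(\<lambda>u. cmod (coef f u) * hol_weight \<rho> \<tau> u) summable_on IJ"
    and "(\<Sum>\<^sub>\<infinity>u\<in>IJ. cmod (coef f u) * hol_weight \<rho> \<tau> u) \<le> M * geom_const"
proof -
  have t: "1 \<le> \<tau>" using paramsD[OF p] by simp
  have M0: "0 \<le> M"
  proof -
    have "f (of_real (2 * \<tau>)) \<in> free_carrier n r" using t by (intro hol_value f) auto
    from F.N_nonneg[OF p this] show ?thesis using M[of "of_real (2 * \<tau>)"] t by simp
  qed
  have col: "(\<Sum>\<alpha>\<in>A. cmod (coef f (\<alpha>, q)) * word_weight \<rho> \<tau> \<alpha>) * \<tau> ^ nat \<bar>q\<bar> \<le> M * (1/2) ^ nat \<bar>q\<bar>"
    if A: "finite A" "A \<subseteq> words n" for A q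
  proof -
    define s where "s = (if q \<ge> 0 then 2 * \<tau> else 1 / (2 * \<tau>))"
    have "(\<Sum>\<alpha>\<in>A. cmod (coef f (\<alpha>, q)) * word_weight \<rho> \<tau> \<alpha>) * s powi q \<le> M"
      by (rule coef_column_bound[OF f p A]) (use t M in \<open>auto simp: s_def split: if_splits\<close>)
    moreover have "s powi q = 2 ^ nat \<bar>q\<bar> * \<tau> ^ nat \<bar>q\<bar>"
      using t by (auto simp: s_def power_int_def power_mult_distrib power_divide inverse_eq_divide)
    ultimately have "((\<Sum>\<alpha>\<in>A. cmod (coef f (\<alpha>, q)) * word_weight \<rho> \<tau> \<alpha>) * \<tau> ^ nat \<bar>q\<bar>) * 2 ^ nat \<bar>q\<bar> \<le> M"
      by (simp add: mult_ac)
    then show ?thesis by (simp add: power_divide pos_le_divide_eq)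
  qed
  have bd: "(\<Sum>u\<in>X. cmod (coef f u) * hol_weight \<rho> \<tau> u) \<le> M * geom_const" if X: "finite X" "X \<subseteq> IJ" for X
  proof -
    have "(\<Sum>u\<in>X. cmod (coef f u) * hol_weight \<rho> \<tau> u) \<le>
        (\<Sum>u\<in>fst ` X \<times> snd ` X. cmod (coef f u) * hol_weight \<rho> \<tau> u)"
      using X hol_weight_pos[OF p] by (intro sum_mono2) (force simp: less_imp_le)+
    also have "\<dots> = (\<Sum>q\<in>snd ` X. \<Sum>\<alpha>\<in>fst ` X. cmod (coef f (\<alpha>, q)) * hol_weight \<rho> \<tau> (\<alpha>, q))"
      by (subst sum.swap) (simp add: sum.cartesian_product)
    also have "\<dots> = (\<Sum>q\<in>snd ` X. (\<Sum>\<alpha>\<in>fst ` X. cmod (coef f (\<alpha>, q)) * word_weight \<rho> \<tau> \<alpha>) * \<tau> ^ nat \<bar>q\<bar>)"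
      by (simp add: hol_weight_def sum_distrib_right mult.assoc)
    also have "\<dots> \<le> (\<Sum>q\<in>snd ` X. M * (1/2) ^ nat \<bar>q\<bar>)"
      using X by (intro sum_mono col) auto
    also have "\<dots> \<le> M * geom_const"
      unfolding sum_distrib_left[symmetric] geom_const_def
      using X M0 by (intro mult_left_mono finite_sum_le_infsum summable_half_power_int) auto
    finally show ?thesis .
  qed
  show s: "(\<lambda>u. cmod (coef f u) * hol_weight \<rho> \<tau> u) summable_on IJ"
    by (rule nonneg_bdd_above_summable_on)
       (use bd hol_weight_pos[OF p] in \<open>auto simp: less_imp_le intro!: bdd_aboveI2\<close>)
  show "(\<Sum>\<^sub>\<infinity>u\<in>IJ. cmod (coef f u) * hol_weight \<rho> \<tau> u) \<le> M * geom_const"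
    by (rule infsum_le_finite_sums[OF s bd])
qed

lemma hol_norm_bounded:
  assumes f: "f \<in> hol_carrier n r" and p: "(\<rho>, \<tau>) \<in> params r" and K: "compact K" "0 \<notin> K"
  obtains M where "\<And>w. w \<in> K \<Longrightarrow> F.nrm \<rho> \<tau> (f w) \<le> M"
proof -
  have "continuous_on K (\<lambda>w. F.nrm \<rho> \<tau> (f w))"
    by (rule continuous_on_subset[OF hol_norm_continuous[OF f p]]) (use K in auto)
  then have "bounded ((\<lambda>w. F.nrm \<rho> \<tau> (f w)) ` K)" using K by (intro compact_imp_bounded compact_continuous_image)
  then obtain M where M: "\<forall>x\<in>K. \<bar>F.nrm \<rho> \<tau> (f x)\<bar> \<le> M" by (auto simp: bounded_iff)
  show ?thesis by (rule that[of M]) (use M in force)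
qed

definition two_circles :: "real \<Rightarrow> complex set" where
  "two_circles \<tau> = sphere 0 (2 * \<tau>) \<union> sphere 0 (1 / (2 * \<tau>))"

lemma two_circles: "compact (two_circles \<tau>)" "1 \<le> \<tau> \<Longrightarrow> 0 \<notin> two_circles \<tau>"
  "w \<in> two_circles \<tau> \<longleftrightarrow> cmod w = 2 * \<tau> \<or> cmod w = 1 / (2 * \<tau>)"
  by (auto simp: two_circles_def)

lemma coef_mem:
  assumes f: "f \<in> hol_carrier n r"
  shows "coef f \<in> laurent_arrays"
  unfolding laurent_arrays_def mem_Collect_eq
proof (intro conjI allI impI)
  show "coef f u = 0" if "u \<notin> words n \<times> UNIV" for u
    using coef_off[OF f] that by (cases u) auto
  fix \<rho> \<tau> assume p: "(\<rho>, \<tau>) \<in> params r"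
  obtain M where "\<And>w. w \<in> two_circles \<tau> \<Longrightarrow> F.nrm \<rho> \<tau> (f w) \<le> M"
    using hol_norm_bounded[OF f p two_circles(1)] two_circles(2) paramsD[OF p] by metis
  then show "(\<lambda>u. cmod (coef f u) * hol_weight \<rho> \<tau> u) summable_on IJ"
    by (intro coef_bound(1)[OF f p]) (simp add: two_circles(3))
qed

lemma laurent_sum_coef:
  assumes f: "f \<in> hol_carrier n r"
  shows "laurent_sum (coef f) = f"
proof (intro ext)
  fix w \<alpha>
  show "laurent_sum (coef f) w \<alpha> = f w \<alpha>"
  proof (cases "w = 0 \<or> \<alpha> \<notin> words n")
    case True
    then show ?thesis
    proof
      assume "w = 0"
      then show ?thesis using hol_zero[OF f] by (simp add: laurent_sum_def)
    qed (simp add: hol_off f laurent_sum_mem coef_mem)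
  next
    case False
    then have "laurent_sum (coef f) w \<alpha> = (\<Sum>\<^sub>\<infinity>p. coef f (\<alpha>, p) * w powi p)" by (simp add: laurent_sum_def laurent_eval_eq)
    also have "\<dots> = f w \<alpha>"
      using laurent_expansion_punctured_plane[OF hol_coordinate[OF f, of \<alpha>]] False
      by (intro infsumI) (simp add: coef_def)
    finally show ?thesis .
  qed
qed

lemma coef_laurent_sum:
  assumes c: "c \<in> laurent_arrays"
  shows "coef (laurent_sum c) = c"
proof
  fix u :: "nat list \<times> int"
  obtain \<alpha> p where u: "u = (\<alpha>, p)" by fastforce
  note h = laurent_sum_mem[OF c]
  show "coef (laurent_sum c) u = c u"
  proof (cases "\<alpha> \<in> words n")
    case True
    have bij: "bij_betw (\<lambda>p. (\<alpha>, p)) UNIV {u \<in> IJ. fst u = \<alpha>}"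
      using True by (intro bij_betwI[where g = snd]) auto
    have s: "(\<lambda>p. norm (c (\<alpha>, p) * w powi p)) summable_on UNIV" if w: "cmod w = 1" for w
    proof -
      have "(\<lambda>u. norm (c u * (w powi (snd u)))) summable_on {u \<in> IJ. fst u = \<alpha>}"
        by (rule laurent_eval_bound(3)[OF c, where T = 1 and C = 1 and e = "\<lambda>p. w powi p"])
           (use w in \<open>auto simp: norm_power_int\<close>)
      then show ?thesis by (subst (asm) summable_on_reindex_bij_betw[OF bij, symmetric]) simp
    qed
    have "laurent_coeff (\<lambda>w. laurent_sum c w \<alpha>) p = c (\<alpha>, p)"
    proof (rule laurent_coeff_unique[OF hol_coordinate[OF h]])
      show "(\<lambda>p. norm (c (\<alpha>, p))) summable_on UNIV" using s[of 1] by simp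
      fix w :: complex assume w: "cmod w = 1"
      then have "laurent_sum c w \<alpha> = (\<Sum>\<^sub>\<infinity>p. c (\<alpha>, p) * w powi p)" using True by (auto simp: laurent_sum_def laurent_eval_eq)
      then show "((\<lambda>p. c (\<alpha>, p) * w powi p) has_sum laurent_sum c w \<alpha>) UNIV"
        using has_sum_infsum[OF abs_summable_summable[OF s[OF w]]] by simp
    qed
    then show ?thesis by (simp add: u coef_def)
  next
    case False
    then show ?thesis using coef_off[OF h] c by (auto simp: u laurent_arrays_def)
  qed
qed

lemma hol_minus: "f \<in> hol_carrier n r \<Longrightarrow> - f \<in> hol_carrier n r"
proof -
  assume f: "f \<in> hol_carrier n r"
  have "- coef f \<in> laurent_arrays" using coef_mem[OF f] by (auto simp: laurent_arrays_def)
  moreover have "- f = laurent_sum (- coef f)"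
  proof -
    have "laurent_sum (- coef f) = - laurent_sum (coef f)"
      by (auto simp: laurent_sum_def laurent_eval_def wpush_def fun_eq_iff infsum_uminus)
    then show ?thesis by (simp add: laurent_sum_coef[OF f])
  qed
  ultimately show ?thesis using laurent_sum_mem by simp
qed

lemma laurent_arrays_zero: "0 \<in> laurent_arrays"
  by (simp add: laurent_arrays_def)

lemma hol_zero_mem: "0 \<in> hol_carrier n r"
proof -
  have "laurent_sum 0 = 0" by (simp add: laurent_sum_def laurent_eval_def wpush_def fun_eq_iff)
  then show ?thesis using laurent_sum_mem[OF laurent_arrays_zero] by simp
qed

sublocale H: koethe_space "hol_carrier n r" coef "words n \<times> (UNIV :: int set)" hol_weight r
proof
  fix f g assume "f \<in> hol_carrier n r" "g \<in> hol_carrier n r"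
  then show "coef (f + g) = coef f + coef g"
    by (auto simp: coef_def fun_eq_iff laurent_coeff_add hol_coordinate)
next
  fix f assume f: "f \<in> hol_carrier n r" and 0: "\<forall>u\<in>IJ. coef f u = 0"
  have "coef f u = 0" for u
    using 0 coef_off[OF f, of u] by (cases u; cases "fst u \<in> words n") auto
  then have "coef f = 0" by (simp add: fun_eq_iff)
  then have "f = laurent_sum 0" using laurent_sum_coef[OF f] by simp
  also have "\<dots> = 0" by (simp add: laurent_sum_def laurent_eval_def wpush_def fun_eq_iff)
  finally show "f = 0" .
next
  fix f \<rho> \<tau> assume "f \<in> hol_carrier n r" "(\<rho>, \<tau>) \<in> params r"
  then show "(\<lambda>u. cmod (coef f u) * hol_weight \<rho> \<tau> u) summable_on IJ"
    using coef_mem by (auto simp: laurent_arrays_def)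
qed (auto simp: radius_pos hol_weight_pos hol_weight_mono hol_add hol_minus hol_zero_mem)

text \<open>Values on an annulus are controlled by a Laurent norm. Together with the way back, from
  values on two circles to a Laurent norm, this identifies the compact-open topology with that of
  the norms \<open>H.nrm\<close>.\<close>

lemma value_le_nrm:
  assumes "f \<in> hol_carrier n r" "w \<noteq> 0" "inverse \<tau>' \<le> cmod w" "cmod w \<le> \<tau>'" "(\<rho>, \<tau>) \<in> params r" "\<tau> \<le> \<tau>'"
  shows "F.nrm \<rho> \<tau> (f w) \<le> H.nrm \<rho> \<tau>' f"
  using laurent_sum_bound[OF coef_mem assms(2-6), of f] assms(1) by (simp add: laurent_sum_coef H.nrm_def)

lemma nrm_le_values:
  assumes "f \<in> hol_carrier n r" "(\<rho>, \<tau>) \<in> params r"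
    and "\<And>w. w \<in> two_circles \<tau> \<Longrightarrow> F.nrm \<rho> \<tau> (f w) \<le> M"
  shows "H.nrm \<rho> \<tau> f \<le> M * geom_const"
  unfolding H.nrm_def using assms by (intro coef_bound(2)) (auto simp: two_circles(3))

lemma geom_const_pos: "0 < geom_const"
proof -
  have "sum (\<lambda>p::int. (1/2::real) ^ nat \<bar>p\<bar>) {0} \<le> geom_const"
    unfolding geom_const_def by (intro finite_sum_le_infsum summable_half_power_int) auto
  then show ?thesis by simp
qed

end

section \<open>The algebra of holomorphic functions\<close>

text \<open>The value at the origin is set to 0 by hand: elements of the carrier vanish there, while
  \<open>0 powi 0\<close> is 1.\<close>

definition hol_mono :: "nat list \<Rightarrow> int \<Rightarrow> complex \<Rightarrow> complex \<Rightarrow> free_series" where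
  "hol_mono \<alpha> p c = (\<lambda>w. if w = 0 then 0 else (\<lambda>\<beta>. c * w powi p * free_word \<alpha> \<beta>))"

lemma hol_mono_mult:
  "(\<lambda>w. free_mult (hol_mono \<alpha> p c w) (hol_mono \<beta> q d w)) = hol_mono (\<alpha> @ \<beta>) (p + q) (c * d)"
proof
  fix w
  have fm: "free_mult (\<lambda>\<gamma>. x * free_word \<alpha> \<gamma>) (\<lambda>\<gamma>. y * free_word \<beta> \<gamma>) = (\<lambda>\<gamma>. x * y * free_word (\<alpha> @ \<beta>) \<gamma>)" for x y
    by (simp add: free_mult_scale free_mult_word mult.assoc)
  have z: "free_mult 0 0 = 0" by (simp add: free_mult_def fun_eq_iff)
  show "free_mult (hol_mono \<alpha> p c w) (hol_mono \<beta> q d w) = hol_mono (\<alpha> @ \<beta>) (p + q) (c * d) w"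
  proof (cases "w = 0")
    case False
    then show ?thesis unfolding hol_mono_def by (simp only: if_False fm) (simp add: power_int_add mult_ac)
  qed (simp add: hol_mono_def z)
qed

lemma hol_z_eq: "hol_z = hol_mono [] 1 1"
  by (auto simp: hol_z_def hol_mono_def fun_eq_iff)

lemma hol_zeta_eq: "hol_zeta i = hol_mono [i] 0 1"
  by (auto simp: hol_zeta_def hol_const_def hol_mono_def fun_eq_iff)

lemma hol_one_eq: "hol_const (free_word []) = hol_mono [] 0 1"
  by (auto simp: hol_const_def hol_mono_def fun_eq_iff)

context deformation
begin

section \<open>Comparison with the compact-open topology\<close>

lemma hol_continuous_delta:
  assumes f: "f \<in> hol_carrier n r" and w: "w \<noteq> 0" and p: "(\<rho>, \<tau>) \<in> params r" and e: "0 < e"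
  shows "\<exists>\<delta>>0. \<forall>v. dist v w < \<delta> \<longrightarrow> F.nrm \<rho> \<tau> (f v - f w) < e"
proof -
  have "\<forall>\<^sub>F v in at w. dist (F.nrm \<rho> \<tau> (f v - f w)) 0 < e"
    by (rule tendstoD[OF hol_continuous[OF f w p] e])
  then obtain \<delta> where \<delta>: "\<delta> > 0" "\<forall>v. v \<noteq> w \<and> dist v w < \<delta> \<longrightarrow> \<bar>F.nrm \<rho> \<tau> (f v - f w)\<bar> < e"
    unfolding eventually_at by auto
  have "F.nrm \<rho> \<tau> (f v - f w) < e" if "dist v w < \<delta>" for v
    using \<delta>(2) that F.N_zero[of \<rho> \<tau>] e by (cases "v = w") auto
  then show ?thesis using \<delta>(1) by blast
qed

text \<open>Every point \<open>w\<close> of \<open>K\<close> has its own seminorm and radius showing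
  that \<open>f w\<close> is interior to \<open>U\<close>. Compactness leaves finitely many of them;
  half of the radius is spent on the oscillation of \<open>f\<close> between \<open>v\<close> and a
  centre, the other half is left for \<open>g - f\<close>.\<close>

lemma openin_H_compact_open:
  assumes K: "compact K" "0 \<notin> K" and U: "openin F.top U"
  shows "openin H.top {f \<in> hol_carrier n r. f ` K \<subseteq> U}"
  unfolding H.openin_top_iff
proof (intro conjI ballI)
  fix f assume "f \<in> {f \<in> hol_carrier n r. f ` K \<subseteq> U}"
  then have f: "f \<in> hol_carrier n r" "f ` K \<subseteq> U" by auto
  have nz: "w \<noteq> 0" if "w \<in> K" for w using K that by auto
  have "\<exists>\<rho> \<tau> \<epsilon>. (\<rho>, \<tau>) \<in> params r \<and> \<epsilon> > 0 \<and> {a \<in> free_carrier n r. F.nrm \<rho> \<tau> (a - f w) < \<epsilon>} \<subseteq> U"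
    if "w \<in> K" for w using U f(2) that unfolding F.openin_top_iff by blast
  then have "\<forall>w\<in>K. \<exists>x. (fst x, fst (snd x)) \<in> params r \<and> snd (snd x) > (0::real) \<and>
      {a \<in> free_carrier n r. F.nrm (fst x) (fst (snd x)) (a - f w) < snd (snd x)} \<subseteq> U"
    by (simp only: split_paired_Ex fst_conv snd_conv) blast
  then obtain X where X: "\<forall>w\<in>K. (fst (X w), fst (snd (X w))) \<in> params r \<and> snd (snd (X w)) > (0::real) \<and>
      {a \<in> free_carrier n r. F.nrm (fst (X w)) (fst (snd (X w))) (a - f w) < snd (snd (X w))} \<subseteq> U"
    by (rule bchoice[THEN exE])
  define P Q E where "P w = fst (X w)" and "Q w = fst (snd (X w))" and "E w = snd (snd (X w))" for w
  have PQE: "(P w, Q w) \<in> params r \<and> E w > (0::real) \<and>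
      {a \<in> free_carrier n r. F.nrm (P w) (Q w) (a - f w) < E w} \<subseteq> U" if "w \<in> K" for w
    using X that by (simp add: P_def Q_def E_def)
  have "\<exists>\<delta>>0. \<forall>v. dist v w < \<delta> \<longrightarrow> F.nrm (P w) (Q w) (f v - f w) < E w / 2" if "w \<in> K" for w
    using PQE[OF that] by (intro hol_continuous_delta f nz that) auto
  then obtain \<delta> where \<delta>: "\<And>w. w \<in> K \<Longrightarrow> \<delta> w > 0 \<and>
      (\<forall>v. dist v w < \<delta> w \<longrightarrow> F.nrm (P w) (Q w) (f v - f w) < E w / 2)" by metis
  have "K \<subseteq> (\<Union>w\<in>K. ball w (\<delta> w))" using \<delta> by auto
  then obtain D where D: "D \<subseteq> K" "finite D" "K \<subseteq> (\<Union>w\<in>D. ball w (\<delta> w))"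
    using compactE_image[OF K(1), of K "\<lambda>w. ball w (\<delta> w)"] by auto
  have "(\<lambda>w. F.nrm (P w) (Q w)) ` D \<subseteq> {F.nrm \<rho> \<tau> | \<rho> \<tau>. (\<rho>, \<tau>) \<in> params r}" using PQE D(1) by blast
  then obtain \<rho> \<tau> where p: "(\<rho>, \<tau>) \<in> params r"
      and dom: "\<And>w a. w \<in> D \<Longrightarrow> a \<in> free_carrier n r \<Longrightarrow> F.nrm (P w) (Q w) a \<le> F.nrm \<rho> \<tau> a"
    using F.finite_directed[of "(\<lambda>w. F.nrm (P w) (Q w)) ` D"] D(2) by (auto simp del: F.nrm_def)
  define \<epsilon> where "\<epsilon> = Min (insert 1 ((\<lambda>w. E w / 2) ` D))"
  have \<epsilon>: "0 < \<epsilon>" "\<And>w. w \<in> D \<Longrightarrow> \<epsilon> \<le> E w / 2"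
  proof -
    show "0 < \<epsilon>" using D PQE by (auto simp: \<epsilon>_def)
    show "\<epsilon> \<le> E w / 2" if "w \<in> D" for w
      unfolding \<epsilon>_def by (rule Min_le) (use D that in auto)
  qed
  obtain B where B: "\<And>w. w \<in> K \<Longrightarrow> cmod w \<le> B" using compact_imp_bounded[OF K(1)] by (auto simp: bounded_iff)
  obtain d where d: "0 < d" "\<And>w. w \<in> K \<Longrightarrow> d \<le> cmod w"
    using separate_point_closed[OF compact_imp_closed[OF K(1)] K(2)] by auto
  \<comment> \<open>The annulus between \<open>inverse T\<close> and \<open>T\<close> contains
    \<open>K\<close>, as \<open>value_le_nrm\<close> demands.\<close>
  define T where "T = max \<tau> (max B (inverse d))"
  have T: "\<tau> \<le> T" "inverse T \<le> cmod w" "cmod w \<le> T" if "w \<in> K" for w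
  proof -
    show "\<tau> \<le> T" by (simp add: T_def)
    have "inverse T \<le> inverse (inverse d)" using d(1) by (intro le_imp_inverse_le) (auto simp: T_def)
    then show "inverse T \<le> cmod w" using d(2)[OF that] by simp
    show "cmod w \<le> T" using B[OF that] by (simp add: T_def)
  qed
  have "g \<in> {f \<in> hol_carrier n r. f ` K \<subseteq> U}" if g: "g \<in> hol_carrier n r" "H.nrm \<rho> T (g - f) < \<epsilon>" for g
  proof -
    have "g v \<in> U" if v: "v \<in> K" for v
    proof -
      obtain w where w: "w \<in> D" "dist v w < \<delta> w" using D(3) v by (auto simp: dist_commute)
      then have wK: "w \<in> K" using D(1) by blast
      note mem = hol_value[OF g(1) nz[OF v]] hol_value[OF f(1) nz[OF v]] hol_value[OF f(1) nz[OF wK]]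
      have "F.nrm (P w) (Q w) (g v - f v) \<le> F.nrm \<rho> \<tau> ((g - f) v)"
        using dom[OF w(1) F.diff_mem[OF mem(1,2)]] by simp
      also have "\<dots> \<le> H.nrm \<rho> T (g - f)"
        by (intro value_le_nrm H.diff_mem g f nz v T[OF v] p)
      also have "\<dots> < E w / 2" using g(2) \<epsilon>(2)[OF w(1)] by simp
      finally have "F.nrm (P w) (Q w) (g v - f w) < E w"
        using F.N_triangle[OF _ mem, of "P w" "Q w"] PQE[OF wK] \<delta>[OF wK] w(2) by fastforce
      then show ?thesis using PQE[OF wK] mem(1) by blast
    qed
    then show ?thesis using g by blast
  qed
  moreover have "(\<rho>, T) \<in> params r" using params_scale[OF p] by (simp add: T_def)
  ultimately show "\<exists>\<rho> \<tau> \<epsilon>. (\<rho>, \<tau>) \<in> params r \<and> \<epsilon> > 0 \<and>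
      {g \<in> hol_carrier n r. H.nrm \<rho> \<tau> (g - f) < \<epsilon>} \<subseteq> {f \<in> hol_carrier n r. f ` K \<subseteq> U}"
    using \<epsilon>(1) by (intro exI[of _ \<rho>] exI[of _ T] exI[of _ \<epsilon>]) auto
qed auto

lemma compact_open_basic:
  "compact K \<Longrightarrow> 0 \<notin> K \<Longrightarrow> openin F.top U \<Longrightarrow>
    openin (compact_open_topology n r) {f \<in> hol_carrier n r. f ` K \<subseteq> U}"
  unfolding compact_open_topology_def top_free_algebra by (rule topology_generated_by_Basis) blast

text \<open>For the converse inclusion, a ball of a Laurent norm is governed by values on two
  circles. These are covered by finitely many compact pieces on which \<open>f\<close> is nearly
  constant; prescribing a small ball for the image of each piece is a finite intersection of
  subbasic conditions.\<close>

lemma compact_open_topology_eq: "compact_open_topology n r = H.top"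
proof (rule topology_eq[THEN iffD2], intro allI iffI)
  fix U assume "openin (compact_open_topology n r) U"
  then show "openin H.top U"
    unfolding compact_open_topology_def openin_topology_generated_by_iff top_free_algebra
    by (rule generate_topology_on_coarsest[OF istopology_openin, rotated])
       (auto intro: openin_H_compact_open)
next
  fix U assume U: "openin H.top U"
  show "openin (compact_open_topology n r) U"
  proof (subst openin_subopen, intro ballI)
    fix f assume fU: "f \<in> U"
    then obtain \<rho> \<tau> \<epsilon> where p: "(\<rho>, \<tau>) \<in> params r" and \<epsilon>: "\<epsilon> > 0"
        and ball: "{g \<in> hol_carrier n r. H.nrm \<rho> \<tau> (g - f) < \<epsilon>} \<subseteq> U"
      using U unfolding H.openin_top_iff by blast
    have f: "f \<in> hol_carrier n r" using U fU unfolding H.openin_top_iff by blast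
    \<comment> \<open>On the circles \<open>g\<close> will differ from \<open>f\<close> by at most
      \<open>2 * \<eta>\<close>, and \<open>nrm_le_values\<close> multiplies this by
      \<open>geom_const\<close>; the 3 makes the final inequality strict.\<close>
    define \<eta> where "\<eta> = \<epsilon> / (3 * geom_const)"
    have \<eta>: "\<eta> > 0" using \<epsilon> geom_const_pos by (simp add: \<eta>_def)
    define K where "K = two_circles \<tau>"
    have K: "compact K" "0 \<notin> K" using two_circles(1,2) paramsD[OF p] by (auto simp: K_def)
    have nz: "w \<noteq> 0" if "w \<in> K" for w using K that by auto
    have "\<exists>\<delta>>0. \<forall>v. dist v w < \<delta> \<longrightarrow> F.nrm \<rho> \<tau> (f v - f w) < \<eta>" if "w \<in> K" for w
      by (intro hol_continuous_delta f nz that p \<eta>)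
    then obtain \<delta> where \<delta>: "\<And>w. w \<in> K \<Longrightarrow> \<delta> w > 0 \<and> (\<forall>v. dist v w < \<delta> w \<longrightarrow> F.nrm \<rho> \<tau> (f v - f w) < \<eta>)"
      by metis
    have "K \<subseteq> (\<Union>w\<in>K. ball w (\<delta> w / 2))" using \<delta> by auto
    then obtain D where D: "D \<subseteq> K" "finite D" "K \<subseteq> (\<Union>w\<in>D. ball w (\<delta> w / 2))"
      using compactE_image[OF K(1), of K "\<lambda>w. ball w (\<delta> w / 2)"] by auto
    define N where "N w = {g \<in> hol_carrier n r. g ` (K \<inter> cball w (\<delta> w / 2)) \<subseteq>
        {a \<in> free_carrier n r. F.nrm \<rho> \<tau> (a - f w) < \<eta>}}" for w
    have N: "openin (compact_open_topology n r) (N w)" if "w \<in> D" for w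
      unfolding N_def using K D that
      by (intro compact_open_basic F.openin_ball p hol_value f nz) (auto intro: compact_Int)
    have whole: "openin (compact_open_topology n r) (hol_carrier n r)"
      using compact_open_basic[of "{}" "{}"] by simp
    have fN: "f \<in> N w" if w: "w \<in> D" for w
    proof -
      have wK: "w \<in> K" using w D by blast
      have "F.nrm \<rho> \<tau> (f v - f w) < \<eta>" if "v \<in> cball w (\<delta> w / 2)" for v
        using \<delta>[OF wK] that by (auto simp: dist_commute)
      then show ?thesis using f nz by (auto simp: N_def hol_value)
    qed
    have sub: "g \<in> U" if g: "g \<in> hol_carrier n r" and gN: "\<And>w. w \<in> D \<Longrightarrow> g \<in> N w" for g
    proof -
      have "F.nrm \<rho> \<tau> ((g - f) v) \<le> 2 * \<eta>" if v: "v \<in> K" for v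
      proof -
        obtain w where w: "w \<in> D" "dist v w < \<delta> w / 2" using D(3) v by (auto simp: dist_commute)
        then have wK: "w \<in> K" using D(1) by blast
        note mem = hol_value[OF g nz[OF v]] hol_value[OF f nz[OF wK]] hol_value[OF f nz[OF v]]
        have "v \<in> K \<inter> cball w (\<delta> w / 2)" using v w(2) by (simp add: dist_commute)
        then have "F.nrm \<rho> \<tau> (g v - f w) < \<eta>" using gN[OF w(1)] unfolding N_def by blast
        moreover have "F.nrm \<rho> \<tau> (f v - f w) < \<eta>" using \<delta>[OF wK] w(2) by auto
        ultimately show ?thesis
          using F.N_triangle[OF p mem] F.N_commute[OF mem(2,3)] by simp
      qed
      then have "H.nrm \<rho> \<tau> (g - f) \<le> (2 * \<eta>) * geom_const"
        by (intro nrm_le_values H.diff_mem g f p) (simp add: K_def)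
      also have "\<dots> < \<epsilon>" using \<epsilon> geom_const_pos by (simp add: \<eta>_def)
      finally show ?thesis using ball g by blast
    qed
    show "\<exists>T. openin (compact_open_topology n r) T \<and> f \<in> T \<and> T \<subseteq> U"
    proof (intro exI[of _ "hol_carrier n r \<inter> (\<Inter>(N ` D) \<inter> topspace (compact_open_topology n r))"] conjI)
      show "openin (compact_open_topology n r) (hol_carrier n r \<inter> (\<Inter>(N ` D) \<inter> topspace (compact_open_topology n r)))"
        using whole N D(2) by (intro openin_Int openin_INT) auto
      show "f \<in> hol_carrier n r \<inter> (\<Inter>(N ` D) \<inter> topspace (compact_open_topology n r))"
        using f fN openin_subset[OF whole] by blast
      show "hol_carrier n r \<inter> (\<Inter>(N ` D) \<inter> topspace (compact_open_topology n r)) \<subseteq> U"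
        using sub by blast
    qed
  qed
qed

lemma top_hol_algebra: "alg_top (hol_algebra n r) = H.top"
  by (simp add: hol_algebra_def compact_open_topology_eq)

section \<open>Monomials and the ring of holomorphic functions\<close>

lemma hol_mono_eq_laurent_sum:
  assumes "\<alpha> \<in> words n"
  shows "hol_mono \<alpha> p c = laurent_sum (\<lambda>u. if u = (\<alpha>, p) then c else 0)"
proof
  fix w
  show "hol_mono \<alpha> p c w = laurent_sum (\<lambda>u. if u = (\<alpha>, p) then c else 0) w"
    using assms by (auto simp: hol_mono_def laurent_sum_def laurent_eval_def wpush_single free_word_def fun_eq_iff)
qed

lemma single_laurent_array:
  assumes "\<alpha> \<in> words n"
  shows "(\<lambda>u. if u = (\<alpha>, p) then c else 0) \<in> laurent_arrays"
proof -
  have "(\<lambda>u. cmod (if u = (\<alpha>, p) then c else 0) * hol_weight \<rho> \<tau> u) summable_on IJ" for \<rho> \<tau>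
  proof -
    have "(\<lambda>u. cmod (if u = (\<alpha>, p) then c else 0) * hol_weight \<rho> \<tau> u) summable_on IJ \<longleftrightarrow>
        (\<lambda>u. cmod (if u = (\<alpha>, p) then c else 0) * hol_weight \<rho> \<tau> u) summable_on {(\<alpha>, p)}"
      using assms by (intro summable_on_cong_neutral) auto
    then show ?thesis by simp
  qed
  then show ?thesis using assms by (auto simp: laurent_arrays_def)
qed

lemma hol_mono_mem: "\<alpha> \<in> words n \<Longrightarrow> hol_mono \<alpha> p c \<in> hol_carrier n r"
  by (simp add: hol_mono_eq_laurent_sum laurent_sum_mem single_laurent_array)

lemma coef_hol_mono: "\<alpha> \<in> words n \<Longrightarrow> coef (hol_mono \<alpha> p c) = (\<lambda>u. if u = (\<alpha>, p) then c else 0)"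
  by (simp add: hol_mono_eq_laurent_sum coef_laurent_sum single_laurent_array)

lemma ring_hol_algebra: "ring (hol_algebra n r)"
proof (rule ringI)
  show "abelian_group (hol_algebra n r)"
  proof (rule abelian_groupI)
    fix f assume "f \<in> carrier (hol_algebra n r)"
    then show "\<exists>g\<in>carrier (hol_algebra n r). g \<oplus>\<^bsub>hol_algebra n r\<^esub> f = \<zero>\<^bsub>hol_algebra n r\<^esub>"
      by (intro bexI[of _ "- f"]) (auto simp: hol_algebra_def hol_minus)
  qed (auto simp: hol_algebra_def hol_add hol_zero_mem add_ac)
  show "Group.monoid (hol_algebra n r)"
  proof (rule monoidI)
    fix f assume "f \<in> carrier (hol_algebra n r)"
    then have f: "f \<in> hol_carrier n r" by (simp add: hol_algebra_def)
    have z: "free_mult 0 0 = 0" by (simp add: free_mult_def fun_eq_iff)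
    have "free_mult (hol_const (free_word []) w) (f w) = f w" "free_mult (f w) (hol_const (free_word []) w) = f w" for w
      using hol_zero[OF f] z by (cases "w = 0"; simp add: hol_const_def free_mult_one)+
    then show "\<one>\<^bsub>hol_algebra n r\<^esub> \<otimes>\<^bsub>hol_algebra n r\<^esub> f = f" "f \<otimes>\<^bsub>hol_algebra n r\<^esub> \<one>\<^bsub>hol_algebra n r\<^esub> = f"
      by (simp_all add: hol_algebra_def)
  qed (auto simp: hol_algebra_def hol_mult free_mult_assoc hol_one_eq hol_mono_mem)
qed (auto simp: hol_algebra_def free_mult_add fun_eq_iff)

end

section \<open>Inversions of words\<close>

primrec inversions :: "nat list \<Rightarrow> nat" where
  "inversions [] = 0"
| "inversions (i # \<alpha>) = length (filter (\<lambda>j. j < i) \<alpha>) + inversions \<alpha>"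

definition word_index :: "nat list \<times> int \<Rightarrow> mono_index" where
  "word_index = (\<lambda>(\<alpha>, p). (count_list \<alpha>, p - int (inversions \<alpha>)))"

lemma inversions_append:
  "inversions (\<alpha> @ \<beta>) = inversions \<alpha> + inversions \<beta> + (\<Sum>a\<leftarrow>\<alpha>. length (filter (\<lambda>b. b < a) \<beta>))"
  by (induction \<alpha>) auto

lemma length_filter_less:
  assumes "\<beta> \<in> words n"
  shows "length (filter (\<lambda>b. b < i) \<beta>) = (\<Sum>j\<in>{1..<i}. count_list \<beta> j)"
  using assms
proof (induction \<beta>)
  case (Cons b \<beta>)
  have "(\<Sum>j\<in>{1..<i}. count_list (b # \<beta>) j) = (\<Sum>j\<in>{1..<i}. count_list \<beta> j + (if j = b then 1 else 0))"
    by (rule sum.cong) auto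
  also have "\<dots> = (\<Sum>j\<in>{1..<i}. count_list \<beta> j) + (if b < i then 1 else 0)"
    using Cons.prems by (simp add: sum.distrib)
  finally show ?case using Cons by auto
qed simp

lemma sum_list_count:
  assumes "\<alpha> \<in> words n"
  shows "(\<Sum>a\<leftarrow>\<alpha>. f a) = (\<Sum>i\<in>{1..n}. count_list \<alpha> i * f i :: nat)"
  using assms
proof (induction \<alpha>)
  case (Cons a \<alpha>)
  have "(\<Sum>i\<in>{1..n}. count_list (a # \<alpha>) i * f i) =
      (\<Sum>i\<in>{1..n}. count_list \<alpha> i * f i + (if i = a then f a else 0))"
    by (rule sum.cong) auto
  also have "\<dots> = (\<Sum>i\<in>{1..n}. count_list \<alpha> i * f i) + f a"
    using Cons.prems by (simp add: sum.distrib)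
  finally show ?case using Cons by simp
qed simp

lemma count_list_off: "\<alpha> \<in> words n \<Longrightarrow> i \<notin> {1..n} \<Longrightarrow> count_list \<alpha> i = 0"
  by (metis count_list_0_iff mem_Collect_eq subset_eq words_def)

lemma word_index_mem: "\<alpha> \<in> words n \<Longrightarrow> word_index (\<alpha>, p) \<in> D_index n"
  using count_list_off[of \<alpha> n] by (simp add: word_index_def D_index_def)

lemma count_list_replicate: "count_list (replicate v m) i = (if i = m then v else 0)"
  by (induction v) auto

text \<open>The inversions between a letter of \<alpha> and a letter of \<beta> are counted by the
  twist in \<open>mono_mult\<close>. So the index is multiplicative, which is the homomorphism
  property of the projection on monomials.\<close>

lemma word_index_append:
  assumes "\<alpha> \<in> words n" "\<beta> \<in> words n"
  shows "mono_mult n (word_index (\<alpha>, p)) (word_index (\<beta>, q)) = word_index (\<alpha> @ \<beta>, p + q)"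
proof -
  have "(\<Sum>a\<leftarrow>\<alpha>. length (filter (\<lambda>b. b < a) \<beta>)) =
      (\<Sum>i\<in>{1..n}. \<Sum>j\<in>{1..<i}. count_list \<alpha> i * count_list \<beta> j)"
    by (simp add: sum_list_count[OF assms(1)] length_filter_less[OF assms(2)] sum_distrib_left)
  then have "int (inversions (\<alpha> @ \<beta>)) = int (inversions \<alpha>) + int (inversions \<beta>) +
      (\<Sum>i\<in>{1..n}. \<Sum>j\<in>{1..<i}. int (count_list \<alpha> i * count_list \<beta> j))"
    by (simp add: inversions_append)
  then show ?thesis
    by (auto simp: mono_mult_def word_index_def fun_eq_iff)
qed

lemma word_index_degree:
  "\<alpha> \<in> words n \<Longrightarrow> (\<Sum>i\<in>{1..n}. fst (word_index (\<alpha>, p)) i) = length \<alpha>"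
  using sum_list_count[of \<alpha> n "\<lambda>_. 1"] by (simp add: word_index_def sum_list_triv)

text \<open>The estimate behind the continuity of the projection. The word is built letter by
  letter: \<open>omega\<close> is subadditive in absolute value under \<open>mono_mult\<close>, and
  a single letter contributes 0.\<close>

lemma omega_word_index:
  assumes "\<alpha> \<in> words n"
  shows "\<bar>omega n (fst (word_index (\<alpha>, p))) (snd (word_index (\<alpha>, p)))\<bar> \<le> \<bar>p\<bar>"
  using assms
proof (induction \<alpha>)
  case Nil
  have "cross n (\<lambda>i. 0) = 0" by (simp add: cross_def)
  then show ?case by (auto simp: word_index_def omega_def)
next
  case (Cons i \<alpha>)
  have "mono_mult n (word_index ([i], 0)) (word_index (\<alpha>, p)) = word_index (i # \<alpha>, p)"
    using word_index_append[of "[i]" n \<alpha> 0 p] Cons.prems by simp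
  then have "\<bar>omega n (fst (word_index (i # \<alpha>, p))) (snd (word_index (i # \<alpha>, p)))\<bar> \<le>
      \<bar>omega n (fst (word_index ([i], 0))) (snd (word_index ([i], 0)))\<bar> +
      \<bar>omega n (fst (word_index (\<alpha>, p))) (snd (word_index (\<alpha>, p)))\<bar>"
    by (intro omega_mono_mult) simp
  moreover have "omega n (fst (word_index ([i], 0))) (snd (word_index ([i], 0))) = 0"
    by (simp add: word_index_def omega_def)
  ultimately show ?case using Cons by simp
qed

text \<open>Letters on the left do not exceed \<open>m\<close> and form no inversion with the
  inserted copies; each copy forms one with every smaller letter on its right.\<close>

lemma inversions_insert_replicate:
  assumes "set \<alpha> \<subseteq> {..m}"
  shows "inversions (\<alpha> @ replicate v m @ \<beta>) = inversions (\<alpha> @ \<beta>) + v * length (filter (\<lambda>b. b < m) \<beta>)"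
  using assms
proof (induction \<alpha>)
  case Nil
  show ?case by (induction v) auto
next
  case (Cons a \<alpha>)
  then show ?case by auto
qed

section \<open>Words with prescribed content and number of inversions\<close>

definition cross_nat :: "nat \<Rightarrow> (nat \<Rightarrow> nat) \<Rightarrow> nat" where
  "cross_nat n k = (\<Sum>j\<in>{1..n}. \<Sum>i\<in>{1..<j}. k i * k j)"

lemma cross_eq: "cross n k = int (cross_nat n k)"
  by (simp add: cross_def cross_nat_def)

lemma cross_nat_Suc: "cross_nat (Suc n) k = cross_nat n k + (\<Sum>i\<in>{1..n}. k i) * k (Suc n)"
  by (simp add: cross_nat_def sum_distrib_right atLeastLessThanSuc_atLeastAtMost)

text \<open>
  A word with the letters \<open>1, \<dots>, n\<close> and the maximal number of inversions is extended by \<open>b\<close>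
  letters \<open>m = n + 1\<close>: moving all of them to the left past one letter at a time, block by block, the number
  of inversions takes every value while only a bounded number of blocks is created.
\<close>

lemma exists_word_with_inversions:
  assumes "t \<le> cross_nat n k"
  shows "\<exists>\<alpha>\<in>words n. (\<forall>i\<in>{1..n}. count_list \<alpha> i = k i) \<and> inversions \<alpha> = t \<and> blocks \<alpha> \<le> 4 * n"
  using assms
proof (induction n arbitrary: t)
  case 0
  then show ?case by (intro bexI[of _ "[]"]) (auto simp: cross_nat_def)
next
  case (Suc n)
  define m b where "m = Suc n" and "b = k m"
  define N where "N = (\<Sum>i\<in>{1..n}. k i)"
  have t: "t \<le> cross_nat n k + N * b" using Suc.prems by (simp add: cross_nat_Suc m_def b_def N_def)
  have sub: "\<alpha> \<in> words n \<Longrightarrow> \<alpha> \<in> words (Suc n)" for \<alpha> by (auto simp: words_def)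
  have rep: "replicate v m \<in> words (Suc n)" for v by (auto simp: words_def m_def set_replicate_conv_if)
  have small: "\<forall>x\<in>set \<alpha>. x < m" if "\<alpha> \<in> words n" for \<alpha> using that by (auto simp: words_def m_def)
  have cm: "count_list \<alpha> m = 0" if "\<alpha> \<in> words n" for \<alpha> using count_list_off[OF that, of m] by (simp add: m_def)
  have fl: "filter (\<lambda>x. x < m) \<alpha> = \<alpha>" if "\<alpha> \<in> words n" for \<alpha> using small[OF that] by simp
  show ?case
  proof (cases "t \<le> cross_nat n k")
    \<comment> \<open>A word in the first \<open>n\<close> letters already has enough inversions,
      and the copies of \<open>m\<close> go to the end, where they form none.\<close>
    case True
    then obtain \<alpha> where \<alpha>: "\<alpha> \<in> words n" "\<forall>i\<in>{1..n}. count_list \<alpha> i = k i" "inversions \<alpha> = t" "blocks \<alpha> \<le> 4 * n"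
      using Suc.IH by blast
    have "set \<alpha> \<subseteq> {..m}" using small[OF \<alpha>(1)] by auto
    then have "inversions (\<alpha> @ replicate b m @ []) = t"
      using \<alpha>(3) by (subst inversions_insert_replicate) auto
    moreover have "blocks (\<alpha> @ replicate b m) \<le> 4 * Suc n"
      using blocks_append[of \<alpha> "replicate b m"] blocks_replicate[of b m] \<alpha>(4) by simp
    moreover have "\<forall>i\<in>{1..Suc n}. count_list (\<alpha> @ replicate b m) i = k i"
      using \<alpha>(2) cm[OF \<alpha>(1)] by (auto simp: count_list_replicate le_Suc_eq b_def m_def)
    ultimately show ?thesis
      using sub[OF \<alpha>(1)] rep[of b] by (intro bexI[of _ "\<alpha> @ replicate b m"]) (auto simp: words_append)
  next
    case False
    \<comment> \<open>\<open>w\<close> has \<open>cross_nat n k\<close> inversions, the largest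
      number for its content; the \<open>s\<close> missing ones have to come from the copies of
      \<open>m\<close>.\<close>
    obtain w where w: "w \<in> words n" "\<forall>i\<in>{1..n}. count_list w i = k i" "inversions w = cross_nat n k" "blocks w \<le> 4 * n"
      using Suc.IH by blast
    have len: "length w = N" using sum_list_count[OF w(1), of "\<lambda>_. 1"] w(2) by (simp add: N_def sum_list_triv)
    define s where "s = t - cross_nat n k"
    have s: "0 < s" "s \<le> N * b" "t = cross_nat n k + s" using False t by (auto simp: s_def)
    show ?thesis
    proof (cases "s = N * b")
      \<comment> \<open>All copies stand in front of \<open>w\<close>. The general construction
        needs a letter of \<open>w\<close> with exactly \<open>s div b\<close> letters behind it,
        and here that number would be the length of \<open>w\<close>.\<close>
      case True
      have "inversions ([] @ replicate b m @ w) = t"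
        using w(3) s True by (subst inversions_insert_replicate) (auto simp: fl[OF w(1)] len mult.commute)
      moreover have "blocks (replicate b m @ w) \<le> 4 * Suc n"
        using blocks_append[of "replicate b m" w] blocks_replicate[of b m] w(4) by simp
      moreover have "\<forall>i\<in>{1..Suc n}. count_list (replicate b m @ w) i = k i"
        using w(2) cm[OF w(1)] by (auto simp: count_list_replicate le_Suc_eq b_def m_def)
      ultimately show ?thesis
        using sub[OF w(1)] rep[of b] by (intro bexI[of _ "replicate b m @ w"]) (auto simp: words_append)
    next
      case False
      have b: "0 < b" using s by (cases b) auto
      \<comment> \<open>Every copy of \<open>m\<close> gets \<open>u\<close> smaller letters on its
        right, and \<open>v\<close> of the copies get one more by standing on the left of the letter
        \<open>x\<close>.\<close>
      define u v where "u = s div b" and "v = s mod b"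
      have uv: "u < N" "v < b" "s = b * u + v"
        using False s b by (auto simp: u_def v_def less_mult_imp_div_less)
      define j where "j = N - Suc u"
      have j: "j < length w" "length (drop (Suc j) w) = u" using uv by (auto simp: j_def len)
      define w1 x w2 where "w1 = take j w" and "x = w ! j" and "w2 = drop (Suc j) w"
      have lw: "length w2 = u" using j(2) by (simp only: w2_def)
      have ww: "w = w1 @ x # w2" unfolding w1_def x_def w2_def by (rule id_take_nth_drop[OF j(1)])
      have mem: "w1 \<in> words n" "x \<in> {1..n}" "w2 \<in> words n" using w(1) by (auto simp: ww words_append)
      have le: "y \<le> m" if "y \<in> set w" for y using small[OF w(1)] that less_imp_le by blast
      have lt: "set w1 \<subseteq> {..m}" "set (w1 @ [x]) \<subseteq> {..m}" "x < m"
        using le small[OF w(1)] by (simp_all add: ww subset_eq)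
      define \<alpha> where "\<alpha> = w1 @ replicate v m @ x # replicate (b - v) m @ w2"
      have "inversions \<alpha> = inversions (w1 @ x # replicate (b - v) m @ w2) + v * Suc u"
        unfolding \<alpha>_def using lt(3) lw
        by (subst inversions_insert_replicate[OF lt(1)]) (simp add: fl[OF mem(3)])
      also have "inversions (w1 @ x # replicate (b - v) m @ w2) = inversions w + (b - v) * u"
        using inversions_insert_replicate[OF lt(2), of "b - v" w2] lw
        by (simp add: fl[OF mem(3)] ww)
      finally have "inversions \<alpha> = cross_nat n k + ((b - v) * u + v * u) + v" by (simp add: w(3))
      moreover have "(b - v) * u + v * u = b * u" using uv(2) by (simp add: distrib_right[symmetric])
      ultimately have "inversions \<alpha> = t" by (simp add: s(3) uv(3))
      \<comment> \<open>At most four blocks are added to those of \<open>w\<close>: the two inserted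
        runs, the letter \<open>x\<close> counted on its own, and one for cutting \<open>w\<close>
        at \<open>x\<close>. This is the origin of \<open>4 * n\<close>.\<close>
      moreover have "blocks \<alpha> \<le> 4 * Suc n"
        using blocks_append[of w1 "replicate v m @ x # replicate (b - v) m @ w2"]
          blocks_append[of "replicate v m" "x # replicate (b - v) m @ w2"]
          blocks_append[of "[x]" "replicate (b - v) m @ w2"] blocks_append[of "replicate (b - v) m" w2]
          blocks_replicate[of v m] blocks_replicate[of "b - v" m]
          blocks_split[of w1 x w2] blocks_Cons_le[of w2 x] w(4)
        unfolding \<alpha>_def ww by simp
      moreover have "\<forall>i\<in>{1..Suc n}. count_list \<alpha> i = k i"
      proof
        fix i assume i: "i \<in> {1..Suc n}"
        have "count_list \<alpha> i = count_list w i + (if i = m then b else 0)"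
          using uv(2) by (simp add: \<alpha>_def ww count_list_replicate)
        then show "count_list \<alpha> i = k i"
          using i w(2) cm[OF w(1)] by (cases "i = m") (auto simp: m_def b_def)
      qed
      moreover have "\<alpha> \<in> words (Suc n)"
        using sub[OF mem(1)] sub[OF mem(3)] mem(2) rep by (auto simp: \<alpha>_def words_append)
      ultimately show ?thesis by blast
    qed
  qed
qed

text \<open>In each of the three cases of \<open>omega\<close> the number
  \<open>omega n k p - p\<close> lies between 0 and \<open>cross n k\<close>, so it is an admissible
  number of inversions.\<close>

lemma exists_word_for_index:
  assumes "u \<in> D_index n"
  shows "\<exists>\<alpha>\<in>words n. word_index (\<alpha>, omega n (fst u) (snd u)) = u \<and> blocks \<alpha> \<le> 4 * n"
proof -
  obtain k p where u: "u = (k, p)" by fastforce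
  have t: "0 \<le> omega n k p - p" "omega n k p - p \<le> cross n k"
    using cross_nonneg[of n k] by (auto simp: omega_def)
  then have "nat (omega n k p - p) \<le> cross_nat n k" by (simp add: cross_eq)
  from exists_word_with_inversions[OF this] obtain \<alpha> where \<alpha>: "\<alpha> \<in> words n"
      "\<forall>i\<in>{1..n}. count_list \<alpha> i = k i" "inversions \<alpha> = nat (omega n k p - p)" "blocks \<alpha> \<le> 4 * n"
    by blast
  have "count_list \<alpha> i = k i" for i
    using \<alpha>(2) count_list_off[OF \<alpha>(1), of i] assms by (cases "i \<in> {1..n}") (auto simp: u D_index_def)
  then show ?thesis
    using \<alpha> t by (intro bexI[of _ \<alpha>]) (auto simp: u word_index_def fun_eq_iff)
qed

definition index_word :: "nat \<Rightarrow> mono_index \<Rightarrow> nat list" where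
  "index_word n u = (SOME \<alpha>. \<alpha> \<in> words n \<and> word_index (\<alpha>, omega n (fst u) (snd u)) = u \<and> blocks \<alpha> \<le> 4 * n)"

lemma index_word:
  assumes "u \<in> D_index n"
  shows "index_word n u \<in> words n" "word_index (index_word n u, omega n (fst u) (snd u)) = u"
    "blocks (index_word n u) \<le> 4 * n"
  using someI_ex[of "\<lambda>\<alpha>. \<alpha> \<in> words n \<and> word_index (\<alpha>, omega n (fst u) (snd u)) = u \<and> blocks \<alpha> \<le> 4 * n"]
    exists_word_for_index[OF assms] unfolding index_word_def by blast+

section \<open>The projection onto the power series model\<close>

definition single :: "'i \<Rightarrow> complex \<Rightarrow> 'i \<Rightarrow> complex" where
  "single i c = (\<lambda>j. if j = i then c else 0)"

lemma D_mult_single: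
  assumes "u \<in> D_index n" "v \<in> D_index n"
  shows "D_mult n (single u c) (single v d) = single (mono_mult n u v) (c * d)"
proof -
  have s: "single u c = (\<lambda>w. c * D_mono (fst u) (snd u) w)" for u c
    by (auto simp: single_def D_mono_def fun_eq_iff)
  show ?thesis
    unfolding s D_mult_scale using D_mult_mono[of "fst u" "snd u" n "fst v" "snd v"] assms
    by (simp add: case_prod_unfold mult.assoc)
qed

context deformation
begin

section \<open>Continuity of the products\<close>

lemma D_weight_positive: "(\<rho>, \<tau>) \<in> params r \<Longrightarrow> 0 < D_weight n \<rho> \<tau> u"
  using paramsD by (fastforce simp: D_weight_def case_prod_unfold)

sublocale D: koethe_space "D_carrier n r" "\<lambda>a. a" "D_index n" "D_weight n" r
proof (rule koethe_space_id)
  fix \<rho> \<tau> \<rho>' \<tau>' u assume *: "(\<rho>, \<tau>) \<in> params r" "(\<rho>', \<tau>') \<in> params r" "\<rho> \<le> \<rho>'" "\<tau> \<le> \<tau>'"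
  then show "D_weight n \<rho> \<tau> u \<le> D_weight n \<rho>' \<tau>' u"
    using paramsD[of \<rho> \<tau>] unfolding D_weight_def case_prod_unfold by (intro mult_mono power_mono) auto
qed (auto simp: radius_pos D_weight_positive D_carrier_def)

lemma D_norm_eq: "D_norm n = D.nrm"
  by (simp add: fun_eq_iff D_norm_def D.nrm_def)

lemma top_D_algebra: "alg_top (D_algebra n r) = D.top"
  by (simp add: D_algebra_def D_norm_eq)

lemma D_carrierI:
  assumes "\<And>u. u \<notin> D_index n \<Longrightarrow> a u = 0"
    and "\<And>\<rho> \<tau>. (\<rho>, \<tau>) \<in> params r \<Longrightarrow> (\<lambda>u. cmod (a u) * D_weight n \<rho> \<tau> u) summable_on D_index n"
  shows "a \<in> D_carrier n r"
  using assms by (auto simp: D_carrier_def)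

lemma single_D_carrier: "u \<in> D_index n \<Longrightarrow> single u c \<in> D_carrier n r"
proof (rule D_carrierI)
  fix \<rho> \<tau> assume "u \<in> D_index n"
  then have "(\<lambda>v. cmod (single u c v) * D_weight n \<rho> \<tau> v) summable_on D_index n \<longleftrightarrow>
      (\<lambda>v. cmod (single u c v) * D_weight n \<rho> \<tau> v) summable_on {u}"
    by (intro summable_on_cong_neutral) (auto simp: single_def)
  then show "(\<lambda>v. cmod (single u c v) * D_weight n \<rho> \<tau> v) summable_on D_index n" by simp
qed (auto simp: single_def)

lemma D_mult_diff:
  assumes "a \<in> D_carrier n r" "a' \<in> D_carrier n r" "b \<in> D_carrier n r"
  shows "D_mult n (a - a') b = D_mult n a b - D_mult n a' b"
    and "D_mult n b (a - a') = D_mult n b a - D_mult n b a'"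
  using D_mult_add[OF radius_pos D.diff_mem[OF assms(1,2)] assms(2,3)] by (simp_all add: eq_diff_eq)

lemma D_mult_norm:
  "(\<rho>, \<tau>) \<in> params r \<Longrightarrow> a \<in> D_carrier n r \<Longrightarrow> b \<in> D_carrier n r \<Longrightarrow>
    D.nrm \<rho> \<tau> (D_mult n a b) \<le> D.nrm \<rho> \<tau> a * D.nrm \<rho> \<tau> b"
  using D_mult_submultiplicative(2)[of \<rho> \<tau> a n b] D.coord_summable paramsD by (simp add: D_norm_eq)

lemma continuous_D_mult:
  assumes b: "b \<in> D_carrier n r"
  shows "continuous_map D.top D.top (\<lambda>a. D_mult n a b)" "continuous_map D.top D.top (\<lambda>a. D_mult n b a)"
proof -
  show "continuous_map D.top D.top (\<lambda>a. D_mult n a b)"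
  proof (rule continuous_map_seminorm_bounded[OF D.seminorm_family_axioms D.seminorm_family_axioms])
    show "\<exists>\<rho>' \<tau>' C. (\<rho>', \<tau>') \<in> params r \<and> (\<forall>a\<in>D_carrier n r. D.nrm \<rho> \<tau> (D_mult n a b) \<le> C * D.nrm \<rho>' \<tau>' a)"
      if "(\<rho>, \<tau>) \<in> params r" for \<rho> \<tau>
      using D_mult_norm[OF that _ b] that
      by (intro exI[of _ \<rho>] exI[of _ \<tau>] exI[of _ "D.nrm \<rho> \<tau> b"]) (auto simp: mult.commute)
  qed (auto simp: D_mult_closed D_mult_diff b)
  show "continuous_map D.top D.top (\<lambda>a. D_mult n b a)"
  proof (rule continuous_map_seminorm_bounded[OF D.seminorm_family_axioms D.seminorm_family_axioms])
    show "\<exists>\<rho>' \<tau>' C. (\<rho>', \<tau>') \<in> params r \<and> (\<forall>a\<in>D_carrier n r. D.nrm \<rho> \<tau> (D_mult n b a) \<le> C * D.nrm \<rho>' \<tau>' a)"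
      if "(\<rho>, \<tau>) \<in> params r" for \<rho> \<tau>
      using D_mult_norm[OF that b] that by blast
  qed (auto simp: D_mult_closed D_mult_diff b)
qed

text \<open>The estimate passes through values on the two circles, where the norms of the free
  algebra are submultiplicative. The circles lie in the annulus belonging to
  \<open>2 * \<tau>\<close>, hence the doubled parameter and the factor
  \<open>geom_const\<close>.\<close>

lemma hol_mult_norm:
  assumes f: "f \<in> hol_carrier n r" and g: "g \<in> hol_carrier n r" and p: "(\<rho>, \<tau>) \<in> params r"
  shows "H.nrm \<rho> \<tau> (\<lambda>w. free_mult (f w) (g w)) \<le> H.nrm \<rho> (2 * \<tau>) f * H.nrm \<rho> (2 * \<tau>) g * geom_const"
proof (rule nrm_le_values[OF hol_mult[OF f g] p])
  fix w assume w: "w \<in> two_circles \<tau>"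
  have t: "1 \<le> \<tau>" using paramsD[OF p] by simp
  have nz: "w \<noteq> 0" using w two_circles(2)[OF t] by auto
  have "1 / (2 * \<tau>) \<le> 2 * \<tau>"
  proof -
    have "1 / (2 * \<tau>) \<le> 1" using t by simp
    then show ?thesis using t by linarith
  qed
  then have T: "inverse (2 * \<tau>) \<le> cmod w" "cmod w \<le> 2 * \<tau>"
    using w unfolding two_circles(3) by (auto simp: inverse_eq_divide)
  have "F.nrm \<rho> \<tau> (free_mult (f w) (g w)) \<le> F.nrm \<rho> \<tau> (f w) * F.nrm \<rho> \<tau> (g w)"
    by (intro free_mult_mem hol_value f g nz p)
  also have "\<dots> \<le> H.nrm \<rho> (2 * \<tau>) f * H.nrm \<rho> (2 * \<tau>) g"
    using t by (intro mult_mono value_le_nrm F.N_nonneg H.N_nonneg hol_value f g nz T p params_scale[OF p]) auto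
  finally show "F.nrm \<rho> \<tau> (free_mult (f w) (g w)) \<le> H.nrm \<rho> (2 * \<tau>) f * H.nrm \<rho> (2 * \<tau>) g" .
qed

lemma continuous_hol_mult:
  assumes g: "g \<in> hol_carrier n r"
  shows "continuous_map H.top H.top (\<lambda>f w. free_mult (f w) (g w))"
    "continuous_map H.top H.top (\<lambda>f w. free_mult (g w) (f w))"
proof -
  show "continuous_map H.top H.top (\<lambda>f w. free_mult (f w) (g w))"
  proof (rule continuous_map_seminorm_bounded[OF H.seminorm_family_axioms H.seminorm_family_axioms])
    show "\<exists>\<rho>' \<tau>' C. (\<rho>', \<tau>') \<in> params r \<and>
        (\<forall>f\<in>hol_carrier n r. H.nrm \<rho> \<tau> (\<lambda>w. free_mult (f w) (g w)) \<le> C * H.nrm \<rho>' \<tau>' f)"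
      if p: "(\<rho>, \<tau>) \<in> params r" for \<rho> \<tau>
      using hol_mult_norm[OF _ g p] params_scale[OF p, of "2 * \<tau>"] paramsD[OF p]
      by (intro exI[of _ \<rho>] exI[of _ "2 * \<tau>"] exI[of _ "H.nrm \<rho> (2 * \<tau>) g * geom_const"])
         (auto simp: mult_ac)
  qed (auto simp: hol_mult g free_mult_diff fun_eq_iff)
  show "continuous_map H.top H.top (\<lambda>f w. free_mult (g w) (f w))"
  proof (rule continuous_map_seminorm_bounded[OF H.seminorm_family_axioms H.seminorm_family_axioms])
    show "\<exists>\<rho>' \<tau>' C. (\<rho>', \<tau>') \<in> params r \<and>
        (\<forall>f\<in>hol_carrier n r. H.nrm \<rho> \<tau> (\<lambda>w. free_mult (g w) (f w)) \<le> C * H.nrm \<rho>' \<tau>' f)"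
      if p: "(\<rho>, \<tau>) \<in> params r" for \<rho> \<tau>
      using hol_mult_norm[OF g _ p] params_scale[OF p, of "2 * \<tau>"] paramsD[OF p]
      by (intro exI[of _ \<rho>] exI[of _ "2 * \<tau>"] exI[of _ "H.nrm \<rho> (2 * \<tau>) g * geom_const"])
         (auto simp: mult_ac)
  qed (auto simp: hol_mult g free_mult_diff fun_eq_iff)
qed

section \<open>The projection as a continuous homomorphism\<close>

definition proj :: "(complex \<Rightarrow> free_series) \<Rightarrow> D_series" where
  "proj f = wpush IJ word_index (\<lambda>_. 1) (coef f)"

lemma word_index_mem': "u \<in> IJ \<Longrightarrow> word_index u \<in> D_index n"
  using word_index_mem by (cases u) auto

text \<open>The index keeps the degree and does not increase the exponent of \<tau> that stems from
  \<open>z\<close>; the block factor is at least 1 and only enlarges the right side.\<close>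

lemma D_weight_word_index:
  assumes p: "(\<rho>, \<tau>) \<in> params r" and u: "u \<in> IJ"
  shows "cmod 1 * D_weight n \<rho> \<tau> (word_index u) \<le> 1 * hol_weight \<rho> \<tau> u"
proof -
  obtain \<alpha> q where uq: "u = (\<alpha>, q)" "\<alpha> \<in> words n" using u by auto
  have t: "0 < \<rho>" "1 \<le> \<tau>" using paramsD[OF p] by auto
  have "\<tau> ^ nat \<bar>omega n (fst (word_index u)) (snd (word_index u))\<bar> \<le> \<tau> ^ nat \<bar>q\<bar>"
    using omega_word_index[OF uq(2), of q] t by (intro power_increasing) (auto simp: uq(1))
  also have "\<dots> \<le> \<tau> ^ blocks \<alpha> * \<tau> ^ nat \<bar>q\<bar>" using t by (simp add: mult_le_cancel_right1)
  finally show ?thesis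
    using t word_index_degree[OF uq(2), of q]
    by (simp add: D_weight_def case_prod_unfold hol_weight_def uq(1) word_weight_def mult.assoc mult_left_mono)
qed

lemma proj_bound:
  assumes f: "f \<in> hol_carrier n r"
  shows "proj f \<in> D_carrier n r"
    and "(\<rho>, \<tau>) \<in> params r \<Longrightarrow> D.nrm \<rho> \<tau> (proj f) \<le> H.nrm \<rho> \<tau> f"
    and "(\<lambda>u. coef f u * 1) summable_on {u \<in> IJ. word_index u = j}"
proof -
  note B = wpush_bound[OF H.coord_summable[OF f] word_index_mem' D_weight_word_index D_weight_positive]
  show "proj f \<in> D_carrier n r"
  proof (rule D_carrierI)
    fix u assume u: "u \<notin> D_index n"
    have "{v \<in> IJ. word_index v = u} = {}" using u word_index_mem' by blast
    then show "proj f u = 0" unfolding proj_def wpush_def by (simp only: infsum_empty)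
  next
    fix \<rho> \<tau> assume p: "(\<rho>, \<tau>) \<in> params r"
    show "(\<lambda>u. cmod (proj f u) * D_weight n \<rho> \<tau> u) summable_on D_index n"
      unfolding proj_def by (rule B(1)[OF p _ p _ p])
  qed
  show "D.nrm \<rho> \<tau> (proj f) \<le> H.nrm \<rho> \<tau> f" if p: "(\<rho>, \<tau>) \<in> params r"
    using B(2)[OF p _ p _ p] by (simp add: D.nrm_def H.nrm_def proj_def)
  obtain \<rho> \<tau> where p: "(\<rho>, \<tau>) \<in> params r" using F.params_nonempty by blast
  show "(\<lambda>u. coef f u * 1) summable_on {u \<in> IJ. word_index u = j}"
    by (rule abs_summable_summable, rule B(3)[OF p _ p _ p])
qed

lemma proj_add: "f \<in> hol_carrier n r \<Longrightarrow> g \<in> hol_carrier n r \<Longrightarrow> proj (f + g) = proj f + proj g"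
  unfolding proj_def H.coord_add by (rule wpush_add[OF proj_bound(3) proj_bound(3)])

lemma proj_diff: "f \<in> hol_carrier n r \<Longrightarrow> g \<in> hol_carrier n r \<Longrightarrow> proj (f - g) = proj f - proj g"
  using proj_add[of "f - g" g] by (simp add: H.diff_mem)

lemma proj_hol_mono: "\<alpha> \<in> words n \<Longrightarrow> proj (hol_mono \<alpha> p c) = single (word_index (\<alpha>, p)) c"
  unfolding proj_def coef_hol_mono single_def by (subst wpush_single) auto

lemma continuous_proj: "continuous_map H.top D.top proj"
proof (rule continuous_map_seminorm_bounded[OF H.seminorm_family_axioms D.seminorm_family_axioms])
  show "\<exists>\<rho>' \<tau>' C. (\<rho>', \<tau>') \<in> params r \<and> (\<forall>f\<in>hol_carrier n r. D.nrm \<rho> \<tau> (proj f) \<le> C * H.nrm \<rho>' \<tau>' f)"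
    if p: "(\<rho>, \<tau>) \<in> params r" for \<rho> \<tau>
    using proj_bound(2)[OF _ p] p by (intro exI[of _ \<rho>] exI[of _ \<tau>] exI[of _ 1]) auto
qed (auto simp: proj_bound proj_diff)

text \<open>Scalars act through constant functions, so closure under scalars follows from closure
  under multiplication, both for the carrier and for ideals.\<close>

lemma hol_smult_eq:
  assumes "f \<in> hol_carrier n r"
  shows "(\<lambda>w \<alpha>. c * f w \<alpha>) = (\<lambda>w. free_mult (hol_mono [] 0 c w) (f w))"
proof
  fix w
  have "free_mult 0 0 = 0" by (simp add: free_mult_def fun_eq_iff)
  then show "(\<lambda>\<alpha>. c * f w \<alpha>) = free_mult (hol_mono [] 0 c w) (f w)"
    using hol_zero[OF assms] by (cases "w = 0") (simp_all add: hol_mono_def free_mult_scale free_mult_one zero_fun_def)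
qed

lemma hol_smult_mem: "f \<in> hol_carrier n r \<Longrightarrow> (\<lambda>w \<alpha>. c * f w \<alpha>) \<in> hol_carrier n r"
  unfolding hol_smult_eq by (intro hol_mult hol_mono_mem) auto

lemma proj_smult:
  assumes "f \<in> hol_carrier n r"
  shows "proj (\<lambda>w \<alpha>. c * f w \<alpha>) = (\<lambda>u. c * proj f u)"
proof -
  have "coef (\<lambda>w \<alpha>. c * f w \<alpha>) = (\<lambda>u. c * coef f u)"
    by (auto simp: coef_def fun_eq_iff laurent_coeff_cmult hol_coordinate assms)
  then show ?thesis unfolding proj_def by (intro ext) (simp only: wpush_cmult)
qed

lemma H_induct [consumes 1, case_names closed zero add mono]:
  assumes "f \<in> hol_carrier n r" "closedin H.top {f \<in> hol_carrier n r. P f}" "P 0"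
    and "\<And>f g. f \<in> hol_carrier n r \<Longrightarrow> g \<in> hol_carrier n r \<Longrightarrow> P f \<Longrightarrow> P g \<Longrightarrow> P (f + g)"
    and "\<And>\<alpha> p c. \<alpha> \<in> words n \<Longrightarrow> P (hol_mono \<alpha> p c)"
  shows "P f"
  by (rule H.closed_span_induct[where e = "\<lambda>u c. hol_mono (fst u) (snd u) c" and P = P, OF assms(1)])
     (use assms in \<open>auto simp: hol_mono_mem coef_hol_mono split: if_splits\<close>)

lemma D_induct [consumes 1, case_names closed zero add mono]:
  assumes "a \<in> D_carrier n r" "closedin D.top {a \<in> D_carrier n r. P a}" "P 0"
    and "\<And>a b. a \<in> D_carrier n r \<Longrightarrow> b \<in> D_carrier n r \<Longrightarrow> P a \<Longrightarrow> P b \<Longrightarrow> P (a + b)"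
    and "\<And>u c. u \<in> D_index n \<Longrightarrow> P (single u c)"
  shows "P a"
  by (rule D.closed_span_induct[where e = single and P = P, OF assms(1)])
     (use assms single_D_carrier in \<open>auto simp: single_def\<close>)

lemma closedin_eq_D:
  "continuous_map H.top D.top f \<Longrightarrow> continuous_map H.top D.top g \<Longrightarrow> closedin H.top {x \<in> hol_carrier n r. f x = g x}"
  using closedin_continuous_maps_eq[OF D.Hausdorff_top, of H.top f g] by simp

lemma proj_zero: "proj 0 = 0"
  using proj_diff[OF hol_zero_mem hol_zero_mem] by simp

lemma D_mult_zero: "D_mult n 0 b = 0" "D_mult n b 0 = 0"
  by (simp_all add: D_mult_def case_prod_unfold fun_eq_iff)

text \<open>Both sides are additive and continuous in each factor separately, so density is used
  once per factor: the left factor varies first, against a fixed monomial, and then the right factor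
  against an arbitrary \<open>f\<close>. Two monomials reduce to
  \<open>word_index_append\<close>.\<close>

lemma proj_mult:
  assumes f: "f \<in> hol_carrier n r" and g: "g \<in> hol_carrier n r"
  shows "proj (\<lambda>w. free_mult (f w) (g w)) = D_mult n (proj f) (proj g)"
proof -
  have zero_mult: "(\<lambda>w. free_mult (0 w) (g w)) = 0" "(\<lambda>w. free_mult (g w) (0 w)) = 0" for g
    by (simp_all add: free_mult_def fun_eq_iff)
  have add_mult: "(\<lambda>w. free_mult ((f + f') w) (g w)) = (\<lambda>w. free_mult (f w) (g w)) + (\<lambda>w. free_mult (f' w) (g w))"
    "(\<lambda>w. free_mult (g w) ((f + f') w)) = (\<lambda>w. free_mult (g w) (f w)) + (\<lambda>w. free_mult (g w) (f' w))" for f f' g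
    by (simp_all add: free_mult_add fun_eq_iff)
  have right_mono: "proj (\<lambda>w. free_mult (f w) (hol_mono \<beta> q d w)) = D_mult n (proj f) (proj (hol_mono \<beta> q d))"
    if f: "f \<in> hol_carrier n r" and b: "\<beta> \<in> words n" for f \<beta> q d
    using f
  proof (induction rule: H_induct)
    case closed
    have "continuous_map H.top D.top (proj \<circ> (\<lambda>f w. free_mult (f w) (hol_mono \<beta> q d w)))"
      by (intro continuous_map_compose[OF continuous_hol_mult(1) continuous_proj] hol_mono_mem b)
    moreover have "continuous_map H.top D.top ((\<lambda>a. D_mult n a (proj (hol_mono \<beta> q d))) \<circ> proj)"
      by (intro continuous_map_compose[OF continuous_proj continuous_D_mult(1)] proj_bound hol_mono_mem b)
    ultimately show ?case unfolding o_def by (rule closedin_eq_D)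
  next
    case zero
    then show ?case by (simp only: zero_mult proj_zero D_mult_zero)
  next
    case (add f g)
    note h = hol_mono_mem[OF b, of q d]
    show ?case
      unfolding add_mult proj_add[OF add(1,2)] proj_add[OF hol_mult[OF add(1) h] hol_mult[OF add(2) h]]
        D_mult_add(1)[OF radius_pos proj_bound(1)[OF add(1)] proj_bound(1)[OF add(2)] proj_bound(1)[OF h]] add(3,4) ..
  next
    case (mono \<alpha> p c)
    then show ?case
      using b by (simp add: hol_mono_mult proj_hol_mono words_append D_mult_single word_index_mem word_index_append)
  qed
  show ?thesis
    using g
  proof (induction rule: H_induct)
    case closed
    have "continuous_map H.top D.top (proj \<circ> (\<lambda>g w. free_mult (f w) (g w)))"
      by (intro continuous_map_compose[OF continuous_hol_mult(2) continuous_proj] f)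
    moreover have "continuous_map H.top D.top ((\<lambda>a. D_mult n (proj f) a) \<circ> proj)"
      by (intro continuous_map_compose[OF continuous_proj continuous_D_mult(2)] proj_bound f)
    ultimately show ?case unfolding o_def by (rule closedin_eq_D)
  next
    case zero
    then show ?case by (simp only: zero_mult proj_zero D_mult_zero)
  next
    case (add f' g)
    show ?case
      unfolding add_mult proj_add[OF add(1,2)] proj_add[OF hol_mult[OF f add(1)] hol_mult[OF f add(2)]]
        D_mult_add(2)[OF radius_pos proj_bound(1)[OF add(1)] proj_bound(1)[OF add(2)] proj_bound(1)[OF f]] add(3,4) ..
  next
    case (mono \<alpha> p c)
    then show ?case by (intro right_mono f)
  qed
qed

end

section \<open>The kernel of the projection\<close>

context deformation
begin

section \<open>The continuous linear section\<close>

definition section_index :: "mono_index \<Rightarrow> nat list \<times> int" where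
  "section_index u = (index_word n u, omega n (fst u) (snd u))"

definition sect :: "D_series \<Rightarrow> complex \<Rightarrow> free_series" where
  "sect a = laurent_sum (wpush (D_index n) section_index (\<lambda>_. 1) a)"

lemma section_index_mem: "u \<in> D_index n \<Longrightarrow> section_index u \<in> IJ"
  by (simp add: section_index_def index_word)

text \<open>The degree and the exponent \<open>omega\<close> agree on both sides by the choice of
  the lift. Only the blocks of the chosen word are left, and their bound does not depend on
  \<open>u\<close>, so they cost a constant.\<close>

lemma hol_weight_section_index:
  assumes p: "(\<rho>, \<tau>) \<in> params r" and u: "u \<in> D_index n"
  shows "cmod 1 * hol_weight \<rho> \<tau> (section_index u) \<le> \<tau> ^ (4 * n) * D_weight n \<rho> \<tau> u"
proof -
  have t: "0 < \<rho>" "1 \<le> \<tau>" using paramsD[OF p] by auto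
  have "length (index_word n u) = (\<Sum>i\<in>{1..n}. fst u i)"
    using word_index_degree[OF index_word(1)[OF u], of "omega n (fst u) (snd u)"] index_word(2)[OF u] by simp
  moreover have "\<tau> ^ blocks (index_word n u) \<le> \<tau> ^ (4 * n)"
    using t index_word(3)[OF u] by (intro power_increasing)
  ultimately show ?thesis
    using t by (simp add: hol_weight_def section_index_def word_weight_def D_weight_def case_prod_unfold
        mult_left_mono mult_right_mono mult_ac)
qed

lemma sect_array:
  assumes a: "a \<in> D_carrier n r"
  shows "wpush (D_index n) section_index (\<lambda>_. 1) a \<in> laurent_arrays"
    and "(\<lambda>u. a u * 1) summable_on {u \<in> D_index n. section_index u = j}"
    and "(\<rho>, \<tau>) \<in> params r \<Longrightarrow> H.nrm \<rho> \<tau> (sect a) \<le> \<tau> ^ (4 * n) * D.nrm \<rho> \<tau> a"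
proof -
  note B = wpush_bound[OF D.coord_summable[OF a] section_index_mem hol_weight_section_index hol_weight_pos]
  show mem: "wpush (D_index n) section_index (\<lambda>_. 1) a \<in> laurent_arrays"
    unfolding laurent_arrays_def mem_Collect_eq
  proof (intro conjI allI impI)
    fix v assume v: "v \<notin> IJ"
    have "{u \<in> D_index n. section_index u = v} = {}" using v section_index_mem by blast
    then show "wpush (D_index n) section_index (\<lambda>_. 1) a v = 0" unfolding wpush_def by (simp only: infsum_empty)
  next
    fix \<rho> \<tau> assume p: "(\<rho>, \<tau>) \<in> params r"
    show "(\<lambda>u. cmod (wpush (D_index n) section_index (\<lambda>_. 1) a u) * hol_weight \<rho> \<tau> u) summable_on IJ"
      by (rule B(1)[OF p _ p _ p])
  qed
  show "H.nrm \<rho> \<tau> (sect a) \<le> \<tau> ^ (4 * n) * D.nrm \<rho> \<tau> a" if p: "(\<rho>, \<tau>) \<in> params r"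
    unfolding H.nrm_def D.nrm_def sect_def coef_laurent_sum[OF mem] by (rule B(2)[OF p _ p _ p])
  obtain \<rho> \<tau> where p: "(\<rho>, \<tau>) \<in> params r" using F.params_nonempty by blast
  show "(\<lambda>u. a u * 1) summable_on {u \<in> D_index n. section_index u = j}"
    by (rule abs_summable_summable, rule B(3)[OF p _ p _ p])
qed

lemma sect_mem: "a \<in> D_carrier n r \<Longrightarrow> sect a \<in> hol_carrier n r"
  unfolding sect_def by (intro laurent_sum_mem sect_array)

lemma coef_sect: "a \<in> D_carrier n r \<Longrightarrow> coef (sect a) = wpush (D_index n) section_index (\<lambda>_. 1) a"
  unfolding sect_def by (intro coef_laurent_sum sect_array)

lemma hol_eqI: "f \<in> hol_carrier n r \<Longrightarrow> g \<in> hol_carrier n r \<Longrightarrow> coef f = coef g \<Longrightarrow> f = g"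
  by (metis laurent_sum_coef)

lemma sect_add: "a \<in> D_carrier n r \<Longrightarrow> b \<in> D_carrier n r \<Longrightarrow> sect (a + b) = sect a + sect b"
proof (rule hol_eqI)
  assume a: "a \<in> D_carrier n r" and b: "b \<in> D_carrier n r"
  show "sect (a + b) \<in> hol_carrier n r" "sect a + sect b \<in> hol_carrier n r"
    by (intro sect_mem hol_add D.add_mem a b)+
  show "coef (sect (a + b)) = coef (sect a + sect b)"
    unfolding H.coord_add[OF sect_mem[OF a] sect_mem[OF b]] coef_sect[OF a] coef_sect[OF b]
      coef_sect[OF D.add_mem[OF a b]] by (rule wpush_add[OF sect_array(2)[OF a] sect_array(2)[OF b]])
qed

lemma sect_diff: "a \<in> D_carrier n r \<Longrightarrow> b \<in> D_carrier n r \<Longrightarrow> sect (a - b) = sect a - sect b"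
  using sect_add[of "a - b" b] by (simp add: D.diff_mem)

lemma sect_single:
  "u \<in> D_index n \<Longrightarrow> sect (single u c) = hol_mono (index_word n u) (omega n (fst u) (snd u)) c"
  unfolding sect_def single_def
  by (subst wpush_single) (simp_all add: hol_mono_eq_laurent_sum index_word section_index_def cong: if_cong)

lemma continuous_sect: "continuous_map D.top H.top sect"
proof (rule continuous_map_seminorm_bounded[OF D.seminorm_family_axioms H.seminorm_family_axioms])
  show "\<exists>\<rho>' \<tau>' C. (\<rho>', \<tau>') \<in> params r \<and> (\<forall>a\<in>D_carrier n r. H.nrm \<rho> \<tau> (sect a) \<le> C * D.nrm \<rho>' \<tau>' a)"
    if p: "(\<rho>, \<tau>) \<in> params r" for \<rho> \<tau>
    using sect_array(3)[OF _ p] p by blast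
qed (auto simp: sect_mem sect_diff)

lemma proj_sect:
  assumes "a \<in> D_carrier n r"
  shows "proj (sect a) = a"
  using assms
proof (induction rule: D_induct)
  case closed
  have "continuous_map D.top D.top (proj \<circ> sect)"
    by (rule continuous_map_compose[OF continuous_sect continuous_proj])
  from closedin_continuous_maps_eq[OF D.Hausdorff_top this continuous_map_id] show ?case by simp
next
  case zero
  have "sect 0 = 0" using sect_diff[OF D.zero_mem D.zero_mem] by simp
  then show ?case by (simp only: proj_zero)
next
  case (add a b)
  then show ?case by (simp only: sect_add proj_add sect_mem)
next
  case (mono u c)
  then show ?case by (simp add: sect_single proj_hol_mono index_word)
qed

section \<open>Ring structure and kernel of the projection\<close>

lemma proj_one: "proj (hol_mono [] 0 1) = D_mono 0 0"
proof -
  have "word_index ([], 0) = (0, 0)" by (auto simp: word_index_def)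
  then show ?thesis by (simp add: proj_hol_mono single_def D_mono_def)
qed

lemma proj_zeta: "i \<in> {1..n} \<Longrightarrow> proj (hol_zeta i) = D_x i"
proof -
  assume "i \<in> {1..n}"
  moreover have "word_index ([i], 0) = (unit_index i, 0)" by (auto simp: word_index_def unit_index_def)
  ultimately show ?thesis by (simp add: hol_zeta_eq proj_hol_mono single_def D_mono_def D_x_def)
qed

lemma proj_z: "proj hol_z = D_z"
proof -
  have "word_index ([], 1) = (0, 1)" by (auto simp: word_index_def)
  then show ?thesis by (simp add: hol_z_eq proj_hol_mono single_def D_mono_def D_z_def)
qed

lemma proj_ring_hom: "proj \<in> ring_hom (hol_algebra n r) (D_algebra n r)"
proof (rule ring_hom_memI)
  fix f g assume "f \<in> carrier (hol_algebra n r)" "g \<in> carrier (hol_algebra n r)"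
  then have "f \<in> hol_carrier n r" "g \<in> hol_carrier n r" by (simp_all add: hol_algebra_def)
  note fg = proj_mult[OF this] proj_add[OF this]
  show "proj (f \<otimes>\<^bsub>hol_algebra n r\<^esub> g) = proj f \<otimes>\<^bsub>D_algebra n r\<^esub> proj g"
    using fg(1) by (simp add: hol_algebra_def D_algebra_def)
  show "proj (f \<oplus>\<^bsub>hol_algebra n r\<^esub> g) = proj f \<oplus>\<^bsub>D_algebra n r\<^esub> proj g"
    using fg(2) by (simp add: hol_algebra_def D_algebra_def)
next
  fix f assume "f \<in> carrier (hol_algebra n r)"
  then show "proj f \<in> carrier (D_algebra n r)" using proj_bound(1) by (simp add: hol_algebra_def D_algebra_def)
next
  show "proj \<one>\<^bsub>hol_algebra n r\<^esub> = \<one>\<^bsub>D_algebra n r\<^esub>"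
    by (simp add: hol_algebra_def D_algebra_def hol_one_eq proj_one)
qed

lemma proj_image: "proj ` hol_carrier n r = D_carrier n r"
proof
  show "proj ` hol_carrier n r \<subseteq> D_carrier n r" using proj_bound(1) by blast
  show "D_carrier n r \<subseteq> proj ` hol_carrier n r" using proj_sect sect_mem by (metis image_eqI subsetI)
qed

text \<open>The ring laws, associativity of \<open>D_mult\<close> among them, are inherited from the
  holomorphic functions because the projection is onto.\<close>

lemma ring_D_algebra: "ring (D_algebra n r)"
proof -
  have "ring (D_algebra n r \<lparr> carrier := proj ` carrier (hol_algebra n r), zero := proj \<zero>\<^bsub>hol_algebra n r\<^esub> \<rparr>)"
    by (rule ring.ring_hom_imp_img_ring[OF ring_hol_algebra proj_ring_hom])
  moreover have "proj ` carrier (hol_algebra n r) = carrier (D_algebra n r)" "proj \<zero>\<^bsub>hol_algebra n r\<^esub> = \<zero>\<^bsub>D_algebra n r\<^esub>"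
    by (simp_all add: hol_algebra_def D_algebra_def proj_image proj_zero)
  ultimately show ?thesis by simp
qed

sublocale P: ring_hom_ring "hol_algebra n r" "D_algebra n r" proj
  by (rule ring_hom_ringI2[OF ring_hol_algebra ring_D_algebra proj_ring_hom])

abbreviation "ker_proj \<equiv> a_kernel (hol_algebra n r) (D_algebra n r) proj"

lemma ker_proj_iff: "f \<in> ker_proj \<longleftrightarrow> f \<in> hol_carrier n r \<and> proj f = 0"
  unfolding a_kernel_def' by (simp add: hol_algebra_def D_algebra_def)

lemma def_relation_eq:
  "hol_zeta i \<otimes>\<^bsub>hol_algebra n r\<^esub> hol_zeta j - hol_z \<otimes>\<^bsub>hol_algebra n r\<^esub> (hol_zeta j \<otimes>\<^bsub>hol_algebra n r\<^esub> hol_zeta i)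
    = hol_mono [i, j] 0 1 - hol_mono [j, i] 1 1"
proof -
  have mult: "f \<otimes>\<^bsub>hol_algebra n r\<^esub> g = (\<lambda>w. free_mult (f w) (g w))" for f g
    by (simp add: hol_algebra_def)
  show ?thesis unfolding mult hol_zeta_eq hol_z_eq hol_mono_mult by simp
qed

lemma closedin_ker_proj: "closedin H.top ker_proj"
proof -
  have "continuous_map H.top D.top (\<lambda>_. 0)" by (simp add: D.zero_mem)
  moreover have "{f \<in> hol_carrier n r. proj f = 0} = ker_proj" by (auto simp: ker_proj_iff)
  ultimately show ?thesis using closedin_eq_D[OF continuous_proj, of "\<lambda>_. 0"] by (simp only:)
qed

lemma def_relations_subset: "def_relations n r \<subseteq> ker_proj"
proof
  fix f assume "f \<in> def_relations n r"
  then obtain i j where ij: "1 \<le> i" "i < j" "j \<le> n" "f = hol_mono [i, j] 0 1 - hol_mono [j, i] 1 1"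
    unfolding def_relations_def def_relation_eq by auto
  then have w: "[i, j] \<in> words n" "[j, i] \<in> words n" by auto
  have "word_index ([i, j], 0) = word_index ([j, i], 1)" using ij by (auto simp: word_index_def fun_eq_iff)
  then show "f \<in> ker_proj"
    unfolding ker_proj_iff ij(4) proj_diff[OF hol_mono_mem[OF w(1)] hol_mono_mem[OF w(2)]]
    using w by (simp add: proj_hol_mono H.diff_mem hol_mono_mem)
qed

text \<open>The kernel is itself a closed ideal containing the relations. Thus the intersection that
  defines the ideal runs over a nonempty family and lies in the kernel.\<close>

lemma ideal_def_ideal: "ideal (def_ideal n r) (hol_algebra n r)"
  and def_ideal_subset: "def_ideal n r \<subseteq> ker_proj"
  and closedin_def_ideal: "closedin H.top (def_ideal n r)"
  and def_relations_in: "def_relations n r \<subseteq> def_ideal n r"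
proof -
  let ?S = "{I. ideal I (hol_algebra n r) \<and> closedin (alg_top (hol_algebra n r)) I \<and> def_relations n r \<subseteq> I}"
  have k: "ker_proj \<in> ?S"
    using P.kernel_is_ideal closedin_ker_proj def_relations_subset by (simp add: top_hol_algebra)
  have eq: "def_ideal n r = \<Inter>?S" by (simp add: def_ideal_def closed_ideal_gen_def)
  show "ideal (def_ideal n r) (hol_algebra n r)"
    unfolding eq by (rule ring.i_Intersect[OF ring_hol_algebra]) (use k in auto)
  show "def_ideal n r \<subseteq> ker_proj" unfolding eq using k by blast
  show "closedin H.top (def_ideal n r)"
    unfolding eq by (rule closedin_Inter) (use k in \<open>auto simp: top_hol_algebra\<close>)
  show "def_relations n r \<subseteq> def_ideal n r" unfolding eq by blast
qed

section \<open>Congruences of monomials modulo the closed ideal\<close>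

lemma def_ideal_add: "f \<in> def_ideal n r \<Longrightarrow> g \<in> def_ideal n r \<Longrightarrow> f + g \<in> def_ideal n r"
  using additive_subgroup.a_closed[OF ideal.axioms(1)[OF ideal_def_ideal], of f g] by (simp add: hol_algebra_def)

lemma def_ideal_zero: "0 \<in> def_ideal n r"
  using additive_subgroup.zero_closed[OF ideal.axioms(1)[OF ideal_def_ideal]] by (simp add: hol_algebra_def)

lemma def_ideal_left: "f \<in> def_ideal n r \<Longrightarrow> g \<in> hol_carrier n r \<Longrightarrow> (\<lambda>w. free_mult (g w) (f w)) \<in> def_ideal n r"
  using ideal.I_l_closed[OF ideal_def_ideal, of f g] by (simp add: hol_algebra_def)

lemma def_ideal_right: "f \<in> def_ideal n r \<Longrightarrow> g \<in> hol_carrier n r \<Longrightarrow> (\<lambda>w. free_mult (f w) (g w)) \<in> def_ideal n r"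
  using ideal.I_r_closed[OF ideal_def_ideal, of f g] by (simp add: hol_algebra_def)

lemma hol_mono_diff_left:
  "(\<lambda>w. free_mult (hol_mono \<gamma> s e w) ((hol_mono \<alpha> p c - hol_mono \<beta> q d) w)) =
    hol_mono (\<gamma> @ \<alpha>) (s + p) (e * c) - hol_mono (\<gamma> @ \<beta>) (s + q) (e * d)"
  by (rule ext) (simp only: minus_apply free_mult_diff(2) fun_cong[OF hol_mono_mult])

lemma hol_mono_diff_right:
  "(\<lambda>w. free_mult ((hol_mono \<alpha> p c - hol_mono \<beta> q d) w) (hol_mono \<gamma> s e w)) =
    hol_mono (\<alpha> @ \<gamma>) (p + s) (c * e) - hol_mono (\<beta> @ \<gamma>) (q + s) (d * e)"
  by (rule ext) (simp only: minus_apply free_mult_diff(1) fun_cong[OF hol_mono_mult])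

lemma def_ideal_minus: "f \<in> def_ideal n r \<Longrightarrow> - f \<in> def_ideal n r"
proof -
  assume f: "f \<in> def_ideal n r"
  then have fH: "f \<in> hol_carrier n r" using subsetD[OF def_ideal_subset] unfolding ker_proj_iff by simp
  have "(\<lambda>w. free_mult (hol_mono [] 0 (- 1) w) (f w)) \<in> def_ideal n r"
    by (intro def_ideal_left f hol_mono_mem) simp
  then show ?thesis unfolding hol_smult_eq[OF fH, symmetric] by (simp add: fun_Compl_def)
qed

lemma def_ideal_trans: "f - g \<in> def_ideal n r \<Longrightarrow> g - h \<in> def_ideal n r \<Longrightarrow> f - h \<in> def_ideal n r"
  using def_ideal_add[of "f - g" "g - h"] by simp

lemma def_ideal_sym: "f - g \<in> def_ideal n r \<Longrightarrow> g - f \<in> def_ideal n r"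
  using def_ideal_minus[of "f - g"] by simp

lemma def_ideal_refl: "f = g \<Longrightarrow> f - g \<in> def_ideal n r"
  by (simp only: diff_self def_ideal_zero)

text \<open>For \<open>y < i\<close> the relation equates \<open>y\<close> followed by
  \<open>i\<close> with \<open>z\<close> times \<open>i\<close> followed by \<open>y\<close>. So
  each exchange that moves \<open>i\<close> to the right past a smaller letter lowers the exponent
  of \<open>z\<close> by one.\<close>

lemma insort_congruent:
  assumes "i \<in> {1..n}" "xs \<in> words n" "sorted xs"
  shows "hol_mono (i # xs) p c - hol_mono (insort i xs) (p - int (length (filter (\<lambda>j. j < i) xs))) c \<in> def_ideal n r"
  using assms(2,3)
proof (induction xs arbitrary: p)
  case Nil
  show ?case by (rule def_ideal_refl) simp
next
  case (Cons y ys)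
  show ?case
  proof (cases "i \<le> y")
    case True
    then have "\<forall>j\<in>set (y # ys). \<not> j < i" using Cons.prems by auto
    then have "filter (\<lambda>j. j < i) (y # ys) = []" by (simp only: filter_empty_conv)
    then show ?thesis using True by (intro def_ideal_refl) simp
  next
    case False
    have y: "y \<in> {1..n}" "ys \<in> words n" "sorted ys" using Cons.prems by auto
    have "hol_mono [y, i] 0 1 - hol_mono [i, y] 1 1 \<in> def_relations n r"
      unfolding def_relations_def def_relation_eq
      by (intro CollectI exI[of _ y] exI[of _ i] conjI refl) (use False y assms(1) in auto)
    then have rel: "hol_mono [y, i] 0 1 - hol_mono [i, y] 1 1 \<in> def_ideal n r" using def_relations_in by blast
    \<comment> \<open>The relation is multiplied on the left by \<open>c\<close> times
      \<open>z\<close> to the power \<open>p - 1\<close>, and on the right by the rest of the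
      word.\<close>
    have "hol_mono [] (p - 1) c \<in> hol_carrier n r" "hol_mono ys 0 1 \<in> hol_carrier n r"
      using y by (simp_all add: hol_mono_mem)
    note h = this
    have "hol_mono [y, i] (p - 1) c - hol_mono [i, y] p c \<in> def_ideal n r"
      using def_ideal_left[OF rel h(1)] unfolding hol_mono_diff_left by simp
    from def_ideal_right[OF this h(2)]
    have "hol_mono (y # i # ys) (p - 1) c - hol_mono (i # y # ys) p c \<in> def_ideal n r"
      unfolding hol_mono_diff_right by simp
    then have 1: "hol_mono (i # y # ys) p c - hol_mono (y # i # ys) (p - 1) c \<in> def_ideal n r"
      by (rule def_ideal_sym)
    have "hol_mono [y] 0 1 \<in> hol_carrier n r" using y by (simp add: hol_mono_mem)
    from def_ideal_left[OF Cons.IH[OF y(2,3), of "p - 1"] this]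
    have "hol_mono (y # i # ys) (p - 1) c -
        hol_mono (y # insort i ys) (p - 1 - int (length (filter (\<lambda>j. j < i) ys))) c \<in> def_ideal n r"
      unfolding hol_mono_diff_left by simp
    moreover have "hol_mono (y # insort i ys) (p - 1 - int (length (filter (\<lambda>j. j < i) ys))) c =
        hol_mono (insort i (y # ys)) (p - int (length (filter (\<lambda>j. j < i) (y # ys)))) c"
      using False by (simp add: algebra_simps)
    ultimately show ?thesis using def_ideal_trans[OF 1] by (simp only:)
  qed
qed

text \<open>Insertion sort: putting \<open>i\<close> into the sorted tail takes one exchange per
  smaller letter, which is exactly the summand of \<open>i\<close> in
  \<open>inversions\<close>.\<close>

lemma sort_congruent:
  assumes "\<alpha> \<in> words n"
  shows "hol_mono \<alpha> p c - hol_mono (sort \<alpha>) (p - int (inversions \<alpha>)) c \<in> def_ideal n r"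
  using assms
proof (induction \<alpha> arbitrary: p)
  case Nil
  show ?case by (rule def_ideal_refl) simp
next
  case (Cons i \<alpha>)
  then have i: "i \<in> {1..n}" "\<alpha> \<in> words n" by auto
  have s: "sort \<alpha> \<in> words n" using i by (simp add: words_def)
  have "hol_mono [i] 0 1 \<in> hol_carrier n r" using i by (simp add: hol_mono_mem)
  from def_ideal_left[OF Cons.IH[OF i(2)] this]
  have 1: "hol_mono (i # \<alpha>) p c - hol_mono (i # sort \<alpha>) (p - int (inversions \<alpha>)) c \<in> def_ideal n r"
    unfolding hol_mono_diff_left by simp
  have "length (filter (\<lambda>j. j < i) (sort \<alpha>)) = length (filter (\<lambda>j. j < i) \<alpha>)"
    by (simp add: filter_sort)
  then have eq: "hol_mono (insort i (sort \<alpha>))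
      (p - int (inversions \<alpha>) - int (length (filter (\<lambda>j. j < i) (sort \<alpha>)))) c =
      hol_mono (sort (i # \<alpha>)) (p - int (inversions (i # \<alpha>))) c"
    by (simp add: algebra_simps)
  have "sorted (sort \<alpha>)" by simp
  from def_ideal_trans[OF 1 insort_congruent[OF i(1) s this]] show ?case by (simp only: eq)
qed

text \<open>Words of equal content have the same sorted form, and equality of the second components
  says that the exponents of \<open>z\<close> agree after sorting.\<close>

lemma word_index_congruent:
  assumes "\<alpha> \<in> words n" "\<beta> \<in> words n" "word_index (\<alpha>, p) = word_index (\<beta>, q)"
  shows "hol_mono \<alpha> p c - hol_mono \<beta> q c \<in> def_ideal n r"
proof -
  have eq: "count_list \<alpha> = count_list \<beta>" "p - int (inversions \<alpha>) = q - int (inversions \<beta>)"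
    using assms(3) by (auto simp: word_index_def)
  have "mset \<alpha> = mset \<beta>" using eq(1) by (simp add: multiset_eq_iff count_mset)
  then have "sort \<alpha> = sort \<beta>" by (intro properties_for_sort) auto
  then have "hol_mono (sort \<alpha>) (p - int (inversions \<alpha>)) c = hol_mono (sort \<beta>) (q - int (inversions \<beta>)) c"
    using eq(2) by simp
  with sort_congruent[OF assms(1), of p c]
  have "hol_mono \<alpha> p c - hol_mono (sort \<beta>) (q - int (inversions \<beta>)) c \<in> def_ideal n r" by (simp only:)
  then show ?thesis by (rule def_ideal_trans[OF _ def_ideal_sym[OF sort_congruent[OF assms(2)]]])
qed

lemma section_congruent:
  assumes "f \<in> hol_carrier n r"
  shows "f - sect (proj f) \<in> def_ideal n r"
  using assms
proof (induction rule: H_induct)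
  case closed
  \<comment> \<open>Closedness of the ideal enters here: the functions with the desired property
    form its preimage under a continuous map.\<close>
  have "continuous_map H.top H.top (\<lambda>f. f - sect (proj f))"
  proof (rule continuous_map_seminorm_bounded[OF H.seminorm_family_axioms H.seminorm_family_axioms])
    fix \<rho> \<tau> assume p: "(\<rho>, \<tau>) \<in> params r"
    have "H.nrm \<rho> \<tau> (f - sect (proj f)) \<le> (1 + \<tau> ^ (4 * n)) * H.nrm \<rho> \<tau> f" if f: "f \<in> hol_carrier n r" for f
    proof -
      have s: "sect (proj f) \<in> hol_carrier n r" by (intro sect_mem proj_bound f)
      have "H.nrm \<rho> \<tau> (f - sect (proj f)) \<le> H.nrm \<rho> \<tau> f + H.nrm \<rho> \<tau> (sect (proj f))"
        using H.N_add[OF p f H.minus_mem[OF s]] by (simp add: H.N_minus[OF s])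
      also have "H.nrm \<rho> \<tau> (sect (proj f)) \<le> \<tau> ^ (4 * n) * D.nrm \<rho> \<tau> (proj f)"
        by (intro sect_array p proj_bound f)
      also have "\<dots> \<le> \<tau> ^ (4 * n) * H.nrm \<rho> \<tau> f"
        using paramsD[OF p] by (intro mult_left_mono proj_bound f p) auto
      finally show ?thesis by (simp add: distrib_right)
    qed
    then show "\<exists>\<rho>' \<tau>' C. (\<rho>', \<tau>') \<in> params r \<and>
        (\<forall>f\<in>hol_carrier n r. H.nrm \<rho> \<tau> (f - sect (proj f)) \<le> C * H.nrm \<rho>' \<tau>' f)"
      using p by blast
  qed (auto simp: H.diff_mem sect_mem proj_bound proj_diff sect_diff)
  from closedin_continuous_map_preimage[OF this closedin_def_ideal] show ?case
    by (simp only: topspace_seminorm_topology)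
next
  case zero
  have "sect 0 = 0" using sect_diff[OF D.zero_mem D.zero_mem] by simp
  show ?case unfolding proj_zero \<open>sect 0 = 0\<close> by (rule def_ideal_refl) (rule refl)
next
  case (add f g)
  have "f + g - sect (proj (f + g)) = (f - sect (proj f)) + (g - sect (proj g))"
    unfolding proj_add[OF add(1,2)] sect_add[OF proj_bound(1)[OF add(1)] proj_bound(1)[OF add(2)]] by simp
  then show ?case using def_ideal_add[OF add(3,4)] by (simp only:)
next
  case (mono \<alpha> p c)
  have u: "word_index (\<alpha>, p) \<in> D_index n" using word_index_mem mono by blast
  show ?case
    unfolding proj_hol_mono[OF mono] sect_single[OF u]
    by (rule word_index_congruent[OF mono index_word(1)[OF u]]) (simp add: index_word(2)[OF u])
qed

lemma def_ideal_eq: "def_ideal n r = ker_proj"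
proof
  show "ker_proj \<subseteq> def_ideal n r"
  proof
    fix f assume "f \<in> ker_proj"
    then have f: "f \<in> hol_carrier n r" "proj f = 0" by (auto simp: ker_proj_iff)
    have "sect 0 = 0" using sect_diff[OF D.zero_mem D.zero_mem] by simp
    then show "f \<in> def_ideal n r" using section_congruent[OF f(1)] f(2) by simp
  qed
qed (rule def_ideal_subset)

end

section \<open>The isomorphism\<close>

context deformation
begin

section \<open>Classes modulo the ideal and the induced map\<close>

abbreviation "cls \<equiv> O_def_class n r"

lemma carrier_O_def: "carrier (O_def_algebra n r) = cls ` hol_carrier n r"
  by (auto simp: O_def_algebra_def quot_algebra_def FactRing_def A_RCOSETS_def' O_def_class_def hol_algebra_def)

lemma cls_ring_hom: "cls \<in> ring_hom (hol_algebra n r) (O_def_algebra n r)"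
proof -
  have "(\<lambda>f. def_ideal n r +>\<^bsub>hol_algebra n r\<^esub> f) \<in> ring_hom (hol_algebra n r) (hol_algebra n r Quot def_ideal n r)"
    by (rule ideal.rcos_ring_hom[OF ideal_def_ideal])
  then show ?thesis
    by (simp add: ring_hom_def O_def_algebra_def quot_algebra_def O_def_class_def[abs_def])
qed

lemma mem_cls: "x \<in> cls f \<longleftrightarrow> (\<exists>h\<in>def_ideal n r. x = h + f)"
  by (auto simp: O_def_class_def a_r_coset_def' hol_algebra_def)

lemma cls_self: "f \<in> cls f"
  using def_ideal_zero unfolding mem_cls by (intro bexI[of _ 0]) simp_all

lemma cls_memD:
  assumes "x \<in> cls f" "f \<in> hol_carrier n r"
  shows "x \<in> hol_carrier n r" "proj x = proj f"
proof -
  obtain h where h: "h \<in> hol_carrier n r" "proj h = 0" "x = h + f"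
    using assms(1) unfolding mem_cls def_ideal_eq Bex_def ker_proj_iff by blast
  show "x \<in> hol_carrier n r" using hol_add[OF h(1) assms(2)] by (simp only: h(3))
  show "proj x = proj f" unfolding h(3) proj_add[OF h(1) assms(2)] h(2) by simp
qed

lemma the_elem_cls: "f \<in> hol_carrier n r \<Longrightarrow> the_elem (proj ` cls f) = proj f"
proof -
  assume f: "f \<in> hol_carrier n r"
  have "proj ` cls f = {proj f}"
  proof
    show "proj ` cls f \<subseteq> {proj f}" using cls_memD(2)[OF _ f] by blast
    show "{proj f} \<subseteq> proj ` cls f" using cls_self by blast
  qed
  then show ?thesis by simp
qed

text \<open>The cosets are the fibres of the projection, because the ideal is its kernel.\<close>

lemma cls_eqI:
  assumes f: "f \<in> hol_carrier n r" and g: "g \<in> hol_carrier n r" and eq: "proj f = proj g"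
  shows "cls f = cls g"
proof -
  have *: "cls f \<subseteq> cls g" if f: "f \<in> hol_carrier n r" and g: "g \<in> hol_carrier n r" and eq: "proj f = proj g" for f g
  proof
    fix x assume "x \<in> cls f"
    then have x: "x \<in> hol_carrier n r" "proj x = proj g" using cls_memD[OF _ f] eq by simp_all
    have "x - g \<in> def_ideal n r"
      unfolding def_ideal_eq ker_proj_iff using H.diff_mem[OF x(1) g] proj_diff[OF x(1) g] x(2) by simp
    moreover have "x = (x - g) + g" by simp
    ultimately show "x \<in> cls g" unfolding mem_cls by blast
  qed
  show ?thesis using *[OF f g eq] *[OF g f eq[symmetric]] by (rule subset_antisym)
qed

lemma cls_smult:
  assumes f: "f \<in> hol_carrier n r"
  shows "c \<odot>\<^bsub>O_def_algebra n r\<^esub> cls f = cls (\<lambda>w \<alpha>. c * f w \<alpha>)"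
proof -
  have "c \<odot>\<^bsub>O_def_algebra n r\<^esub> cls f = (\<Union>x\<in>cls f. cls (\<lambda>w \<alpha>. c * x w \<alpha>))"
    by (simp add: O_def_algebra_def quot_algebra_def O_def_class_def hol_algebra_def)
  \<comment> \<open>The quotient multiplies every representative by the scalar; the resulting cosets
    all coincide, so their union is a single coset.\<close>
  also have "\<dots> = (\<Union>x\<in>cls f. cls (\<lambda>w \<alpha>. c * f w \<alpha>))"
  proof (rule SUP_cong)
    fix x assume "x \<in> cls f"
    note x = cls_memD[OF this f]
    show "cls (\<lambda>w \<alpha>. c * x w \<alpha>) = cls (\<lambda>w \<alpha>. c * f w \<alpha>)"
      by (rule cls_eqI) (simp_all only: hol_smult_mem x f proj_smult)
  qed simp
  also have "\<dots> = cls (\<lambda>w \<alpha>. c * f w \<alpha>)" using cls_self by blast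
  finally show ?thesis .
qed

text \<open>Outside the carrier a total function would be arbitrary; \<open>restrict\<close> makes
  it extensional, the form in which uniqueness can be asserted. \<open>the_elem\<close> picks the
  common value of the projection on a class.\<close>

definition class_iso :: "(complex \<Rightarrow> free_series) set \<Rightarrow> D_series" where
  "class_iso = restrict (\<lambda>X. the_elem (proj ` X)) (carrier (O_def_algebra n r))"

lemma class_iso_class: "f \<in> hol_carrier n r \<Longrightarrow> class_iso (cls f) = proj f"
  by (simp add: class_iso_def carrier_O_def the_elem_cls)

lemma openin_O_def:
  "openin (alg_top (O_def_algebra n r)) U \<longleftrightarrow>
    U \<subseteq> carrier (O_def_algebra n r) \<and> openin H.top {f \<in> hol_carrier n r. cls f \<in> U}"
proof -
  have "alg_top (O_def_algebra n r) = quot_topology (hol_algebra n r) (def_ideal n r)"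
    "carrier (hol_algebra n r Quot def_ideal n r) = carrier (O_def_algebra n r)"
    "carrier (hol_algebra n r) = hol_carrier n r"
    by (simp_all add: O_def_algebra_def quot_algebra_def hol_algebra_def)
  then show ?thesis by (simp only: openin_quot_topology top_hol_algebra O_def_class_def)
qed

lemma topspace_O_def: "topspace (alg_top (O_def_algebra n r)) = carrier (O_def_algebra n r)"
proof
  show "topspace (alg_top (O_def_algebra n r)) \<subseteq> carrier (O_def_algebra n r)"
    using openin_O_def openin_topspace by blast
  have "{f \<in> hol_carrier n r. cls f \<in> carrier (O_def_algebra n r)} = topspace H.top"
    by (auto simp: carrier_O_def)
  then have "openin H.top {f \<in> hol_carrier n r. cls f \<in> carrier (O_def_algebra n r)}"
    by (simp only: openin_topspace)
  then have "openin (alg_top (O_def_algebra n r)) (carrier (O_def_algebra n r))"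
    by (simp add: openin_O_def)
  then show "carrier (O_def_algebra n r) \<subseteq> topspace (alg_top (O_def_algebra n r))" by (rule openin_subset)
qed

lemma continuous_cls: "continuous_map H.top (alg_top (O_def_algebra n r)) cls"
  by (auto simp: continuous_map_def openin_O_def topspace_O_def carrier_O_def)

text \<open>The inverse is \<open>cls \<circ> sect\<close>, which is continuous because the section
  is. Continuity of the map itself is the universal property of the quotient topology.\<close>

lemma top_algebra_iso_class_iso: "top_algebra_iso (O_def_algebra n r) (D_algebra n r) class_iso"
  unfolding top_algebra_iso_def
proof (intro conjI allI ballI)
  have ops: "f \<otimes>\<^bsub>hol_algebra n r\<^esub> g \<in> hol_carrier n r" "f \<oplus>\<^bsub>hol_algebra n r\<^esub> g \<in> hol_carrier n r"
    if "f \<in> hol_carrier n r" "g \<in> hol_carrier n r" for f g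
    using hol_mult[OF that] hol_add[OF that] by (simp_all add: hol_algebra_def)
  have H: "carrier (hol_algebra n r) = hol_carrier n r" by (simp add: hol_algebra_def)
  have D: "carrier (D_algebra n r) = D_carrier n r" by (simp add: D_algebra_def)
  have hom: "class_iso \<in> ring_hom (O_def_algebra n r) (D_algebra n r)"
  proof (rule ring_hom_memI)
    fix X assume "X \<in> carrier (O_def_algebra n r)"
    then obtain f where f: "X = cls f" "f \<in> hol_carrier n r" by (auto simp: carrier_O_def)
    show "class_iso X \<in> carrier (D_algebra n r)" unfolding f(1) class_iso_class[OF f(2)] D by (rule proj_bound(1)[OF f(2)])
    fix Y assume "Y \<in> carrier (O_def_algebra n r)"
    then obtain g where g: "Y = cls g" "g \<in> hol_carrier n r" by (auto simp: carrier_O_def)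
    have fg: "f \<in> carrier (hol_algebra n r)" "g \<in> carrier (hol_algebra n r)" using f g H by auto
    show "class_iso (X \<otimes>\<^bsub>O_def_algebra n r\<^esub> Y) = class_iso X \<otimes>\<^bsub>D_algebra n r\<^esub> class_iso Y"
      unfolding f(1) g(1) ring_hom_mult[OF cls_ring_hom fg, symmetric] class_iso_class[OF f(2)] class_iso_class[OF g(2)]
        class_iso_class[OF ops(1)[OF f(2) g(2)]] by (rule ring_hom_mult[OF proj_ring_hom fg])
    show "class_iso (X \<oplus>\<^bsub>O_def_algebra n r\<^esub> Y) = class_iso X \<oplus>\<^bsub>D_algebra n r\<^esub> class_iso Y"
      unfolding f(1) g(1) ring_hom_add[OF cls_ring_hom fg, symmetric] class_iso_class[OF f(2)] class_iso_class[OF g(2)]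
        class_iso_class[OF ops(2)[OF f(2) g(2)]] by (rule ring_hom_add[OF proj_ring_hom fg])
  next
    have "\<one>\<^bsub>hol_algebra n r\<^esub> \<in> hol_carrier n r" by (simp add: hol_algebra_def hol_one_eq hol_mono_mem)
    then show "class_iso \<one>\<^bsub>O_def_algebra n r\<^esub> = \<one>\<^bsub>D_algebra n r\<^esub>"
      unfolding ring_hom_one[OF cls_ring_hom, symmetric] ring_hom_one[OF proj_ring_hom, symmetric] by (rule class_iso_class)
  qed
  have inv1: "cls (sect (class_iso X)) = X" if X: "X \<in> carrier (O_def_algebra n r)" for X
  proof -
    obtain f where f: "X = cls f" "f \<in> hol_carrier n r" using X by (auto simp: carrier_O_def)
    show ?thesis
      unfolding f(1) class_iso_class[OF f(2)]
      by (rule cls_eqI[OF sect_mem[OF proj_bound(1)[OF f(2)]] f(2) proj_sect[OF proj_bound(1)[OF f(2)]]])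
  qed
  have inv2: "class_iso (cls (sect a)) = a" if "a \<in> D_carrier n r" for a
    by (simp add: class_iso_class sect_mem proj_sect that)
  have class_iso_mem: "class_iso X \<in> D_carrier n r" if "X \<in> carrier (O_def_algebra n r)" for X
    using ring_hom_closed[OF hom that] D by simp
  have cls_mem: "cls (sect a) \<in> carrier (O_def_algebra n r)" if "a \<in> D_carrier n r" for a
    unfolding carrier_O_def by (intro imageI sect_mem that)
  have "bij_betw class_iso (carrier (O_def_algebra n r)) (carrier (D_algebra n r))"
    unfolding D by (rule bij_betwI[where g = "cls \<circ> sect"]) (use inv1 inv2 class_iso_mem cls_mem in auto)
  with hom show "class_iso \<in> ring_iso (O_def_algebra n r) (D_algebra n r)" by (simp add: ring_iso_def)
  show "class_iso (c \<odot>\<^bsub>O_def_algebra n r\<^esub> X) = c \<odot>\<^bsub>D_algebra n r\<^esub> class_iso X"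
    if X: "X \<in> carrier (O_def_algebra n r)" for c X
  proof -
    obtain f where f: "X = cls f" "f \<in> hol_carrier n r" using X by (auto simp: carrier_O_def)
    show ?thesis
      unfolding f(1) cls_smult[OF f(2)] class_iso_class[OF f(2)] class_iso_class[OF hol_smult_mem[OF f(2)]] proj_smult[OF f(2)]
      by (simp add: D_algebra_def)
  qed
  have cont1: "continuous_map (alg_top (O_def_algebra n r)) D.top class_iso"
    unfolding continuous_map_def
  proof (intro conjI allI impI)
    show "class_iso \<in> topspace (alg_top (O_def_algebra n r)) \<rightarrow> topspace D.top"
      using class_iso_mem by (auto simp: topspace_O_def)
    fix U assume "openin D.top U"
    then have "openin H.top {f \<in> hol_carrier n r. proj f \<in> U}"
      using continuous_proj by (simp add: continuous_map_def)
    moreover have "{f \<in> hol_carrier n r. cls f \<in> {X \<in> carrier (O_def_algebra n r). class_iso X \<in> U}} =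
        {f \<in> hol_carrier n r. proj f \<in> U}"
      by (auto simp: carrier_O_def class_iso_class)
    ultimately show "openin (alg_top (O_def_algebra n r)) {X \<in> topspace (alg_top (O_def_algebra n r)). class_iso X \<in> U}"
      unfolding openin_O_def topspace_O_def by auto
  qed
  have cont2: "continuous_map D.top (alg_top (O_def_algebra n r)) (cls \<circ> sect)"
    by (rule continuous_map_compose[OF continuous_sect continuous_cls])
  have "homeomorphic_maps (alg_top (O_def_algebra n r)) D.top class_iso (cls \<circ> sect)"
    unfolding homeomorphic_maps_def using cont1 cont2 inv1 inv2 by (simp add: topspace_O_def)
  then show "homeomorphic_map (alg_top (O_def_algebra n r)) (alg_top (D_algebra n r)) class_iso"
    unfolding top_D_algebra homeomorphic_map_maps by blast
qed

text \<open>Uniqueness is proved on the holomorphic functions, before passing to classes, because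
  density of the linear combinations of monomials is available there. The prescribed values
  determine the homomorphism on monomials, continuity on the rest.\<close>

lemma ring_homs_agree:
  assumes hom: "T \<in> ring_hom (hol_algebra n r) (D_algebra n r)"
    and smult: "\<And>c f. f \<in> hol_carrier n r \<Longrightarrow> T (\<lambda>w \<alpha>. c * f w \<alpha>) = (\<lambda>u. c * T f u)"
    and cont: "continuous_map H.top D.top T"
    and z: "T hol_z = D_z" and x: "\<And>i. i \<in> {1..n} \<Longrightarrow> T (hol_zeta i) = D_x i"
    and f: "f \<in> hol_carrier n r"
  shows "T f = proj f"
proof -
  have D: "Group.monoid (D_algebra n r)" using ring_D_algebra by (rule ring.is_monoid)
  have H: "carrier (hol_algebra n r) = hol_carrier n r" by (simp add: hol_algebra_def)
  have mult: "f \<otimes>\<^bsub>hol_algebra n r\<^esub> g = (\<lambda>w. free_mult (f w) (g w))" for f g by (simp add: hol_algebra_def)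
  have one: "\<one>\<^bsub>hol_algebra n r\<^esub> = hol_mono [] 0 1" by (simp add: hol_algebra_def hol_one_eq)
  have step: "T (hol_mono (\<alpha> @ \<beta>) (p + q) 1) = proj (hol_mono (\<alpha> @ \<beta>) (p + q) 1)"
    if ab: "\<alpha> \<in> words n" "\<beta> \<in> words n" "T (hol_mono \<alpha> p 1) = proj (hol_mono \<alpha> p 1)"
      "T (hol_mono \<beta> q 1) = proj (hol_mono \<beta> q 1)" for \<alpha> \<beta> p q
  proof -
    have m: "hol_mono \<alpha> p 1 \<in> carrier (hol_algebra n r)" "hol_mono \<beta> q 1 \<in> carrier (hol_algebra n r)"
      using ab by (simp_all add: H hol_mono_mem)
    have e: "hol_mono (\<alpha> @ \<beta>) (p + q) 1 = hol_mono \<alpha> p 1 \<otimes>\<^bsub>hol_algebra n r\<^esub> hol_mono \<beta> q 1"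
      unfolding mult hol_mono_mult by simp
    show ?thesis unfolding e ring_hom_mult[OF hom m] ring_hom_mult[OF proj_ring_hom m] ab(3,4) ..
  qed
  have one': "T (hol_mono [] 0 1) = proj (hol_mono [] 0 1)"
    using ring_hom_one[OF hom] ring_hom_one[OF proj_ring_hom] by (simp add: one)
  have z': "T (hol_mono [] 1 1) = proj (hol_mono [] 1 1)" using z proj_z by (simp add: hol_z_eq)
  \<comment> \<open>The inverse of \<open>z\<close> is not among the prescribed values. Its images
    under \<open>T\<close> and \<open>proj\<close> are a left and a right inverse of the same
    element \<open>T ?z\<close>, hence equal.\<close>
  have zi: "T (hol_mono [] (-1) 1) = proj (hol_mono [] (-1) 1)"
  proof -
    let ?z = "hol_mono [] 1 1" and ?y = "hol_mono [] (-1) 1"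
    have m: "?z \<in> carrier (hol_algebra n r)" "?y \<in> carrier (hol_algebra n r)" by (simp_all add: H hol_mono_mem)
    have e: "?z \<otimes>\<^bsub>hol_algebra n r\<^esub> ?y = \<one>\<^bsub>hol_algebra n r\<^esub>" "?y \<otimes>\<^bsub>hol_algebra n r\<^esub> ?z = \<one>\<^bsub>hol_algebra n r\<^esub>"
      unfolding mult hol_mono_mult one by simp_all
    have c: "T ?y \<in> carrier (D_algebra n r)" "proj ?y \<in> carrier (D_algebra n r)" "T ?z \<in> carrier (D_algebra n r)"
      using ring_hom_closed[OF hom] ring_hom_closed[OF proj_ring_hom] m by blast+
    have 1: "T ?y \<otimes>\<^bsub>D_algebra n r\<^esub> T ?z = \<one>\<^bsub>D_algebra n r\<^esub>"
      using ring_hom_mult[OF hom m(2,1)] ring_hom_one[OF hom] by (simp only: e)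
    have 2: "T ?z \<otimes>\<^bsub>D_algebra n r\<^esub> proj ?y = \<one>\<^bsub>D_algebra n r\<^esub>"
      using ring_hom_mult[OF proj_ring_hom m] ring_hom_one[OF proj_ring_hom] by (simp only: e z')
    show ?thesis
      using monoid.m_assoc[OF D c(1,3,2)] monoid.l_one[OF D c(2)] monoid.r_one[OF D c(1)] by (simp only: 1 2)
  qed
  have pos: "T (hol_mono [] (int m) 1) = proj (hol_mono [] (int m) 1)" for m
  proof (induction m)
    case (Suc m)
    then show ?case using step[of "[]" "[]" "int m" 1] z' by (simp add: add.commute)
  qed (simp add: one')
  have neg: "T (hol_mono [] (- int m) 1) = proj (hol_mono [] (- int m) 1)" for m
  proof (induction m)
    case (Suc m)
    then show ?case using step[of "[]" "[]" "-1" "- int m"] zi by simp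
  qed (simp add: one')
  have powers: "T (hol_mono [] p 1) = proj (hol_mono [] p 1)" for p
    using pos[of "nat p"] neg[of "nat (- p)"] by (cases "p \<ge> 0") simp_all
  have words: "T (hol_mono \<alpha> 0 1) = proj (hol_mono \<alpha> 0 1)" if "\<alpha> \<in> words n" for \<alpha>
    using that
  proof (induction \<alpha>)
    case (Cons i \<alpha>)
    then have i: "i \<in> {1..n}" "\<alpha> \<in> words n" by auto
    have "T (hol_mono [i] 0 1) = proj (hol_mono [i] 0 1)"
      using x[OF i(1)] proj_zeta[OF i(1)] by (simp only: hol_zeta_eq)
    then show ?case using step[of "[i]" \<alpha> 0 0] Cons i by simp
  qed (simp add: one')
  show ?thesis
    using f
  proof (induction rule: H_induct)
    case closed
    show ?case by (rule closedin_eq_D[OF cont continuous_proj])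
  next
    case zero
    have "T \<zero>\<^bsub>hol_algebra n r\<^esub> = \<zero>\<^bsub>D_algebra n r\<^esub>"
      by (rule ring_hom_zero[OF hom ring_hol_algebra ring_D_algebra])
    then have "T 0 = 0" by (simp add: hol_algebra_def D_algebra_def)
    then show ?case unfolding proj_zero .
  next
    case (add f g)
    have "T (f \<oplus>\<^bsub>hol_algebra n r\<^esub> g) = T f \<oplus>\<^bsub>D_algebra n r\<^esub> T g"
      by (rule ring_hom_add[OF hom]) (use add H in auto)
    then have "T (f + g) = T f + T g" by (simp add: hol_algebra_def D_algebra_def)
    then show ?case unfolding proj_add[OF add(1,2)] add(3,4) .
  next
    case (mono \<alpha> p c)
    have 1: "T (hol_mono \<alpha> p 1) = proj (hol_mono \<alpha> p 1)"
      using step[OF mono words_Nil words[OF mono] powers[of p]] by simp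
    have e: "hol_mono \<alpha> p c = (\<lambda>w \<beta>. c * hol_mono \<alpha> p 1 w \<beta>)" by (auto simp: hol_mono_def fun_eq_iff)
    have m: "hol_mono \<alpha> p 1 \<in> hol_carrier n r" using mono by (rule hol_mono_mem)
    show ?case unfolding e smult[OF m] proj_smult[OF m] 1 ..
  qed
qed

lemma class_iso_unique:
  assumes ext: "\<phi> \<in> extensional (carrier (O_def_algebra n r))"
    and top: "top_algebra_iso (O_def_algebra n r) (D_algebra n r) \<phi>"
    and z: "\<phi> (cls hol_z) = D_z" and x: "\<forall>i\<in>{1..n}. \<phi> (cls (hol_zeta i)) = D_x i"
  shows "\<phi> = class_iso"
proof (rule extensionalityI[OF ext])
  show "class_iso \<in> extensional (carrier (O_def_algebra n r))" by (simp add: class_iso_def)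
  fix X assume "X \<in> carrier (O_def_algebra n r)"
  then obtain f where f: "X = cls f" "f \<in> hol_carrier n r" by (auto simp: carrier_O_def)
  have hom: "\<phi> \<in> ring_hom (O_def_algebra n r) (D_algebra n r)"
    using top by (simp add: top_algebra_iso_def ring_iso_def)
  have "(\<phi> \<circ> cls) f = proj f"
  proof (rule ring_homs_agree)
    show "\<phi> \<circ> cls \<in> ring_hom (hol_algebra n r) (D_algebra n r)"
      by (rule ring_hom_trans[OF cls_ring_hom hom])
    show "(\<phi> \<circ> cls) (\<lambda>w \<alpha>. c * g w \<alpha>) = (\<lambda>u. c * (\<phi> \<circ> cls) g u)" if g: "g \<in> hol_carrier n r" for c g
    proof -
      have "\<phi> (c \<odot>\<^bsub>O_def_algebra n r\<^esub> cls g) = c \<odot>\<^bsub>D_algebra n r\<^esub> \<phi> (cls g)"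
        using top g unfolding top_algebra_iso_def carrier_O_def by blast
      then show ?thesis unfolding cls_smult[OF g] by (simp add: D_algebra_def)
    qed
    have "continuous_map (alg_top (O_def_algebra n r)) D.top \<phi>"
      using top homeomorphic_imp_continuous_map unfolding top_algebra_iso_def top_D_algebra by blast
    then show "continuous_map H.top D.top (\<phi> \<circ> cls)" by (rule continuous_map_compose[OF continuous_cls])
  qed (use z x f in auto)
  then show "\<phi> X = class_iso X" using f by (simp add: class_iso_class)
qed

end

theorem theorem6p3:
  fixes n :: nat and r :: ereal
  assumes "n \<ge> 1" and "r > 0"
  shows "\<exists>!\<phi>. \<phi> \<in> extensional (carrier (O_def_algebra n r)) \<and>
    top_algebra_iso (O_def_algebra n r) (D_algebra n r) \<phi> \<and>
    \<phi> (O_def_class n r hol_z) = D_z \<and>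
    (\<forall>i\<in>{1..n}. \<phi> (O_def_class n r (hol_zeta i)) = D_x i)"
proof -
  interpret deformation n r by unfold_locales (rule assms(2))
  have z: "hol_z \<in> hol_carrier n r" by (simp add: hol_z_eq hol_mono_mem)
  have x: "hol_zeta i \<in> hol_carrier n r" if "i \<in> {1..n}" for i
    using that by (simp add: hol_zeta_eq hol_mono_mem)
  show ?thesis
  proof (rule ex1I[of _ class_iso])
    show "class_iso \<in> extensional (carrier (O_def_algebra n r)) \<and>
      top_algebra_iso (O_def_algebra n r) (D_algebra n r) class_iso \<and> class_iso (cls hol_z) = D_z \<and>
      (\<forall>i\<in>{1..n}. class_iso (cls (hol_zeta i)) = D_x i)"
      using top_algebra_iso_class_iso class_iso_class[OF z] proj_z class_iso_class[OF x] proj_zeta by (simp add: class_iso_def)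
  qed (use class_iso_unique in blast)
qed

end
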